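(* In the setting described in the context, every finitely generated right $\Lambda$-module $M$ admits a partially minimal projective resolution.
   Context: Setting. $\mathcal R$ is a commutative Cohen–Macaulay noetherian local ring of Krull dimension $d$ with coefficient field $k$ and canonical module $\omega_{\mathcal R}$. $\mathcal E$ is an $\mathcal R$-linear (Hom-sets are finitely generated $\mathcal R$-modules, composition respects this structure) idempotent complete Frobenius exact category with an additive progenerator $P$, i.e. $\operatorname{add}P=\operatorname{proj}\mathcal E$. $\mathcal D$ is its stable category (same objects; morphisms modulo those factoring through projectives), triangulated, and assumed Krull–Schmidt. The object $X\in\mathcal E$ satisfies $X\cong P\oplus\bigoplus_{i=1}^nX_i^{a_i}$ with $a_i>0$ and $X_i$ pairwise non-isomorphic indecomposable objects of $\mathcal D$; $I=\{1,\dots,n\}$. Put $\Lambda=\mathrm{End}_{\mathcal E}(X)$, let $[\operatorname{proj}\mathcal E]\subseteq\Lambda$ be the ideal of maps $X\to X$ factoring through a projective object, and $\Lambda_{\mathrm{con}}=\Lambda/[\operatorname{proj}\mathcal E]=\mathrm{End}_{\mathcal D}(X)$. Let $e_i\in\Lambda$ be the idempotent projecting onto a summand $X_i$; $S_i=e_i\Lambda_{\mathrm{con}}/\operatorname{rad}(e_i\Lambda_{\mathrm{con}})$ ($i\in I$) are the simple right $\Lambda_{\mathrm{con}}$-modules up to isomorphism, and $\mathcal S=\bigoplus_{i\in I}S_i$. Modules are right modules. A projective resolution $\cdots\xrightarrow{f_2}Q_1\xrightarrow{f_1}Q_0\xrightarrow{f_0}M\to0$ by finitely generated $\Lambda$-modules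 is partially minimal if $\mathrm{Hom}_\Lambda(f_i,\mathcal S)=0$ for all $i>0$. *)

theory Defs
  imports "HOL-Library.Extended_Nat" "HOL-Algebra.Subrings" "HOL-Algebra.Ring_Divisibility"
begin

section \<open>Right modules over a (not necessarily commutative) ring\<close>

text \<open>The record of \<^locale>\<open>module\<close> is reused; for a right module, \<open>a \<odot> x\<close> is to be read as
  \<open>x \<cdot> a\<close>. Over a commutative ring this is the same notion as \<^locale>\<open>module\<close>. The fields
  \<^const>\<open>monoid.mult\<close> and \<^const>\<open>one\<close> of a module carry no meaning and are left undefined
  below.\<close>

locale right_module = R?: ring R + M?: abelian_group M
  for R :: "('r, 's) ring_scheme" (structure) and M :: "('r, 'm) module" (structure) +
  assumes smult_closed:
      "\<lbrakk>a \<in> carrier R; x \<in> carrier M\<rbrakk> \<Longrightarrow> a \<odot>\<^bsub>M\<^esub> x \<in> carrier M"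
    and smult_add_scalar:
      "\<lbrakk>a \<in> carrier R; b \<in> carrier R; x \<in> carrier M\<rbrakk>
        \<Longrightarrow> (a \<oplus>\<^bsub>R\<^esub> b) \<odot>\<^bsub>M\<^esub> x = a \<odot>\<^bsub>M\<^esub> x \<oplus>\<^bsub>M\<^esub> b \<odot>\<^bsub>M\<^esub> x"
    and smult_add_vector:
      "\<lbrakk>a \<in> carrier R; x \<in> carrier M; y \<in> carrier M\<rbrakk>
        \<Longrightarrow> a \<odot>\<^bsub>M\<^esub> (x \<oplus>\<^bsub>M\<^esub> y) = a \<odot>\<^bsub>M\<^esub> x \<oplus>\<^bsub>M\<^esub> a \<odot>\<^bsub>M\<^esub> y"
    and smult_mult:
      "\<lbrakk>a \<in> carrier R; b \<in> carrier R; x \<in> carrier M\<rbrakk>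
        \<Longrightarrow> (a \<otimes>\<^bsub>R\<^esub> b) \<odot>\<^bsub>M\<^esub> x = b \<odot>\<^bsub>M\<^esub> (a \<odot>\<^bsub>M\<^esub> x)"
    and smult_one:
      "x \<in> carrier M \<Longrightarrow> \<one>\<^bsub>R\<^esub> \<odot>\<^bsub>M\<^esub> x = x"

lemma module_imp_right_module:
  fixes M :: "('r, 'm) module"
  assumes "module R M"
  shows "right_module R M"
proof -
  interpret module R M by fact
  show ?thesis
    by unfold_locales
      (simp_all add: smult_l_distr smult_r_distr smult_assoc1 [symmetric] R.m_comm)
qed

definition fin_gen :: "('r, 's) ring_scheme \<Rightarrow> ('r, 'm) module \<Rightarrow> bool" where
  "fin_gen R M \<longleftrightarrow> (\<exists>A. finite A \<and> A \<subseteq> carrier M \<and>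
     (\<forall>x \<in> carrier M. \<exists>c \<in> A \<rightarrow> carrier R. x = (\<Oplus>\<^bsub>M\<^esub>a \<in> A. c a \<odot>\<^bsub>M\<^esub> a)))"

definition mod_hom ::
  "('r, 's) ring_scheme \<Rightarrow> ('r, 'm) module \<Rightarrow> ('r, 'n) module \<Rightarrow> ('m \<Rightarrow> 'n) set" where
  "mod_hom R M N = {f \<in> carrier M \<rightarrow> carrier N.
     (\<forall>x \<in> carrier M. \<forall>y \<in> carrier M. f (x \<oplus>\<^bsub>M\<^esub> y) = f x \<oplus>\<^bsub>N\<^esub> f y) \<and>
     (\<forall>a \<in> carrier R. \<forall>x \<in> carrier M. f (a \<odot>\<^bsub>M\<^esub> x) = a \<odot>\<^bsub>N\<^esub> f x)}"

definition mod_isomorphic ::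
  "('r, 's) ring_scheme \<Rightarrow> ('r, 'm) module \<Rightarrow> ('r, 'n) module \<Rightarrow> bool" where
  "mod_isomorphic R M N \<longleftrightarrow> (\<exists>f \<in> mod_hom R M N. bij_betw f (carrier M) (carrier N))"

definition quot_mod :: "('r, 'm) module \<Rightarrow> 'm set \<Rightarrow> ('r, 'm set) module" where
  "quot_mod M N = \<lparr>carrier = a_rcosets\<^bsub>M\<^esub> N, monoid.mult = undefined, one = undefined,
     ring.zero = N, add = set_add M, smult = (\<lambda>a A. \<Union>x\<in>A. N +>\<^bsub>M\<^esub> (a \<odot>\<^bsub>M\<^esub> x))\<rparr>"

definition dsum_mod :: "'i set \<Rightarrow> ('i \<Rightarrow> ('r, 'm) module) \<Rightarrow> ('r, 'i \<Rightarrow> 'm) module" where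
  "dsum_mod I M = \<lparr>carrier = (\<Pi>\<^sub>E i\<in>I. carrier (M i)), monoid.mult = undefined, one = undefined,
     ring.zero = (\<lambda>i\<in>I. \<zero>\<^bsub>M i\<^esub>), add = (\<lambda>x y. \<lambda>i\<in>I. x i \<oplus>\<^bsub>M i\<^esub> y i),
     smult = (\<lambda>a x. \<lambda>i\<in>I. a \<odot>\<^bsub>M i\<^esub> x i)\<rparr>"

definition restrict_scalars :: "('a \<Rightarrow> 'b) \<Rightarrow> ('b, 'm) module \<Rightarrow> ('a, 'm) module" where
  "restrict_scalars \<phi> M = \<lparr>carrier = carrier M, monoid.mult = undefined, one = undefined,
     ring.zero = \<zero>\<^bsub>M\<^esub>, add = add M, smult = (\<lambda>a x. \<phi> a \<odot>\<^bsub>M\<^esub> x)\<rparr>"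

text \<open>The right ideal \<open>eA\<close>, as a right \<open>A\<close>-module.\<close>

definition right_principal :: "('a, 's) ring_scheme \<Rightarrow> 'a \<Rightarrow> ('a, 'a) module" where
  "right_principal A e = \<lparr>carrier = (\<lambda>x. e \<otimes>\<^bsub>A\<^esub> x) ` carrier A, monoid.mult = undefined,
     one = undefined, ring.zero = \<zero>\<^bsub>A\<^esub>, add = add A, smult = (\<lambda>a x. x \<otimes>\<^bsub>A\<^esub> a)\<rparr>"

definition maximal_submodule ::
  "('r, 's) ring_scheme \<Rightarrow> ('r, 'm) module \<Rightarrow> 'm set \<Rightarrow> bool" where
  "maximal_submodule R M N \<longleftrightarrow> submodule N R M \<and> N \<noteq> carrier M \<and>
     (\<forall>L. submodule L R M \<longrightarrow> N \<subseteq> L \<longrightarrow> L = N \<or> L = carrier M)"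

definition mod_rad :: "('r, 's) ring_scheme \<Rightarrow> ('r, 'm) module \<Rightarrow> 'm set" where
  "mod_rad R M = carrier M \<inter> \<Inter>{N. maximal_submodule R M N}"

definition mod_top :: "('r, 's) ring_scheme \<Rightarrow> ('r, 'm) module \<Rightarrow> ('r, 'm set) module" where
  "mod_top R M = quot_mod M (mod_rad R M)"

text \<open>The lifting property. Quantification over modules has to be restricted to fixed carrier
  types; the ones below lose nothing, since the free module on the set \<^term>\<open>carrier Q\<close> lives on
  functions from \<open>'q\<close> to \<open>'r\<close>, so that lifting the identity along its canonical map onto \<open>Q\<close>
  exhibits \<open>Q\<close> as a direct summand of a free module.\<close>

definition projective_module :: "('r, 's) ring_scheme \<Rightarrow> ('r, 'q) module \<Rightarrow> bool" where
  "projective_module R Q \<longleftrightarrow> right_module R Q \<and>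
     (\<forall>(A :: ('r, 'q \<Rightarrow> 'r) module) (B :: ('r, 'q) module) g h.
        right_module R A \<longrightarrow> right_module R B \<longrightarrow>
        g \<in> mod_hom R A B \<longrightarrow> g ` carrier A = carrier B \<longrightarrow> h \<in> mod_hom R Q B \<longrightarrow>
        (\<exists>l \<in> mod_hom R Q A. \<forall>x \<in> carrier Q. g (l x) = h x))"

definition mod_ker :: "('r, 'm) module \<Rightarrow> ('r, 'n) module \<Rightarrow> ('m \<Rightarrow> 'n) \<Rightarrow> 'm set" where
  "mod_ker M N f = {x \<in> carrier M. f x = \<zero>\<^bsub>N\<^esub>}"

text \<open>\<open>\<epsilon>\<close> is the augmentation \<open>Q 0 \<rightarrow> M\<close>, and \<open>f i\<close> is the differential
  \<open>Q (Suc i) \<rightarrow> Q i\<close>. Finitely generated projective modules are, up to isomorphism, submodules of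
  some \<open>R\<^sup>k\<close>, so the carrier type \<open>nat \<Rightarrow> 'r\<close> is no restriction on them. With this
  indexing, partial minimality is a condition on every \<open>f i\<close> and none on \<open>\<epsilon>\<close>.\<close>

definition fg_projective_resolution ::
  "('r, 's) ring_scheme \<Rightarrow> ('r, 'm) module \<Rightarrow> (nat \<Rightarrow> ('r, nat \<Rightarrow> 'r) module) \<Rightarrow>
   ((nat \<Rightarrow> 'r) \<Rightarrow> 'm) \<Rightarrow> (nat \<Rightarrow> (nat \<Rightarrow> 'r) \<Rightarrow> (nat \<Rightarrow> 'r)) \<Rightarrow> bool" where
  "fg_projective_resolution R M Q \<epsilon> f \<longleftrightarrow>
     (\<forall>i. projective_module R (Q i) \<and> fin_gen R (Q i)) \<and>
     \<epsilon> \<in> mod_hom R (Q 0) M \<and> \<epsilon> ` carrier (Q 0) = carrier M \<and>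
     (\<forall>i. f i \<in> mod_hom R (Q (Suc i)) (Q i)) \<and>
     f 0 ` carrier (Q 1) = mod_ker (Q 0) M \<epsilon> \<and>
     (\<forall>i. f (Suc i) ` carrier (Q (Suc (Suc i))) = mod_ker (Q (Suc i)) (Q i) (f i))"

text \<open>\<open>Hom(f, S) = 0\<close>\<close>

definition hom_induced_zero ::
  "('r, 's) ring_scheme \<Rightarrow> ('r, 'm) module \<Rightarrow> ('r, 'n) module \<Rightarrow> ('m \<Rightarrow> 'n) \<Rightarrow>
   ('r, 't) module \<Rightarrow> bool" where
  "hom_induced_zero R M N f S \<longleftrightarrow>
     (\<forall>\<phi> \<in> mod_hom R N S. \<forall>x \<in> carrier M. \<phi> (f x) = \<zero>\<^bsub>S\<^esub>)"

definition partially_minimal ::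
  "('r, 's) ring_scheme \<Rightarrow> ('r, 't) module \<Rightarrow> (nat \<Rightarrow> ('r, 'q) module) \<Rightarrow>
   (nat \<Rightarrow> 'q \<Rightarrow> 'q) \<Rightarrow> bool" where
  "partially_minimal R S Q f \<longleftrightarrow> (\<forall>i. hom_induced_zero R (Q (Suc i)) (Q i) (f i) S)"


section \<open>Commutative local rings\<close>

definition local_cring :: "'r ring \<Rightarrow> 'r set \<Rightarrow> bool" where
  "local_cring R \<mm> \<longleftrightarrow> cring R \<and> maximalideal \<mm> R \<and> (\<forall>J. maximalideal J R \<longrightarrow> J = \<mm>)"

definition krull_dim :: "'r ring \<Rightarrow> enat" where
  "krull_dim R = (SUP l \<in> {l :: nat. \<exists>p. (\<forall>i\<le>l. primeideal (p i) R) \<and>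
     (\<forall>i<l. p i \<subset> p (Suc i))}. enat l)"

definition regular_sequence :: "'r ring \<Rightarrow> 'r list \<Rightarrow> bool" where
  "regular_sequence R xs \<longleftrightarrow> set xs \<subseteq> carrier R \<and>
     (\<forall>i < length xs. \<forall>y \<in> carrier R.
        xs ! i \<otimes>\<^bsub>R\<^esub> y \<in> Idl\<^bsub>R\<^esub> (set (take i xs)) \<longrightarrow> y \<in> Idl\<^bsub>R\<^esub> (set (take i xs))) \<and>
     Idl\<^bsub>R\<^esub> (set xs) \<noteq> carrier R"

definition local_depth :: "'r ring \<Rightarrow> 'r set \<Rightarrow> enat" where
  "local_depth R \<mm> = (SUP xs \<in> {xs. regular_sequence R xs \<and> set xs \<subseteq> \<mm>}. enat (length xs))"

definition cohen_macaulay_local :: "'r ring \<Rightarrow> 'r set \<Rightarrow> bool" where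
  "cohen_macaulay_local R \<mm> \<longleftrightarrow>
     local_cring R \<mm> \<and> noetherian_ring R \<and> local_depth R \<mm> = krull_dim R"

definition coefficient_field :: "'r ring \<Rightarrow> 'r set \<Rightarrow> 'r set \<Rightarrow> bool" where
  "coefficient_field R \<mm> k \<longleftrightarrow>
     subfield k R \<and> bij_betw (\<lambda>x. \<mm> +>\<^bsub>R\<^esub> x) k (carrier (R Quot \<mm>))"

definition residue_module :: "'r ring \<Rightarrow> 'r set \<Rightarrow> ('r, 'r set) module" where
  "residue_module R \<mm> = quot_mod (right_principal R \<one>\<^bsub>R\<^esub>) \<mm>"

definition hom_mod :: "'r ring \<Rightarrow> ('r, 'm) module \<Rightarrow> ('r, 'n) module \<Rightarrow> ('r, 'm \<Rightarrow> 'n) module" where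
  "hom_mod R M N = \<lparr>carrier = mod_hom R M N \<inter> extensional (carrier M), monoid.mult = undefined,
     one = undefined, ring.zero = (\<lambda>x\<in>carrier M. \<zero>\<^bsub>N\<^esub>),
     add = (\<lambda>f g. \<lambda>x\<in>carrier M. f x \<oplus>\<^bsub>N\<^esub> g x), smult = (\<lambda>a f. \<lambda>x\<in>carrier M. a \<odot>\<^bsub>N\<^esub> f x)\<rparr>"

text \<open>The cohomology of \<open>Hom(F, N)\<close> in degree \<open>i\<close>; when \<open>F\<close> is a projective resolution of
  \<open>L\<close> this is \<open>Ext\<^sup>i(L, N)\<close>.\<close>

definition hom_cocycles ::
  "'r ring \<Rightarrow> (nat \<Rightarrow> ('r, 'q) module) \<Rightarrow> (nat \<Rightarrow> 'q \<Rightarrow> 'q) \<Rightarrow> ('r, 'n) module \<Rightarrow> nat \<Rightarrow>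
   ('q \<Rightarrow> 'n) set" where
  "hom_cocycles R F f N i = {\<phi> \<in> carrier (hom_mod R (F i) N).
     \<forall>x \<in> carrier (F (Suc i)). \<phi> (f i x) = \<zero>\<^bsub>N\<^esub>}"

fun hom_coboundaries ::
  "'r ring \<Rightarrow> (nat \<Rightarrow> ('r, 'q) module) \<Rightarrow> (nat \<Rightarrow> 'q \<Rightarrow> 'q) \<Rightarrow> ('r, 'n) module \<Rightarrow> nat \<Rightarrow>
   ('q \<Rightarrow> 'n) set" where
  "hom_coboundaries R F f N 0 = {\<zero>\<^bsub>hom_mod R (F 0) N\<^esub>}"
| "hom_coboundaries R F f N (Suc i) =
     (\<lambda>\<phi>. \<lambda>x\<in>carrier (F (Suc i)). \<phi> (f i x)) ` carrier (hom_mod R (F i) N)"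

definition hom_cohomology ::
  "'r ring \<Rightarrow> (nat \<Rightarrow> ('r, 'q) module) \<Rightarrow> (nat \<Rightarrow> 'q \<Rightarrow> 'q) \<Rightarrow> ('r, 'n) module \<Rightarrow> nat \<Rightarrow>
   ('r, ('q \<Rightarrow> 'n) set) module" where
  "hom_cohomology R F f N i =
     quot_mod (hom_mod R (F i) N \<lparr>carrier := hom_cocycles R F f N i\<rparr>)
       (hom_coboundaries R F f N i)"

text \<open>A canonical module of a Cohen--Macaulay local ring \<open>R\<close> of dimension \<open>d\<close> with residue field
  \<open>\<kappa>\<close>: a finitely generated module with \<open>Ext\<^sup>i(\<kappa>, \<omega>)\<close> isomorphic to \<open>\<kappa>\<close> for \<open>i = d\<close> and zero
  otherwise (Bruns--Herzog, Section 3.3). Since \<open>Ext\<close> does not depend on the resolution of \<open>\<kappa>\<close>,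
  it is computed from some resolution by finitely generated projectives.\<close>

definition canonical_module :: "'r ring \<Rightarrow> 'r set \<Rightarrow> ('r, 'w) module \<Rightarrow> bool" where
  "canonical_module R \<mm> \<omega> \<longleftrightarrow> module R \<omega> \<and> fin_gen R \<omega> \<and>
     (\<exists>F \<epsilon> f. fg_projective_resolution R (residue_module R \<mm>) F \<epsilon> f \<and>
       (\<forall>i. if enat i = krull_dim R
            then mod_isomorphic R (hom_cohomology R F f \<omega> i) (residue_module R \<mm>)
            else carrier (hom_cohomology R F f \<omega> i) = {\<zero>\<^bsub>hom_cohomology R F f \<omega> i\<^esub>}))"


section \<open>Linear categories\<close>

text \<open>Morphism sets of different pairs of objects may overlap, so composition takes the objects as
  arguments: \<open>Comp \<C> A B C g f\<close> is \<open>g \<circ> f\<close> for \<open>f : A \<rightarrow> B\<close> and \<open>g : B \<rightarrow> C\<close>.\<close>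

record ('r, 'o, 'm) lincat =
  Obj :: "'o set"
  Hom :: "'o \<Rightarrow> 'o \<Rightarrow> ('r, 'm) module"
  Id :: "'o \<Rightarrow> 'm"
  Comp :: "'o \<Rightarrow> 'o \<Rightarrow> 'o \<Rightarrow> 'm \<Rightarrow> 'm \<Rightarrow> 'm"

abbreviation Mor :: "('r, 'o, 'm) lincat \<Rightarrow> 'o \<Rightarrow> 'o \<Rightarrow> 'm set" where
  "Mor \<C> A B \<equiv> carrier (Hom \<C> A B)"

locale linear_category =
  fixes R :: "'r ring" and \<C> :: "('r, 'o, 'm) lincat"
  assumes hom_module:
      "\<lbrakk>A \<in> Obj \<C>; B \<in> Obj \<C>\<rbrakk> \<Longrightarrow> module R (Hom \<C> A B)"
    and id_closed: "A \<in> Obj \<C> \<Longrightarrow> Id \<C> A \<in> Mor \<C> A A"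
    and comp_closed:
      "\<lbrakk>A \<in> Obj \<C>; B \<in> Obj \<C>; C \<in> Obj \<C>; f \<in> Mor \<C> A B; g \<in> Mor \<C> B C\<rbrakk>
        \<Longrightarrow> Comp \<C> A B C g f \<in> Mor \<C> A C"
    and comp_id_left:
      "\<lbrakk>A \<in> Obj \<C>; B \<in> Obj \<C>; f \<in> Mor \<C> A B\<rbrakk> \<Longrightarrow> Comp \<C> A B B (Id \<C> B) f = f"
    and comp_id_right:
      "\<lbrakk>A \<in> Obj \<C>; B \<in> Obj \<C>; f \<in> Mor \<C> A B\<rbrakk> \<Longrightarrow> Comp \<C> A A B f (Id \<C> A) = f"
    and comp_assoc:
      "\<lbrakk>A \<in> Obj \<C>; B \<in> Obj \<C>; C \<in> Obj \<C>; D \<in> Obj \<C>;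
        f \<in> Mor \<C> A B; g \<in> Mor \<C> B C; h \<in> Mor \<C> C D\<rbrakk>
        \<Longrightarrow> Comp \<C> A B D (Comp \<C> B C D h g) f = Comp \<C> A C D h (Comp \<C> A B C g f)"
    and comp_add_left:
      "\<lbrakk>A \<in> Obj \<C>; B \<in> Obj \<C>; C \<in> Obj \<C>; f \<in> Mor \<C> A B; g \<in> Mor \<C> B C; g' \<in> Mor \<C> B C\<rbrakk>
        \<Longrightarrow> Comp \<C> A B C (g \<oplus>\<^bsub>Hom \<C> B C\<^esub> g') f
            = Comp \<C> A B C g f \<oplus>\<^bsub>Hom \<C> A C\<^esub> Comp \<C> A B C g' f"
    and comp_add_right:
      "\<lbrakk>A \<in> Obj \<C>; B \<in> Obj \<C>; C \<in> Obj \<C>; f \<in> Mor \<C> A B; f' \<in> Mor \<C> A B; g \<in> Mor \<C> B C\<rbrakk>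
        \<Longrightarrow> Comp \<C> A B C g (f \<oplus>\<^bsub>Hom \<C> A B\<^esub> f')
            = Comp \<C> A B C g f \<oplus>\<^bsub>Hom \<C> A C\<^esub> Comp \<C> A B C g f'"
    and comp_smult_left:
      "\<lbrakk>A \<in> Obj \<C>; B \<in> Obj \<C>; C \<in> Obj \<C>; r \<in> carrier R; f \<in> Mor \<C> A B; g \<in> Mor \<C> B C\<rbrakk>
        \<Longrightarrow> Comp \<C> A B C (r \<odot>\<^bsub>Hom \<C> B C\<^esub> g) f = r \<odot>\<^bsub>Hom \<C> A C\<^esub> Comp \<C> A B C g f"
    and comp_smult_right:
      "\<lbrakk>A \<in> Obj \<C>; B \<in> Obj \<C>; C \<in> Obj \<C>; r \<in> carrier R; f \<in> Mor \<C> A B; g \<in> Mor \<C> B C\<rbrakk>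
        \<Longrightarrow> Comp \<C> A B C g (r \<odot>\<^bsub>Hom \<C> A B\<^esub> f) = r \<odot>\<^bsub>Hom \<C> A C\<^esub> Comp \<C> A B C g f"

locale hom_finite_linear_category = linear_category +
  assumes hom_fin_gen: "\<lbrakk>A \<in> Obj \<C>; B \<in> Obj \<C>\<rbrakk> \<Longrightarrow> fin_gen R (Hom \<C> A B)"

definition End_ring :: "('r, 'o, 'm) lincat \<Rightarrow> 'o \<Rightarrow> 'm ring" where
  "End_ring \<C> X = \<lparr>carrier = Mor \<C> X X, monoid.mult = Comp \<C> X X X, one = Id \<C> X,
     ring.zero = \<zero>\<^bsub>Hom \<C> X X\<^esub>, add = add (Hom \<C> X X)\<rparr>"

lemma (in linear_category) End_ring_is_ring:
  assumes "X \<in> Obj \<C>"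
  shows "ring (End_ring \<C> X)"
proof -
  interpret H: module R "Hom \<C> X X" by (rule hom_module [OF assms assms])
  have inv: "\<exists>y \<in> Mor \<C> X X. y \<oplus>\<^bsub>Hom \<C> X X\<^esub> x = \<zero>\<^bsub>Hom \<C> X X\<^esub>"
    if "x \<in> Mor \<C> X X" for x
    using that H.M.l_neg by blast
  have "abelian_group (End_ring \<C> X)"
    by (rule abelian_groupI) (auto simp: End_ring_def H.M.a_ac inv)
  then show ?thesis
    by (intro ringI monoidI)
      (auto simp: End_ring_def assms id_closed comp_closed comp_assoc comp_id_left comp_id_right
        comp_add_left comp_add_right)
qed

definition is_iso :: "('r, 'o, 'm) lincat \<Rightarrow> 'o \<Rightarrow> 'o \<Rightarrow> 'm \<Rightarrow> bool" where
  "is_iso \<C> A B f \<longleftrightarrow> f \<in> Mor \<C> A B \<and>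
     (\<exists>g \<in> Mor \<C> B A. Comp \<C> A B A g f = Id \<C> A \<and> Comp \<C> B A B f g = Id \<C> B)"

definition isomorphic :: "('r, 'o, 'm) lincat \<Rightarrow> 'o \<Rightarrow> 'o \<Rightarrow> bool" where
  "isomorphic \<C> A B \<longleftrightarrow> (\<exists>f. is_iso \<C> A B f)"

definition zero_object :: "('r, 'o, 'm) lincat \<Rightarrow> 'o \<Rightarrow> bool" where
  "zero_object \<C> A \<longleftrightarrow> A \<in> Obj \<C> \<and> Id \<C> A = \<zero>\<^bsub>Hom \<C> A A\<^esub>"

text \<open>\<open>Y\<close> is a direct sum (biproduct) of the finite family \<open>F\<close> with injections \<open>\<iota>\<close> and
  projections \<open>\<pi>\<close>. As \<open>Y\<close> is any object carrying such data, this says that \<open>Y\<close> is isomorphic to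
  the direct sum.\<close>

definition direct_sum ::
  "('r, 'o, 'm) lincat \<Rightarrow> 'i set \<Rightarrow> ('i \<Rightarrow> 'o) \<Rightarrow> 'o \<Rightarrow> ('i \<Rightarrow> 'm) \<Rightarrow> ('i \<Rightarrow> 'm) \<Rightarrow> bool" where
  "direct_sum \<C> J F Y \<iota> \<pi> \<longleftrightarrow> finite J \<and> Y \<in> Obj \<C> \<and>
     (\<forall>j\<in>J. F j \<in> Obj \<C> \<and> \<iota> j \<in> Mor \<C> (F j) Y \<and> \<pi> j \<in> Mor \<C> Y (F j)) \<and>
     (\<forall>j\<in>J. \<forall>l\<in>J. Comp \<C> (F j) Y (F l) (\<pi> l) (\<iota> j)
        = (if j = l then Id \<C> (F j) else \<zero>\<^bsub>Hom \<C> (F j) (F l)\<^esub>)) \<and>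
     (\<Oplus>\<^bsub>Hom \<C> Y Y\<^esub>j \<in> J. Comp \<C> Y (F j) Y (\<iota> j) (\<pi> j)) = Id \<C> Y"

definition is_direct_sum ::
  "('r, 'o, 'm) lincat \<Rightarrow> 'i set \<Rightarrow> ('i \<Rightarrow> 'o) \<Rightarrow> 'o \<Rightarrow> bool" where
  "is_direct_sum \<C> J F Y \<longleftrightarrow> (\<exists>\<iota> \<pi>. direct_sum \<C> J F Y \<iota> \<pi>)"

text \<open>The case \<open>n = 0\<close> is the existence of a zero object.\<close>

locale additive_category = linear_category +
  assumes finite_direct_sums:
    "\<And>(n :: nat) F. (\<And>j. j < n \<Longrightarrow> F j \<in> Obj \<C>) \<Longrightarrow> \<exists>Y. is_direct_sum \<C> {..<n} F Y"

definition is_binary_sum :: "('r, 'o, 'm) lincat \<Rightarrow> 'o \<Rightarrow> 'o \<Rightarrow> 'o \<Rightarrow> bool" where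
  "is_binary_sum \<C> A B Y \<longleftrightarrow> is_direct_sum \<C> UNIV (\<lambda>b. if b then A else B) Y"

definition in_add :: "('r, 'o, 'm) lincat \<Rightarrow> 'o \<Rightarrow> 'o \<Rightarrow> bool" where
  "in_add \<C> P A \<longleftrightarrow> (\<exists>(n :: nat) Y B. is_direct_sum \<C> {..<n} (\<lambda>_. P) Y \<and> is_binary_sum \<C> A B Y)"

definition idempotent_complete :: "('r, 'o, 'm) lincat \<Rightarrow> bool" where
  "idempotent_complete \<C> \<longleftrightarrow> (\<forall>A \<in> Obj \<C>. \<forall>e \<in> Mor \<C> A A. Comp \<C> A A A e e = e \<longrightarrow>
     (\<exists>B \<in> Obj \<C>. \<exists>r \<in> Mor \<C> A B. \<exists>s \<in> Mor \<C> B A.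
        Comp \<C> A B A s r = e \<and> Comp \<C> B A B r s = Id \<C> B))"

definition indecomposable :: "('r, 'o, 'm) lincat \<Rightarrow> 'o \<Rightarrow> bool" where
  "indecomposable \<C> A \<longleftrightarrow> A \<in> Obj \<C> \<and> \<not> zero_object \<C> A \<and>
     (\<forall>B C. is_binary_sum \<C> B C A \<longrightarrow> zero_object \<C> B \<or> zero_object \<C> C)"

text \<open>Local rings, not necessarily commutative: nonzero, with non-units closed under addition.\<close>

definition nc_local_ring :: "('a, 's) ring_scheme \<Rightarrow> bool" where
  "nc_local_ring A \<longleftrightarrow> ring A \<and> \<one>\<^bsub>A\<^esub> \<noteq> \<zero>\<^bsub>A\<^esub> \<and>
     (\<forall>x \<in> carrier A - Units A. \<forall>y \<in> carrier A - Units A. x \<oplus>\<^bsub>A\<^esub> y \<notin> Units A)"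

definition krull_schmidt :: "('r, 'o, 'm) lincat \<Rightarrow> bool" where
  "krull_schmidt \<C> \<longleftrightarrow> (\<forall>A \<in> Obj \<C>. \<exists>(n :: nat) F. is_direct_sum \<C> {..<n} F A \<and>
     (\<forall>j<n. nc_local_ring (End_ring \<C> (F j))))"


section \<open>Exact and Frobenius categories\<close>

definition kernel_cokernel_pair ::
  "('r, 'o, 'm) lincat \<Rightarrow> 'o \<Rightarrow> 'o \<Rightarrow> 'o \<Rightarrow> 'm \<Rightarrow> 'm \<Rightarrow> bool" where
  "kernel_cokernel_pair \<C> A B C i p \<longleftrightarrow>
     A \<in> Obj \<C> \<and> B \<in> Obj \<C> \<and> C \<in> Obj \<C> \<and> i \<in> Mor \<C> A B \<and> p \<in> Mor \<C> B C \<and>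
     Comp \<C> A B C p i = \<zero>\<^bsub>Hom \<C> A C\<^esub> \<and>
     (\<forall>T \<in> Obj \<C>. \<forall>f \<in> Mor \<C> T B. Comp \<C> T B C p f = \<zero>\<^bsub>Hom \<C> T C\<^esub> \<longrightarrow>
        (\<exists>!g. g \<in> Mor \<C> T A \<and> Comp \<C> T A B i g = f)) \<and>
     (\<forall>T \<in> Obj \<C>. \<forall>f \<in> Mor \<C> B T. Comp \<C> A B T f i = \<zero>\<^bsub>Hom \<C> A T\<^esub> \<longrightarrow>
        (\<exists>!g. g \<in> Mor \<C> C T \<and> Comp \<C> B C T g p = f))"

text \<open>The square with sides \<open>i : A \<rightarrow> B\<close>, \<open>f : A \<rightarrow> A'\<close>, \<open>i' : A' \<rightarrow> B'\<close>, \<open>f' : B \<rightarrow> B'\<close>.\<close>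

definition pushout ::
  "('r, 'o, 'm) lincat \<Rightarrow> 'o \<Rightarrow> 'o \<Rightarrow> 'o \<Rightarrow> 'o \<Rightarrow> 'm \<Rightarrow> 'm \<Rightarrow> 'm \<Rightarrow> 'm \<Rightarrow> bool" where
  "pushout \<C> A B A' B' i f i' f' \<longleftrightarrow>
     B' \<in> Obj \<C> \<and> i' \<in> Mor \<C> A' B' \<and> f' \<in> Mor \<C> B B' \<and>
     Comp \<C> A B B' f' i = Comp \<C> A A' B' i' f \<and>
     (\<forall>T \<in> Obj \<C>. \<forall>u \<in> Mor \<C> B T. \<forall>v \<in> Mor \<C> A' T. Comp \<C> A B T u i = Comp \<C> A A' T v f \<longrightarrow>
        (\<exists>!w. w \<in> Mor \<C> B' T \<and> Comp \<C> B B' T w f' = u \<and> Comp \<C> A' B' T w i' = v))"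

text \<open>The square with sides \<open>p : B \<rightarrow> C\<close>, \<open>f : C' \<rightarrow> C\<close>, \<open>p' : B' \<rightarrow> C'\<close>, \<open>f' : B' \<rightarrow> B\<close>.\<close>

definition pullback ::
  "('r, 'o, 'm) lincat \<Rightarrow> 'o \<Rightarrow> 'o \<Rightarrow> 'o \<Rightarrow> 'o \<Rightarrow> 'm \<Rightarrow> 'm \<Rightarrow> 'm \<Rightarrow> 'm \<Rightarrow> bool" where
  "pullback \<C> B C B' C' p f p' f' \<longleftrightarrow>
     B' \<in> Obj \<C> \<and> p' \<in> Mor \<C> B' C' \<and> f' \<in> Mor \<C> B' B \<and>
     Comp \<C> B' B C p f' = Comp \<C> B' C' C f p' \<and>
     (\<forall>T \<in> Obj \<C>. \<forall>u \<in> Mor \<C> T B. \<forall>v \<in> Mor \<C> T C'. Comp \<C> T B C p u = Comp \<C> T C' C f v \<longrightarrow>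
        (\<exists>!w. w \<in> Mor \<C> T B' \<and> Comp \<C> T B' B f' w = u \<and> Comp \<C> T B' C' p' w = v))"

type_synonym ('o, 'm) conflations = "'o \<Rightarrow> 'o \<Rightarrow> 'o \<Rightarrow> 'm \<Rightarrow> 'm \<Rightarrow> bool"

definition inflation :: "('o, 'm) conflations \<Rightarrow> 'o \<Rightarrow> 'o \<Rightarrow> 'm \<Rightarrow> bool" where
  "inflation \<K> A B i \<longleftrightarrow> (\<exists>C p. \<K> A B C i p)"

definition deflation :: "('o, 'm) conflations \<Rightarrow> 'o \<Rightarrow> 'o \<Rightarrow> 'm \<Rightarrow> bool" where
  "deflation \<K> B C p \<longleftrightarrow> (\<exists>A i. \<K> A B C i p)"

text \<open>Quillen's axioms for the class \<open>\<K>\<close> of conflations (short exact sequences), in the form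
  given by Buehler.\<close>

locale exact_category = additive_category +
  fixes \<K> :: "('o, 'm) conflations"
  assumes conflation_kc: "\<K> A B C i p \<Longrightarrow> kernel_cokernel_pair \<C> A B C i p"
    and conflation_iso:
      "\<lbrakk>\<K> A B C i p; A' \<in> Obj \<C>; B' \<in> Obj \<C>; C' \<in> Obj \<C>;
        is_iso \<C> A A' a; is_iso \<C> B B' b; is_iso \<C> C C' c;
        i' \<in> Mor \<C> A' B'; p' \<in> Mor \<C> B' C';
        Comp \<C> A B B' b i = Comp \<C> A A' B' i' a; Comp \<C> B C C' c p = Comp \<C> B B' C' p' b\<rbrakk>
        \<Longrightarrow> \<K> A' B' C' i' p'"
    and inflation_id: "A \<in> Obj \<C> \<Longrightarrow> inflation \<K> A A (Id \<C> A)"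
    and deflation_id: "A \<in> Obj \<C> \<Longrightarrow> deflation \<K> A A (Id \<C> A)"
    and inflation_comp:
      "\<lbrakk>inflation \<K> A B i; inflation \<K> B C j\<rbrakk> \<Longrightarrow> inflation \<K> A C (Comp \<C> A B C j i)"
    and deflation_comp:
      "\<lbrakk>deflation \<K> A B p; deflation \<K> B C q\<rbrakk> \<Longrightarrow> deflation \<K> A C (Comp \<C> A B C q p)"
    and inflation_pushout:
      "\<lbrakk>inflation \<K> A B i; A' \<in> Obj \<C>; f \<in> Mor \<C> A A'\<rbrakk>
        \<Longrightarrow> \<exists>B' i' f'. pushout \<C> A B A' B' i f i' f' \<and> inflation \<K> A' B' i'"
    and deflation_pullback:
      "\<lbrakk>deflation \<K> B C p; C' \<in> Obj \<C>; f \<in> Mor \<C> C' C\<rbrakk>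
        \<Longrightarrow> \<exists>B' p' f'. pullback \<C> B C B' C' p f p' f' \<and> deflation \<K> B' C' p'"

definition proj_object :: "('r, 'o, 'm) lincat \<Rightarrow> ('o, 'm) conflations \<Rightarrow> 'o \<Rightarrow> bool" where
  "proj_object \<C> \<K> Q \<longleftrightarrow> Q \<in> Obj \<C> \<and>
     (\<forall>B C p f. deflation \<K> B C p \<longrightarrow> f \<in> Mor \<C> Q C \<longrightarrow>
        (\<exists>g \<in> Mor \<C> Q B. Comp \<C> Q B C p g = f))"

definition inj_object :: "('r, 'o, 'm) lincat \<Rightarrow> ('o, 'm) conflations \<Rightarrow> 'o \<Rightarrow> bool" where
  "inj_object \<C> \<K> J \<longleftrightarrow> J \<in> Obj \<C> \<and>
     (\<forall>A B i f. inflation \<K> A B i \<longrightarrow> f \<in> Mor \<C> A J \<longrightarrow>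
        (\<exists>g \<in> Mor \<C> B J. Comp \<C> A B J g i = f))"

locale frobenius_category = exact_category +
  assumes enough_projectives: "A \<in> Obj \<C> \<Longrightarrow> \<exists>Q p. proj_object \<C> \<K> Q \<and> deflation \<K> Q A p"
    and enough_injectives: "A \<in> Obj \<C> \<Longrightarrow> \<exists>J i. inj_object \<C> \<K> J \<and> inflation \<K> A J i"
    and proj_iff_inj: "proj_object \<C> \<K> A \<longleftrightarrow> inj_object \<C> \<K> A"

definition additive_progenerator ::
  "('r, 'o, 'm) lincat \<Rightarrow> ('o, 'm) conflations \<Rightarrow> 'o \<Rightarrow> bool" where
  "additive_progenerator \<C> \<K> P \<longleftrightarrow>
     P \<in> Obj \<C> \<and> {A \<in> Obj \<C>. in_add \<C> P A} = {A \<in> Obj \<C>. proj_object \<C> \<K> A}"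

text \<open>The morphisms \<open>A \<rightarrow> B\<close> that factor through a projective object.\<close>

definition proj_ideal ::
  "('r, 'o, 'm) lincat \<Rightarrow> ('o, 'm) conflations \<Rightarrow> 'o \<Rightarrow> 'o \<Rightarrow> 'm set" where
  "proj_ideal \<C> \<K> A B = {h. \<exists>Q f g. proj_object \<C> \<K> Q \<and> f \<in> Mor \<C> A Q \<and> g \<in> Mor \<C> Q B \<and>
     h = Comp \<C> A Q B g f}"

definition stable_category ::
  "('r, 'o, 'm) lincat \<Rightarrow> ('o, 'm) conflations \<Rightarrow> ('r, 'o, 'm set) lincat" where
  "stable_category \<C> \<K> = \<lparr>Obj = Obj \<C>,
     Hom = (\<lambda>A B. quot_mod (Hom \<C> A B) (proj_ideal \<C> \<K> A B)),
     Id = (\<lambda>A. proj_ideal \<C> \<K> A A +>\<^bsub>Hom \<C> A A\<^esub> Id \<C> A),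
     Comp = (\<lambda>A B C G F. \<Union>g\<in>G. \<Union>f\<in>F. proj_ideal \<C> \<K> A C +>\<^bsub>Hom \<C> A C\<^esub> Comp \<C> A B C g f)\<rparr>"

text \<open>The contraction algebra \<open>\<Lambda>\<^sub>c\<^sub>o\<^sub>n = \<Lambda> / [proj]\<close>, where \<open>\<Lambda>\<close> is the endomorphism ring of \<open>X\<close>.\<close>

definition contraction_algebra ::
  "('r, 'o, 'm) lincat \<Rightarrow> ('o, 'm) conflations \<Rightarrow> 'o \<Rightarrow> 'm set ring" where
  "contraction_algebra \<C> \<K> X = End_ring \<C> X Quot proj_ideal \<C> \<K> X X"

lemma contraction_algebra_eq_stable_End:
  "contraction_algebra \<C> \<K> X = End_ring (stable_category \<C> \<K>) X"
  by (simp add: contraction_algebra_def FactRing_def End_ring_def stable_category_def quot_mod_def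
      A_RCOSETS_def RCOSETS_def a_r_coset_def r_coset_def set_add_def set_mult_def
      rcoset_mult_def fun_eq_iff)

definition contraction_simple ::
  "('r, 'o, 'm) lincat \<Rightarrow> ('o, 'm) conflations \<Rightarrow> 'o \<Rightarrow> 'm \<Rightarrow> ('m set, 'm set set) module" where
  "contraction_simple \<C> \<K> X e = mod_top (contraction_algebra \<C> \<K> X)
     (right_principal (contraction_algebra \<C> \<K> X) (proj_ideal \<C> \<K> X X +>\<^bsub>End_ring \<C> X\<^esub> e))"

text \<open>The direct sum of the modules \<open>S\<^sub>i = e\<^sub>i\<Lambda>\<^sub>c\<^sub>o\<^sub>n / rad(e\<^sub>i\<Lambda>\<^sub>c\<^sub>o\<^sub>n)\<close>, viewed as a \<open>\<Lambda>\<close>-module along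
  the quotient map \<open>\<Lambda> \<rightarrow> \<Lambda>\<^sub>c\<^sub>o\<^sub>n\<close>.\<close>

definition sum_of_simples ::
  "('r, 'o, 'm) lincat \<Rightarrow> ('o, 'm) conflations \<Rightarrow> 'o \<Rightarrow> 'i set \<Rightarrow> ('i \<Rightarrow> 'm) \<Rightarrow>
   ('m, 'i \<Rightarrow> 'm set set) module" where
  "sum_of_simples \<C> \<K> X I e = restrict_scalars (\<lambda>a. proj_ideal \<C> \<K> X X +>\<^bsub>End_ring \<C> X\<^esub> a)
     (dsum_mod I (\<lambda>i. contraction_simple \<C> \<K> X (e i)))"

end

theory Submission
  imports Defs
begin

text \<open>Let \<open>e\<^sub>0 \<in> \<Lambda>\<close> be the idempotent of the summand \<open>P\<close>, so that \<open>[proj] = \<Lambda>e\<^sub>0\<Lambda>\<close>. For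
  \<open>i \<ge> 1\<close> the corner of \<open>\<Lambda>/[proj]\<close> at \<open>e\<^sub>i\<close> is local, because \<open>X\<^sub>i\<close> is indecomposable in a
  Krull--Schmidt category. A finitely generated module \<open>M\<close> has finitely many generators
  \<open>m\<^sub>t \<in> Me\<^sub>i\<close>, where \<open>i = i(t)\<close>; take them with as few as possible having \<open>i(t) \<noteq> 0\<close>, and
  consider the surjection \<open>Q \<rightarrow> M\<close> from the sum \<open>Q\<close> of the modules \<open>e\<^sub>i\<Lambda>\<close>, \<open>i = i(t)\<close>. If some
  homomorphism from \<open>Q\<close> to a simple module \<open>S\<^sub>j\<close> did not vanish at an element \<open>x\<close> of the kernel,
  then by locality some coordinate of a multiple of \<open>x\<close>, with \<open>i = i(t) \<noteq> 0\<close>, would be congruent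
  to \<open>e\<^sub>i\<close> modulo \<open>\<Lambda>e\<^sub>0\<Lambda>\<close>. So \<open>m\<^sub>t\<close> could be replaced by elements of \<open>Me\<^sub>0\<close>, against
  minimality. Since \<open>\<Lambda>\<close> is right noetherian, the kernel is finitely generated and the
  construction can be iterated.\<close>

subsection \<open>Spans and noetherian modules\<close>

text \<open>A minimal projective cover of M need not exist: R is not assumed complete, so \<Lambda>
  need not be semiperfect. Locality is available only modulo [proj], but Hom into the S_i sees only
  the summands e_i\<Lambda> with i >= 1. Hence only generators of nonzero type are counted, and
  generators in Me_0 may be added freely, provided there are finitely many.

  The equality [proj] = \<Lambda>e_0\<Lambda> comes from proj = add P: a map through a projective is
  a map through some P^n, hence a sum of maps through P. One idempotent for each type is enough,
  because the projection onto another copy of X_i in X factors through the chosen copy; so 1 still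
  lies in the sum of the ideals \<Lambda>e_i\<Lambda>, and every M has generators in the Me_i.
  Finally \<Lambda> is right noetherian because its right ideals are R-submodules of the finitely
  generated R-module Hom(X, X).\<close>

context right_module
begin

lemma smult_zero_scalar [simp]: "x \<in> carrier M \<Longrightarrow> \<zero>\<^bsub>R\<^esub> \<odot>\<^bsub>M\<^esub> x = \<zero>\<^bsub>M\<^esub>"
  by (metis M.add.r_cancel_one' R.l_zero R.zero_closed smult_add_scalar smult_closed)

lemma smult_zero_vector [simp]: "a \<in> carrier R \<Longrightarrow> a \<odot>\<^bsub>M\<^esub> \<zero>\<^bsub>M\<^esub> = \<zero>\<^bsub>M\<^esub>"
  by (metis M.add.r_cancel_one' M.l_zero M.zero_closed smult_add_vector smult_closed)

lemma smult_minus_one: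
  assumes "x \<in> carrier M"
  shows "(\<ominus>\<^bsub>R\<^esub> \<one>\<^bsub>R\<^esub>) \<odot>\<^bsub>M\<^esub> x = \<ominus>\<^bsub>M\<^esub> x"
proof -
  have "(\<ominus>\<^bsub>R\<^esub> \<one>\<^bsub>R\<^esub>) \<odot>\<^bsub>M\<^esub> x \<oplus>\<^bsub>M\<^esub> x = \<zero>\<^bsub>M\<^esub>"
    using assms smult_add_scalar [of "\<ominus>\<^bsub>R\<^esub> \<one>\<^bsub>R\<^esub>" "\<one>\<^bsub>R\<^esub>" x] by (simp add: R.l_neg smult_one)
  then show ?thesis
    using assms by (simp add: M.minus_equality smult_closed)
qed

text \<open>Closure under negatives follows from closure under the action, because -x is the action
  of -1 on x.\<close>

lemma submodule_criterion:
  assumes "H \<subseteq> carrier M" "\<zero>\<^bsub>M\<^esub> \<in> H"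
    and "\<And>x y. x \<in> H \<Longrightarrow> y \<in> H \<Longrightarrow> x \<oplus>\<^bsub>M\<^esub> y \<in> H"
    and smult: "\<And>a x. a \<in> carrier R \<Longrightarrow> x \<in> H \<Longrightarrow> a \<odot>\<^bsub>M\<^esub> x \<in> H"
  shows "submodule H R M"
proof (intro submodule.intro subgroup.intro submodule_axioms.intro)
  show "inv\<^bsub>add_monoid M\<^esub> x \<in> H" if "x \<in> H" for x
    using smult [of "\<ominus>\<^bsub>R\<^esub> \<one>\<^bsub>R\<^esub>" x] that assms(1) smult_minus_one [of x]
    by (auto simp: a_inv_def)
qed (use assms in auto)

lemma submoduleD:
  assumes "submodule H R M"
  shows "H \<subseteq> carrier M" "\<zero>\<^bsub>M\<^esub> \<in> H"
    "\<And>x y. x \<in> H \<Longrightarrow> y \<in> H \<Longrightarrow> x \<oplus>\<^bsub>M\<^esub> y \<in> H"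
    "\<And>a x. a \<in> carrier R \<Longrightarrow> x \<in> H \<Longrightarrow> a \<odot>\<^bsub>M\<^esub> x \<in> H"
    "\<And>x. x \<in> H \<Longrightarrow> \<ominus>\<^bsub>M\<^esub> x \<in> H"
proof -
  interpret H: submodule H R M by fact
  show "H \<subseteq> carrier M" "\<zero>\<^bsub>M\<^esub> \<in> H"
    "\<And>x y. x \<in> H \<Longrightarrow> y \<in> H \<Longrightarrow> x \<oplus>\<^bsub>M\<^esub> y \<in> H"
    "\<And>x. x \<in> H \<Longrightarrow> \<ominus>\<^bsub>M\<^esub> x \<in> H"
    using H.subset H.one_closed H.m_closed H.m_inv_closed by (auto simp: a_inv_def)
  show "\<And>a x. a \<in> carrier R \<Longrightarrow> x \<in> H \<Longrightarrow> a \<odot>\<^bsub>M\<^esub> x \<in> H"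
    by (rule H.smult_closed)
qed

lemma submodule_is_right_module:
  assumes "submodule H R M"
  shows "right_module R (M\<lparr>carrier := H\<rparr>)"
proof -
  note H = submoduleD [OF assms]
  have in_M: "x \<in> carrier M" if "x \<in> H" for x
    using H(1) that by blast
  have "abelian_group (M\<lparr>carrier := H\<rparr>)"
  proof (rule abelian_groupI)
    show "\<exists>y \<in> carrier (M\<lparr>carrier := H\<rparr>). y \<oplus>\<^bsub>M\<lparr>carrier := H\<rparr>\<^esub> x = \<zero>\<^bsub>M\<lparr>carrier := H\<rparr>\<^esub>"
      if "x \<in> carrier (M\<lparr>carrier := H\<rparr>)" for x
      using that H(5) by (auto simp: in_M M.l_neg intro!: bexI [of _ "\<ominus>\<^bsub>M\<^esub> x"])
  qed (auto simp: H in_M M.a_ac)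
  then show ?thesis
    by (intro right_module.intro right_module_axioms.intro R.ring_axioms)
      (auto simp: H(2-4) in_M smult_add_scalar smult_add_vector smult_mult smult_one)
qed

end

text \<open>Unlike the sums in \<open>fin_gen\<close>, this makes sense for infinite generating sets
  such as Me_0 or a left ideal \<Lambda>e, and adding one multiple at a time gives an induction
  rule.\<close>

inductive_set mod_span ::
    "('r, 's) ring_scheme \<Rightarrow> ('r, 'm) module \<Rightarrow> 'm set \<Rightarrow> 'm set"
  for R M A where
  zero: "\<zero>\<^bsub>M\<^esub> \<in> mod_span R M A"
| step: "\<lbrakk>a \<in> A; r \<in> carrier R; x \<in> mod_span R M A\<rbrakk> \<Longrightarrow> r \<odot>\<^bsub>M\<^esub> a \<oplus>\<^bsub>M\<^esub> x \<in> mod_span R M A"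

lemma mod_span_mono: "A \<subseteq> B \<Longrightarrow> mod_span R M A \<subseteq> mod_span R M B"
proof
  show "x \<in> mod_span R M B" if "A \<subseteq> B" "x \<in> mod_span R M A" for x
    using that(2,1) by induction (auto intro: mod_span.intros)
qed

lemma mod_span_empty: "mod_span R M {} = {\<zero>\<^bsub>M\<^esub>}"
proof -
  have "x = \<zero>\<^bsub>M\<^esub>" if "x \<in> mod_span R M {}" for x
    using that by induction auto
  then show ?thesis by (auto intro: mod_span.zero)
qed

text \<open>A derivation of membership uses only finitely many generators. This restores finiteness
  whenever generators are drawn from an infinite set.\<close>

lemma mod_span_finite_subset:
  assumes "x \<in> mod_span R M A"
  shows "\<exists>B \<subseteq> A. finite B \<and> x \<in> mod_span R M B"
  using assms
proof induction
  case zero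
  then show ?case by (intro exI [of _ "{}"]) (simp add: mod_span.zero)
next
  case (step a r x)
  then obtain B where "B \<subseteq> A" "finite B" "x \<in> mod_span R M B" by blast
  then show ?case
    using step mod_span_mono [of B "insert a B" R M]
    by (intro exI [of _ "insert a B"]) (auto intro: mod_span.step)
qed

context right_module
begin

lemma mod_span_closed: "A \<subseteq> carrier M \<Longrightarrow> mod_span R M A \<subseteq> carrier M"
proof
  show "x \<in> carrier M" if "A \<subseteq> carrier M" "x \<in> mod_span R M A" for x
    using that(2,1) by induction (auto intro: smult_closed)
qed

lemma mod_span_closed': "x \<in> mod_span R M A \<Longrightarrow> A \<subseteq> carrier M \<Longrightarrow> x \<in> carrier M"
  using mod_span_closed by blast

lemma mod_span_add:
  assumes "x \<in> mod_span R M A" "y \<in> mod_span R M A" "A \<subseteq> carrier M"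
  shows "x \<oplus>\<^bsub>M\<^esub> y \<in> mod_span R M A"
  using assms(1)
proof induction
  case zero
  then show ?case using assms mod_span_closed' by simp
next
  case (step a r x)
  then have "r \<odot>\<^bsub>M\<^esub> a \<oplus>\<^bsub>M\<^esub> x \<oplus>\<^bsub>M\<^esub> y = r \<odot>\<^bsub>M\<^esub> a \<oplus>\<^bsub>M\<^esub> (x \<oplus>\<^bsub>M\<^esub> y)"
    using assms(2,3) by (intro M.a_assoc) (auto intro: smult_closed mod_span_closed')
  then show ?case using step by (auto intro: mod_span.step)
qed

lemma mod_span_smult:
  assumes "x \<in> mod_span R M A" "b \<in> carrier R" "A \<subseteq> carrier M"
  shows "b \<odot>\<^bsub>M\<^esub> x \<in> mod_span R M A"
  using assms(1)
proof induction
  case zero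
  then show ?case using assms by (simp add: mod_span.zero)
next
  case (step a r x)
  then have "b \<odot>\<^bsub>M\<^esub> (r \<odot>\<^bsub>M\<^esub> a \<oplus>\<^bsub>M\<^esub> x) = (r \<otimes>\<^bsub>R\<^esub> b) \<odot>\<^bsub>M\<^esub> a \<oplus>\<^bsub>M\<^esub> b \<odot>\<^bsub>M\<^esub> x"
    using assms(2,3) mod_span_closed' [of x A] smult_closed
    by (auto simp: smult_add_vector smult_mult subset_eq)
  then show ?case using step assms(2) by (auto intro: mod_span.step)
qed

lemma mod_span_submodule: "A \<subseteq> carrier M \<Longrightarrow> submodule (mod_span R M A) R M"
  by (rule submodule_criterion)
    (auto intro: mod_span_add mod_span_smult mod_span.zero mod_span_closed')

lemma mod_span_superset:
  assumes "a \<in> A" "A \<subseteq> carrier M"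
  shows "a \<in> mod_span R M A"
proof -
  have "\<one>\<^bsub>R\<^esub> \<odot>\<^bsub>M\<^esub> a \<oplus>\<^bsub>M\<^esub> \<zero>\<^bsub>M\<^esub> \<in> mod_span R M A"
    using assms by (intro mod_span.intros) auto
  then show ?thesis using assms by (auto simp: smult_one subset_eq)
qed

lemma mod_span_least:
  assumes "submodule H R M" "A \<subseteq> H"
  shows "mod_span R M A \<subseteq> H"
proof
  show "x \<in> H" if "x \<in> mod_span R M A" for x
    using that by induction (use submoduleD [OF assms(1)] assms(2) in auto)
qed

text \<open>The multiples of \<open>b\<close> are collected into one coefficient, which makes
  inductions on the number of generators possible.\<close>

lemma mod_span_insert:
  assumes "x \<in> mod_span R M (insert b B)" "insert b B \<subseteq> carrier M"
  shows "\<exists>r \<in> carrier R. \<exists>y \<in> mod_span R M B. x = r \<odot>\<^bsub>M\<^esub> b \<oplus>\<^bsub>M\<^esub> y"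
  using assms(1)
proof induction
  case zero
  then show ?case
    using assms(2) by (intro bexI [of _ "\<zero>\<^bsub>R\<^esub>"] bexI [of _ "\<zero>\<^bsub>M\<^esub>"]) (auto intro: mod_span.zero)
next
  case (step a r x)
  then obtain s y where sy: "s \<in> carrier R" "y \<in> mod_span R M B" "x = s \<odot>\<^bsub>M\<^esub> b \<oplus>\<^bsub>M\<^esub> y" by blast
  have y: "y \<in> carrier M" and b: "b \<in> carrier M"
    using assms(2) sy mod_span_closed' [of y B] by auto
  show ?case
  proof (cases "a = b")
    case True
    have "r \<odot>\<^bsub>M\<^esub> a \<oplus>\<^bsub>M\<^esub> x = (r \<oplus>\<^bsub>R\<^esub> s) \<odot>\<^bsub>M\<^esub> b \<oplus>\<^bsub>M\<^esub> y"
      using True sy step y b by (simp add: smult_add_scalar M.a_assoc smult_closed)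
    then show ?thesis using R.a_closed [OF step(2) sy(1)] sy(2) by metis
  next
    case False
    then have a: "a \<in> B" "a \<in> carrier M" using step assms(2) by auto
    have "r \<odot>\<^bsub>M\<^esub> a \<oplus>\<^bsub>M\<^esub> x = s \<odot>\<^bsub>M\<^esub> b \<oplus>\<^bsub>M\<^esub> (r \<odot>\<^bsub>M\<^esub> a \<oplus>\<^bsub>M\<^esub> y)"
      using sy step y b a by (simp add: M.a_lcomm smult_closed)
    then show ?thesis using sy(1) mod_span.step [OF a(1) step(2) sy(2)] by metis
  qed
qed

lemma mod_span_imp_finsum:
  assumes "x \<in> mod_span R M A" "finite A" "A \<subseteq> carrier M"
  shows "\<exists>c \<in> A \<rightarrow> carrier R. x = (\<Oplus>\<^bsub>M\<^esub>a \<in> A. c a \<odot>\<^bsub>M\<^esub> a)"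
  using assms(2,1,3)
proof (induction A arbitrary: x rule: finite_induct)
  case empty
  then show ?case by (simp add: mod_span_empty)
next
  case (insert b B)
  obtain r y where ry: "r \<in> carrier R" "y \<in> mod_span R M B" "x = r \<odot>\<^bsub>M\<^esub> b \<oplus>\<^bsub>M\<^esub> y"
    using mod_span_insert insert.prems by blast
  obtain c where c: "c \<in> B \<rightarrow> carrier R" "y = (\<Oplus>\<^bsub>M\<^esub>a \<in> B. c a \<odot>\<^bsub>M\<^esub> a)"
    using insert.IH [OF ry(2)] insert.prems by blast
  have "(\<Oplus>\<^bsub>M\<^esub>a \<in> B. (c(b := r)) a \<odot>\<^bsub>M\<^esub> a) = y"
    unfolding c(2) using insert.hyps c(1) insert.prems
    by (intro M.finsum_cong') (auto intro!: smult_closed)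
  moreover have "(\<Oplus>\<^bsub>M\<^esub>a \<in> insert b B. (c(b := r)) a \<odot>\<^bsub>M\<^esub> a)
      = (c(b := r)) b \<odot>\<^bsub>M\<^esub> b \<oplus>\<^bsub>M\<^esub> (\<Oplus>\<^bsub>M\<^esub>a \<in> B. (c(b := r)) a \<odot>\<^bsub>M\<^esub> a)"
    using insert.hyps c(1) insert.prems ry(1)
    by (intro M.finsum_insert) (auto intro!: smult_closed)
  ultimately have "x = (\<Oplus>\<^bsub>M\<^esub>a \<in> insert b B. (c(b := r)) a \<odot>\<^bsub>M\<^esub> a)"
    using ry(3) by simp
  moreover have "c(b := r) \<in> insert b B \<rightarrow> carrier R"
    using c(1) ry(1) by auto
  ultimately show ?case by blast
qed

lemma finsum_in_mod_span:
  assumes "finite A" "A \<subseteq> carrier M" "c \<in> A \<rightarrow> carrier R"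
  shows "(\<Oplus>\<^bsub>M\<^esub>a \<in> A. c a \<odot>\<^bsub>M\<^esub> a) \<in> mod_span R M A"
  using assms
proof (induction A rule: finite_induct)
  case empty
  then show ?case by (simp add: mod_span.zero)
next
  case (insert b B)
  have "(\<Oplus>\<^bsub>M\<^esub>a \<in> insert b B. c a \<odot>\<^bsub>M\<^esub> a) = c b \<odot>\<^bsub>M\<^esub> b \<oplus>\<^bsub>M\<^esub> (\<Oplus>\<^bsub>M\<^esub>a \<in> B. c a \<odot>\<^bsub>M\<^esub> a)"
    using insert by (intro M.finsum_insert) (auto intro!: smult_closed)
  moreover have "(\<Oplus>\<^bsub>M\<^esub>a \<in> B. c a \<odot>\<^bsub>M\<^esub> a) \<in> mod_span R M (insert b B)"
    using insert mod_span_mono [of B "insert b B" R M] by auto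
  ultimately show ?case
    using insert.prems by (auto intro!: mod_span.step)
qed

lemma fin_gen_iff_mod_span:
  "fin_gen R M \<longleftrightarrow> (\<exists>A. finite A \<and> A \<subseteq> carrier M \<and> carrier M \<subseteq> mod_span R M A)"
proof
  assume "fin_gen R M"
  then obtain A where A: "finite A" "A \<subseteq> carrier M"
    "\<forall>x \<in> carrier M. \<exists>c \<in> A \<rightarrow> carrier R. x = (\<Oplus>\<^bsub>M\<^esub>a \<in> A. c a \<odot>\<^bsub>M\<^esub> a)"
    unfolding fin_gen_def by blast
  then have "carrier M \<subseteq> mod_span R M A"
    using finsum_in_mod_span by (metis subsetI)
  with A show "\<exists>A. finite A \<and> A \<subseteq> carrier M \<and> carrier M \<subseteq> mod_span R M A" by blast
next
  assume "\<exists>A. finite A \<and> A \<subseteq> carrier M \<and> carrier M \<subseteq> mod_span R M A"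
  then obtain A where A: "finite A" "A \<subseteq> carrier M" "carrier M \<subseteq> mod_span R M A" by blast
  have "\<exists>c \<in> A \<rightarrow> carrier R. x = (\<Oplus>\<^bsub>M\<^esub>a \<in> A. c a \<odot>\<^bsub>M\<^esub> a)" if "x \<in> carrier M" for x
    using mod_span_imp_finsum [OF _ A(1,2)] A(3) that by (simp only: subset_eq)
  with A(1,2) show "fin_gen R M"
    unfolding fin_gen_def by (intro exI [of _ A] conjI ballI)
qed

end

lemma mod_span_carrier_update: "mod_span R (M\<lparr>carrier := H\<rparr>) A = mod_span R M A"
proof (intro equalityI subsetI)
  show "x \<in> mod_span R M A" if "x \<in> mod_span R (M\<lparr>carrier := H\<rparr>) A" for x
    using that by induction (auto intro: mod_span.intros)
  show "x \<in> mod_span R (M\<lparr>carrier := H\<rparr>) A" if "x \<in> mod_span R M A" for x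
    using that
  proof induction
    case zero
    show ?case using mod_span.zero [of "M\<lparr>carrier := H\<rparr>" R A] by simp
  next
    case (step a r x)
    then show ?case using mod_span.step [of a A r R x "M\<lparr>carrier := H\<rparr>"] by simp
  qed
qed

section \<open>Right noetherian rings and their finitely generated modules\<close>

definition noetherian_module :: "('r, 's) ring_scheme \<Rightarrow> ('r, 'm) module \<Rightarrow> bool" where
  "noetherian_module R M \<longleftrightarrow>
     (\<forall>H. submodule H R M \<longrightarrow> (\<exists>A \<subseteq> H. finite A \<and> H \<subseteq> mod_span R M A))"

text \<open>The submodules of this module are the right ideals of R, so
  \<open>noetherian_module R (regular_module R)\<close> says that R is right noetherian.\<close>

abbreviation regular_module :: "('r, 's) ring_scheme \<Rightarrow> ('r, 'r) module" where
  "regular_module R \<equiv> right_principal R \<one>\<^bsub>R\<^esub>"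

lemma regular_module_simps [simp]:
  assumes "ring R"
  shows "carrier (regular_module R) = carrier R"
    "\<zero>\<^bsub>regular_module R\<^esub> = \<zero>\<^bsub>R\<^esub>" "add (regular_module R) = add R"
    "smult (regular_module R) = (\<lambda>a x. x \<otimes>\<^bsub>R\<^esub> a)"
proof -
  interpret ring R by fact
  show "carrier (regular_module R) = carrier R"
    by (simp add: right_principal_def)
qed (simp_all add: right_principal_def)

lemma right_module_regular:
  assumes "ring R"
  shows "right_module R (regular_module R)"
proof -
  interpret ring R by fact
  note reg = regular_module_simps [OF assms]
  have "abelian_group (regular_module R)"
    by (rule abelian_groupI) (auto simp: reg a_ac intro!: bexI [where x = "\<ominus>\<^bsub>R\<^esub> x" for x] l_neg)
  then show ?thesis
    by (intro right_module.intro right_module_axioms.intro assms)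
      (simp_all add: reg l_distr r_distr m_assoc)
qed

text \<open>Hilbert-style induction on the number of generators: the coefficients at one generator
  \<open>b\<close> of the elements of H form a right ideal, which is finitely generated, and what
  remains of H lies in the span of the other generators.\<close>

lemma (in right_module) fin_gen_imp_noetherian:
  assumes noeth: "noetherian_module R (regular_module R)" and "fin_gen R M"
  shows "noetherian_module R M"
proof -
  note reg = regular_module_simps [OF R.ring_axioms]
  have rm: "right_module R (regular_module R)"
    by (rule right_module_regular [OF R.ring_axioms])
  have "\<exists>A \<subseteq> H. finite A \<and> H \<subseteq> mod_span R M A"
    if "finite B" "B \<subseteq> carrier M" "submodule H R M" "H \<subseteq> mod_span R M B" for B H
    using that
  proof (induction B arbitrary: H rule: finite_induct)
    case empty
    then show ?case by (intro exI [of _ "{}"]) (auto intro: mod_span.zero)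
  next
    case (insert b B)
    note H = submoduleD [OF insert.prems(2)]
    have b: "b \<in> carrier M" and B: "B \<subseteq> carrier M" using insert by auto
    note S = submoduleD [OF mod_span_submodule [OF B]]
    \<comment> \<open>The right ideal of coefficients at \<open>b\<close> of elements of H, taken
      modulo the span of \<open>B\<close>.\<close>
    define I where "I = {r \<in> carrier R. \<exists>x \<in> mod_span R M B. r \<odot>\<^bsub>M\<^esub> b \<oplus>\<^bsub>M\<^esub> x \<in> H}"
    have "submodule I R (regular_module R)"
    proof (rule right_module.submodule_criterion [OF rm])
      show "I \<subseteq> carrier (regular_module R)" by (auto simp: I_def reg)
      show "\<zero>\<^bsub>regular_module R\<^esub> \<in> I"
        using b H(2) by (auto simp: I_def reg intro!: bexI [of _ "\<zero>\<^bsub>M\<^esub>"] mod_span.zero)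
      show "r \<oplus>\<^bsub>regular_module R\<^esub> s \<in> I" if rs: "r \<in> I" "s \<in> I" for r s
      proof -
        obtain x y where *: "x \<in> mod_span R M B" "y \<in> mod_span R M B" "r \<in> carrier R" "s \<in> carrier R"
          "r \<odot>\<^bsub>M\<^esub> b \<oplus>\<^bsub>M\<^esub> x \<in> H" "s \<odot>\<^bsub>M\<^esub> b \<oplus>\<^bsub>M\<^esub> y \<in> H"
          using rs by (auto simp: I_def)
        then have "x \<in> carrier M" "y \<in> carrier M" using S(1) by auto
        with * b have "(r \<odot>\<^bsub>M\<^esub> b \<oplus>\<^bsub>M\<^esub> x) \<oplus>\<^bsub>M\<^esub> (s \<odot>\<^bsub>M\<^esub> b \<oplus>\<^bsub>M\<^esub> y)
            = (r \<oplus>\<^bsub>R\<^esub> s) \<odot>\<^bsub>M\<^esub> b \<oplus>\<^bsub>M\<^esub> (x \<oplus>\<^bsub>M\<^esub> y)"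
          by (simp add: smult_add_scalar M.a_ac smult_closed)
        with * have "(r \<oplus>\<^bsub>R\<^esub> s) \<odot>\<^bsub>M\<^esub> b \<oplus>\<^bsub>M\<^esub> (x \<oplus>\<^bsub>M\<^esub> y) \<in> H"
          using H(3) by metis
        with * show ?thesis
          unfolding I_def reg using S(3) by blast
      qed
      show "c \<odot>\<^bsub>regular_module R\<^esub> r \<in> I" if c: "c \<in> carrier R" and r: "r \<in> I" for c r
      proof -
        obtain x where *: "x \<in> mod_span R M B" "r \<in> carrier R" "r \<odot>\<^bsub>M\<^esub> b \<oplus>\<^bsub>M\<^esub> x \<in> H"
          using r by (auto simp: I_def)
        then have "x \<in> carrier M" using S(1) by auto
        with * b c have "c \<odot>\<^bsub>M\<^esub> (r \<odot>\<^bsub>M\<^esub> b \<oplus>\<^bsub>M\<^esub> x) = (r \<otimes>\<^bsub>R\<^esub> c) \<odot>\<^bsub>M\<^esub> b \<oplus>\<^bsub>M\<^esub> c \<odot>\<^bsub>M\<^esub> x"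
          by (simp add: smult_add_vector smult_mult smult_closed)
        with * c have "(r \<otimes>\<^bsub>R\<^esub> c) \<odot>\<^bsub>M\<^esub> b \<oplus>\<^bsub>M\<^esub> c \<odot>\<^bsub>M\<^esub> x \<in> H"
          using H(4) by metis
        with * c show ?thesis
          unfolding I_def reg using S(4) by blast
      qed
    qed
    then obtain A0 where A0: "A0 \<subseteq> I" "finite A0" "I \<subseteq> mod_span R (regular_module R) A0"
      using noeth unfolding noetherian_module_def by blast
    have "\<forall>r \<in> A0. \<exists>x. x \<in> mod_span R M B \<and> r \<odot>\<^bsub>M\<^esub> b \<oplus>\<^bsub>M\<^esub> x \<in> H"
      using A0(1) by (auto simp: I_def)
    \<comment> \<open>Each of the finitely many generators r of \<open>I\<close> is completed by
      \<open>x r\<close> to an element \<open>h r\<close> of H with coefficient r at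
      \<open>b\<close>.\<close>
    then obtain x where x: "\<And>r. r \<in> A0 \<Longrightarrow> x r \<in> mod_span R M B \<and> r \<odot>\<^bsub>M\<^esub> b \<oplus>\<^bsub>M\<^esub> x r \<in> H"
      by metis
    define h where "h r = r \<odot>\<^bsub>M\<^esub> b \<oplus>\<^bsub>M\<^esub> x r" for r
    have hA: "h ` A0 \<subseteq> H" using x by (auto simp: h_def)
    then have hAM: "h ` A0 \<subseteq> carrier M" using H(1) by blast
    \<comment> \<open>Every coefficient in \<open>I\<close>, not only the generators, is realised by
      an element in the span of the \<open>h r\<close>.\<close>
    have lift: "r \<in> carrier R \<and> (\<exists>y \<in> mod_span R M B. r \<odot>\<^bsub>M\<^esub> b \<oplus>\<^bsub>M\<^esub> y \<in> mod_span R M (h ` A0))"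
      if "r \<in> mod_span R (regular_module R) A0" for r
      using that
    proof induction
      case zero
      then show ?case
        using b by (auto simp: reg intro!: bexI [of _ "\<zero>\<^bsub>M\<^esub>"] mod_span.zero)
    next
      case (step a c r)
      then obtain y where y: "y \<in> mod_span R M B" "r \<odot>\<^bsub>M\<^esub> b \<oplus>\<^bsub>M\<^esub> y \<in> mod_span R M (h ` A0)"
        and r: "r \<in> carrier R" by blast
      have a: "a \<in> carrier R" using step A0(1) by (auto simp: I_def)
      have xa: "x a \<in> mod_span R M B" "x a \<in> carrier M" "y \<in> carrier M"
        using x [OF step(1)] S(1) y by auto
      have "c \<odot>\<^bsub>M\<^esub> h a \<oplus>\<^bsub>M\<^esub> (r \<odot>\<^bsub>M\<^esub> b \<oplus>\<^bsub>M\<^esub> y) \<in> mod_span R M (h ` A0)"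
        using step(1,2) y(2) by (rule mod_span.step [OF imageI])
      moreover have "c \<odot>\<^bsub>M\<^esub> h a \<oplus>\<^bsub>M\<^esub> (r \<odot>\<^bsub>M\<^esub> b \<oplus>\<^bsub>M\<^esub> y)
          = (a \<otimes>\<^bsub>R\<^esub> c \<oplus>\<^bsub>R\<^esub> r) \<odot>\<^bsub>M\<^esub> b \<oplus>\<^bsub>M\<^esub> (c \<odot>\<^bsub>M\<^esub> x a \<oplus>\<^bsub>M\<^esub> y)"
        using step a r b xa
        by (simp add: h_def smult_add_scalar smult_add_vector smult_mult M.a_ac smult_closed)
      moreover have "c \<odot>\<^bsub>M\<^esub> x a \<oplus>\<^bsub>M\<^esub> y \<in> mod_span R M B"
        using S step xa y by auto
      moreover have "a \<otimes>\<^bsub>R\<^esub> c \<oplus>\<^bsub>R\<^esub> r \<in> carrier R" using a r step(2) by simp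
      ultimately show ?case unfolding reg by metis
    qed
    have "submodule (H \<inter> mod_span R M B) R M"
      by (rule submodule_criterion) (use H S in auto)
    then obtain A' where A': "A' \<subseteq> H \<inter> mod_span R M B" "finite A'"
      "H \<inter> mod_span R M B \<subseteq> mod_span R M A'"
      using insert.IH [OF B] by blast
    have sub: "h ` A0 \<union> A' \<subseteq> carrier M" using hAM A' H(1) by blast
    have "H \<subseteq> mod_span R M (h ` A0 \<union> A')"
    proof
      fix z assume z: "z \<in> H"
      then obtain r y where ry: "r \<in> carrier R" "y \<in> mod_span R M B" "z = r \<odot>\<^bsub>M\<^esub> b \<oplus>\<^bsub>M\<^esub> y"
        using mod_span_insert insert.prems by blast
      then have "r \<in> I" using z by (auto simp: I_def)
      then obtain y' where y': "y' \<in> mod_span R M B"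
        "r \<odot>\<^bsub>M\<^esub> b \<oplus>\<^bsub>M\<^esub> y' \<in> mod_span R M (h ` A0)"
        using lift A0(3) by blast
      have yM: "y \<in> carrier M" "y' \<in> carrier M" using ry y' S(1) by auto
      have rb: "r \<odot>\<^bsub>M\<^esub> b \<in> carrier M" using ry b smult_closed by auto
      let ?w = "r \<odot>\<^bsub>M\<^esub> b \<oplus>\<^bsub>M\<^esub> y'"
      have wH: "?w \<in> H"
        using y'(2) mod_span_least [OF insert.prems(2) hA] by blast
      have eq: "y \<oplus>\<^bsub>M\<^esub> \<ominus>\<^bsub>M\<^esub> y' = z \<oplus>\<^bsub>M\<^esub> \<ominus>\<^bsub>M\<^esub> ?w" "z = ?w \<oplus>\<^bsub>M\<^esub> (y \<oplus>\<^bsub>M\<^esub> \<ominus>\<^bsub>M\<^esub> y')"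
        unfolding ry(3) using yM rb
        by (simp_all add: M.minus_add M.a_ac M.r_neg M.r_neg1 M.r_neg2) (metis M.a_lcomm M.a_inv_closed M.a_closed M.r_neg2)
      have "y \<oplus>\<^bsub>M\<^esub> \<ominus>\<^bsub>M\<^esub> y' \<in> H \<inter> mod_span R M B"
        using S(3) [OF ry(2) S(5) [OF y'(1)]] H(3) [OF z H(5) [OF wH]] eq(1) by simp
      then have "y \<oplus>\<^bsub>M\<^esub> \<ominus>\<^bsub>M\<^esub> y' \<in> mod_span R M (h ` A0 \<union> A')"
        using A'(3) mod_span_mono [of A' "h ` A0 \<union> A'" R M] by blast
      moreover have "?w \<in> mod_span R M (h ` A0 \<union> A')"
        using y'(2) mod_span_mono [of "h ` A0" "h ` A0 \<union> A'" R M] by blast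
      ultimately show "z \<in> mod_span R M (h ` A0 \<union> A')"
        by (subst eq(2)) (rule mod_span_add [OF _ _ sub])
    qed
    then show ?case using hA A' A0 by (intro exI [of _ "h ` A0 \<union> A'"]) auto
  qed
  moreover obtain B where "finite B" "B \<subseteq> carrier M" "carrier M \<subseteq> mod_span R M B"
    using assms(2) fin_gen_iff_mod_span by blast
  ultimately show ?thesis
    unfolding noetherian_module_def by (meson order_trans submoduleD(1))
qed


subsection \<open>Quotient modules and tops of local corners\<close>

lemma quot_mod_simps:
  "carrier (quot_mod M N) = a_rcosets\<^bsub>M\<^esub> N" "\<zero>\<^bsub>quot_mod M N\<^esub> = N"
  "add (quot_mod M N) = set_add M"
  by (simp_all add: quot_mod_def)

context right_module
begin

lemma abelian_subgroup_of_submodule: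
  assumes "submodule N R M"
  shows "abelian_subgroup N M"
  using assms M.abelian_group_axioms
  by (intro abelian_subgroupI3 additive_subgroupI) (auto simp: submodule_def)

lemma quot_mod_carrierE:
  assumes "X \<in> carrier (quot_mod M N)"
  obtains x where "x \<in> carrier M" "X = N +>\<^bsub>M\<^esub> x"
  using assms by (auto simp: quot_mod_simps A_RCOSETS_def')

lemma quot_mod_carrierI:
  "x \<in> carrier M \<Longrightarrow> N +>\<^bsub>M\<^esub> x \<in> carrier (quot_mod M N)"
  by (auto simp: quot_mod_simps A_RCOSETS_def')

text \<open>The action on cosets is defined as a union over all representatives. The members of this
  union coincide because N is stable under the action, and there is at least one.\<close>

lemma quot_mod_smult:
  assumes N: "submodule N R M" and "a \<in> carrier R" "x \<in> carrier M"
  shows "a \<odot>\<^bsub>quot_mod M N\<^esub> (N +>\<^bsub>M\<^esub> x) = N +>\<^bsub>M\<^esub> (a \<odot>\<^bsub>M\<^esub> x)"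
proof -
  interpret N: abelian_subgroup N M by (rule abelian_subgroup_of_submodule [OF N])
  have "N +>\<^bsub>M\<^esub> (a \<odot>\<^bsub>M\<^esub> y) = N +>\<^bsub>M\<^esub> (a \<odot>\<^bsub>M\<^esub> x)" if "y \<in> N +>\<^bsub>M\<^esub> x" for y
  proof -
    obtain u where u: "u \<in> N" "y = u \<oplus>\<^bsub>M\<^esub> x"
      using \<open>y \<in> N +>\<^bsub>M\<^esub> x\<close> by (auto simp: a_r_coset_def')
    then have "a \<odot>\<^bsub>M\<^esub> y = a \<odot>\<^bsub>M\<^esub> u \<oplus>\<^bsub>M\<^esub> a \<odot>\<^bsub>M\<^esub> x"
      using assms by (simp add: smult_add_vector)
    moreover have "a \<odot>\<^bsub>M\<^esub> u \<in> N" using submoduleD [OF N] assms u by blast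
    ultimately have "a \<odot>\<^bsub>M\<^esub> y \<in> N +>\<^bsub>M\<^esub> (a \<odot>\<^bsub>M\<^esub> x)"
      by (auto simp: a_r_coset_def')
    then show ?thesis
      using N.a_repr_independence' assms smult_closed by metis
  qed
  then have "(\<Union>y \<in> N +>\<^bsub>M\<^esub> x. N +>\<^bsub>M\<^esub> (a \<odot>\<^bsub>M\<^esub> y)) = (\<Union>y \<in> N +>\<^bsub>M\<^esub> x. N +>\<^bsub>M\<^esub> (a \<odot>\<^bsub>M\<^esub> x))"
    by (intro SUP_cong refl)
  moreover have "N +>\<^bsub>M\<^esub> x \<noteq> {}" using N.a_rcos_self [of x] assms by blast
  ultimately show ?thesis by (simp add: quot_mod_def)
qed

lemma quot_mod_add:
  assumes N: "submodule N R M" and "x \<in> carrier M" "y \<in> carrier M"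
  shows "(N +>\<^bsub>M\<^esub> x) \<oplus>\<^bsub>quot_mod M N\<^esub> (N +>\<^bsub>M\<^esub> y) = N +>\<^bsub>M\<^esub> (x \<oplus>\<^bsub>M\<^esub> y)"
  using abelian_subgroup.a_rcos_sum [OF abelian_subgroup_of_submodule [OF N]] assms
  by (simp add: quot_mod_simps)

lemma quot_mod_eq_zero:
  assumes N: "submodule N R M" and "x \<in> carrier M"
  shows "N +>\<^bsub>M\<^esub> x = \<zero>\<^bsub>quot_mod M N\<^esub> \<longleftrightarrow> x \<in> N"
  using M.a_coset_join1 [of N x] M.a_coset_join2 [of x N] assms
  by (auto simp: quot_mod_simps submodule_def)

lemma quot_mod_right_module:
  assumes N: "submodule N R M"
  shows "right_module R (quot_mod M N)"
proof -
  have zero: "\<zero>\<^bsub>quot_mod M N\<^esub> = N +>\<^bsub>M\<^esub> \<zero>\<^bsub>M\<^esub>"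
    using quot_mod_eq_zero [OF N, of "\<zero>\<^bsub>M\<^esub>"] submoduleD(2) [OF N] by simp
  have "abelian_group (quot_mod M N)"
  proof (rule abelian_groupI; (elim quot_mod_carrierE)?)
    show "\<zero>\<^bsub>quot_mod M N\<^esub> \<in> carrier (quot_mod M N)"
      using quot_mod_carrierI [of "\<zero>\<^bsub>M\<^esub>"] zero by simp
    show "\<exists>Y \<in> carrier (quot_mod M N). Y \<oplus>\<^bsub>quot_mod M N\<^esub> X = \<zero>\<^bsub>quot_mod M N\<^esub>"
      if "x \<in> carrier M" "X = N +>\<^bsub>M\<^esub> x" for X x
      using that
      by (intro bexI [of _ "N +>\<^bsub>M\<^esub> (\<ominus>\<^bsub>M\<^esub> x)"])
        (simp_all add: zero quot_mod_add [OF N] quot_mod_carrierI M.l_neg)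
  qed (simp_all add: zero quot_mod_add [OF N] quot_mod_carrierI M.a_ac)
  then show ?thesis
    by (intro right_module.intro right_module_axioms.intro R.ring_axioms;
        (elim quot_mod_carrierE)?)
      (simp_all add: quot_mod_smult [OF N] quot_mod_add [OF N] quot_mod_carrierI
        smult_add_scalar smult_add_vector smult_mult smult_one smult_closed)
qed

end

text \<open>This is locality of the corner ring eAe, phrased with right inverses only. Letting
  \<open>z\<close> range over all of A changes nothing: since y = ye, the element eze serves
  whenever z does.\<close>

definition corner_local :: "('a, 's) ring_scheme \<Rightarrow> 'a \<Rightarrow> bool" where
  "corner_local A e \<longleftrightarrow> e \<in> carrier A \<and> e \<otimes>\<^bsub>A\<^esub> e = e \<and> e \<noteq> \<zero>\<^bsub>A\<^esub> \<and>
     (\<forall>y \<in> carrier A. \<forall>y' \<in> carrier A.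
        e \<otimes>\<^bsub>A\<^esub> y \<otimes>\<^bsub>A\<^esub> e = y \<longrightarrow> e \<otimes>\<^bsub>A\<^esub> y' \<otimes>\<^bsub>A\<^esub> e = y' \<longrightarrow> y \<oplus>\<^bsub>A\<^esub> y' = e \<longrightarrow>
        (\<exists>z \<in> carrier A. y \<otimes>\<^bsub>A\<^esub> z = e) \<or> (\<exists>z \<in> carrier A. y' \<otimes>\<^bsub>A\<^esub> z = e))"

lemma (in ring) right_principal_carrier:
  assumes "e \<in> carrier R" "e \<otimes> e = e"
  shows "carrier (right_principal R e) = {x \<in> carrier R. e \<otimes> x = x}"
proof -
  have "x \<in> (\<otimes>) e ` carrier R" if "x \<in> carrier R" "e \<otimes> x = x" for x
    using that by (metis image_eqI)
  then show ?thesis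
    using assms by (auto simp: right_principal_def m_assoc [symmetric])
qed

lemma (in ring) right_principal_right_module:
  assumes "e \<in> carrier R" "e \<otimes> e = e"
  shows "right_module R (right_principal R e)"
proof -
  note c = right_principal_carrier [OF assms]
  have s: "\<zero>\<^bsub>right_principal R e\<^esub> = \<zero>" "add (right_principal R e) = add R"
    "smult (right_principal R e) = (\<lambda>a x. x \<otimes> a)"
    by (simp_all add: right_principal_def)
  have "abelian_group (right_principal R e)"
  proof (rule abelian_groupI)
    show "\<exists>y \<in> carrier (right_principal R e). y \<oplus>\<^bsub>right_principal R e\<^esub> x = \<zero>\<^bsub>right_principal R e\<^esub>"
      if "x \<in> carrier (right_principal R e)" for x
      using that assms by (intro bexI [of _ "\<ominus> x"]) (auto simp: c s l_neg r_minus)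
  qed (use assms in \<open>auto simp: c s a_ac r_distr\<close>)
  then show ?thesis
    using assms
    by (intro right_module.intro right_module_axioms.intro ring_axioms)
      (auto simp: c s r_distr l_distr m_assoc [symmetric])
qed

text \<open>\<open>U\<close> is the set of elements of eR that do not generate eR. Any submodule not
  inside \<open>U\<close> contains e and is everything, so \<open>U\<close>, once it is closed under
  addition, is the unique maximal submodule. Additivity is where locality enters.\<close>

lemma (in ring) mod_rad_corner_local:
  assumes loc: "corner_local R e"
  defines "U \<equiv> {x \<in> carrier (right_principal R e). \<forall>z \<in> carrier R. x \<otimes> z \<noteq> e}"
  shows "submodule U R (right_principal R e)" "mod_rad R (right_principal R e) = U"
proof -
  let ?P = "right_principal R e"
  have e: "e \<in> carrier R" "e \<otimes> e = e" "e \<noteq> \<zero>" using loc by (auto simp: corner_local_def)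
  interpret P: right_module R ?P by (rule right_principal_right_module [OF e(1,2)])
  note c = right_principal_carrier [OF e(1,2)]
  have s: "\<zero>\<^bsub>?P\<^esub> = \<zero>" "add ?P = add R" "smult ?P = (\<lambda>a x. x \<otimes> a)"
    by (simp_all add: right_principal_def)
  show U: "submodule U R ?P"
  proof (rule P.submodule_criterion)
    show "U \<subseteq> carrier ?P" by (auto simp: U_def)
    show "\<zero>\<^bsub>?P\<^esub> \<in> U" using e by (auto simp: U_def c s)
    show "a \<odot>\<^bsub>?P\<^esub> x \<in> U" if "a \<in> carrier R" "x \<in> U" for a x
      using that P.smult_closed [of a x] by (auto simp: U_def s m_assoc c)
    show "x \<oplus>\<^bsub>?P\<^esub> y \<in> U" if xy: "x \<in> U" "y \<in> U" for x y
    proof -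
      have x: "x \<in> carrier R" "e \<otimes> x = x" and y: "y \<in> carrier R" "e \<otimes> y = y"
        using xy by (auto simp: U_def c)
      have "(x \<oplus> y) \<otimes> z \<noteq> e" if z: "z \<in> carrier R" for z
      proof
        assume "(x \<oplus> y) \<otimes> z = e"
        \<comment> \<open>Multiplying by e on the right moves both summands into the corner eRe,
          where locality applies.\<close>
        then have "x \<otimes> z \<otimes> e \<oplus> y \<otimes> z \<otimes> e = e"
          using x y z e by (metis l_distr m_closed)
        moreover have "e \<otimes> (u \<otimes> z \<otimes> e) \<otimes> e = u \<otimes> z \<otimes> e"
          if "u \<in> carrier R" "e \<otimes> u = u" for u
        proof -
          have "e \<otimes> (u \<otimes> z \<otimes> e) \<otimes> e = (e \<otimes> u) \<otimes> z \<otimes> (e \<otimes> e)"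
            using that(1) z e(1) by (simp add: m_assoc)
          then show ?thesis using that e by simp
        qed
        note this [OF x] this [OF y]
        moreover have "x \<otimes> z \<otimes> e \<in> carrier R" "y \<otimes> z \<otimes> e \<in> carrier R"
          using x y z e by simp_all
        ultimately consider w where "w \<in> carrier R" "x \<otimes> z \<otimes> e \<otimes> w = e"
          | w where "w \<in> carrier R" "y \<otimes> z \<otimes> e \<otimes> w = e"
          using loc unfolding corner_local_def by blast
        then show False
        proof cases
          case 1
          then have "x \<otimes> (z \<otimes> (e \<otimes> w)) = e" using x z e by (simp add: m_assoc)
          then show False using xy(1) 1 z e by (auto simp: U_def)
        next
          case 2
          then have "y \<otimes> (z \<otimes> (e \<otimes> w)) = e" using y z e by (simp add: m_assoc)
          then show False using xy(2) 2 z e by (auto simp: U_def)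
        qed
      qed
      then show ?thesis
        using x y e by (auto simp: U_def c s r_distr)
    qed
  qed
  have generates: "L = carrier ?P" if L: "submodule L R ?P" "x \<in> L" "x \<notin> U" for L x
  proof -
    note LD = P.submoduleD [OF L(1)]
    obtain z where z: "z \<in> carrier R" "x \<otimes> z = e"
      using L LD(1) by (auto simp: U_def)
    then have "e \<in> L" using LD(4) [OF z(1) L(2)] by (simp add: s)
    then have "x \<in> L" if "x \<in> carrier ?P" for x
      using that LD(4) [of x e] by (auto simp: s c)
    with LD(1) show ?thesis by blast
  qed
  have "e \<in> carrier ?P" using e by (simp add: c)
  have "e \<notin> U" using e by (auto simp: U_def intro: bexI [of _ e])
  have max: "maximal_submodule R ?P U"
    unfolding maximal_submodule_def using U generates \<open>e \<notin> U\<close> \<open>e \<in> carrier ?P\<close> by blast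
  have "N = U" if N: "maximal_submodule R ?P N" for N
  proof -
    have "N \<subseteq> U" using N generates unfolding maximal_submodule_def by blast
    then show ?thesis
      using N U \<open>e \<notin> U\<close> \<open>e \<in> carrier ?P\<close> unfolding maximal_submodule_def by blast
  qed
  with max have "{N. maximal_submodule R ?P N} = {U}" by blast
  then show "mod_rad R ?P = U"
    unfolding mod_rad_def using P.submoduleD(1) [OF U] by auto
qed

text \<open>The second claim is simplicity in the elementwise form used below. A representative x
  outside the radical has xz = e for some z, and then zy carries x to y for every y in eR.\<close>

lemma (in ring) mod_top_corner_local:
  assumes loc: "corner_local R e"
  defines "T \<equiv> mod_top R (right_principal R e)"
  shows "right_module R T"
    and "\<lbrakk>s \<in> carrier T; t \<in> carrier T; s \<noteq> \<zero>\<^bsub>T\<^esub>\<rbrakk> \<Longrightarrow> \<exists>a \<in> carrier R. a \<odot>\<^bsub>T\<^esub> s = t"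
proof -
  let ?P = "right_principal R e"
  have e: "e \<in> carrier R" "e \<otimes> e = e" using loc by (auto simp: corner_local_def)
  interpret P: right_module R ?P by (rule right_principal_right_module [OF e])
  note c = right_principal_carrier [OF e]
  define U where "U = mod_rad R ?P"
  have U: "submodule U R ?P"
    and U_eq: "U = {x \<in> carrier (right_principal R e). \<forall>z \<in> carrier R. x \<otimes> z \<noteq> e}"
    using mod_rad_corner_local [OF loc] by (auto simp: U_def)
  have T: "T = quot_mod ?P U" by (simp add: T_def U_def mod_top_def)
  show "right_module R T" unfolding T by (rule P.quot_mod_right_module [OF U])
  assume st: "s \<in> carrier T" "t \<in> carrier T" "s \<noteq> \<zero>\<^bsub>T\<^esub>"
  obtain x where x: "x \<in> carrier ?P" "s = U +>\<^bsub>?P\<^esub> x"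
    using st(1) T P.quot_mod_carrierE by metis
  obtain y where y: "y \<in> carrier ?P" "t = U +>\<^bsub>?P\<^esub> y"
    using st(2) T P.quot_mod_carrierE by metis
  have "x \<notin> U" using st(3) x P.quot_mod_eq_zero [OF U] by (simp add: T)
  then obtain z where z: "z \<in> carrier R" "x \<otimes> z = e" using x by (auto simp: U_eq)
  have xR: "x \<in> carrier R" and yR: "y \<in> carrier R" "e \<otimes> y = y" using x y by (auto simp: c)
  have "x \<otimes> (z \<otimes> y) = y" using xR yR z by (simp add: m_assoc [symmetric])
  then have "(z \<otimes> y) \<odot>\<^bsub>?P\<^esub> x = y" by (simp add: right_principal_def)
  then have "(z \<otimes> y) \<odot>\<^bsub>T\<^esub> s = t"
    using P.quot_mod_smult [OF U _ x(1)] z yR by (simp add: T x y)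
  then show "\<exists>a \<in> carrier R. a \<odot>\<^bsub>T\<^esub> s = t" using z yR by blast
qed

text \<open>If \<open>y = xae\<close> fixes \<open>t\<close>, then \<open>e - y\<close> kills it, so \<open>e - y\<close> cannot be right invertible in
  the corner ring.\<close>

lemma (in right_module) right_inverse_of_nonzero_action:
  assumes loc: "corner_local R e"
    and simple: "\<And>s t. \<lbrakk>s \<in> carrier M; t \<in> carrier M; s \<noteq> \<zero>\<^bsub>M\<^esub>\<rbrakk> \<Longrightarrow> \<exists>a \<in> carrier R. a \<odot>\<^bsub>M\<^esub> s = t"
    and t: "t \<in> carrier M" "e \<odot>\<^bsub>M\<^esub> t = t"
    and x: "x \<in> carrier R" "e \<otimes>\<^bsub>R\<^esub> x = x" "x \<odot>\<^bsub>M\<^esub> t \<noteq> \<zero>\<^bsub>M\<^esub>"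
  shows "\<exists>b \<in> carrier R. x \<otimes>\<^bsub>R\<^esub> b = e"
proof -
  have e: "e \<in> carrier R" "e \<otimes>\<^bsub>R\<^esub> e = e" using loc by (auto simp: corner_local_def)
  obtain a where a: "a \<in> carrier R" "a \<odot>\<^bsub>M\<^esub> (x \<odot>\<^bsub>M\<^esub> t) = t"
    using simple [of "x \<odot>\<^bsub>M\<^esub> t" t] t x smult_closed by blast
  define y where "y = x \<otimes>\<^bsub>R\<^esub> a \<otimes>\<^bsub>R\<^esub> e"
  define y' where "y' = e \<ominus>\<^bsub>R\<^esub> y"
  have y: "y \<in> carrier R" "e \<otimes>\<^bsub>R\<^esub> y = y" "y \<otimes>\<^bsub>R\<^esub> e = y"
    using x a e by (simp_all add: y_def R.m_assoc) (simp_all add: x(2) R.m_assoc [symmetric])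
  have y': "y' \<in> carrier R" using y e by (simp add: y'_def)
  have corner: "e \<otimes>\<^bsub>R\<^esub> y \<otimes>\<^bsub>R\<^esub> e = y" "e \<otimes>\<^bsub>R\<^esub> y' \<otimes>\<^bsub>R\<^esub> e = y'"
    using e y by (simp_all add: y'_def R.minus_eq R.r_distr R.l_distr R.l_minus R.r_minus)
  have sum: "y \<oplus>\<^bsub>R\<^esub> y' = e"
    using e y by (simp add: y'_def R.minus_eq R.a_ac R.r_neg1 R.r_neg2 R.r_neg)
  have yt: "y \<odot>\<^bsub>M\<^esub> t = t"
    unfolding y_def using a e t x by (simp add: smult_mult smult_closed)
  have t_eq: "y \<odot>\<^bsub>M\<^esub> t \<oplus>\<^bsub>M\<^esub> y' \<odot>\<^bsub>M\<^esub> t = t"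
    using smult_add_scalar [of y y' t] sum t y y' by simp
  then have y't: "y' \<odot>\<^bsub>M\<^esub> t = \<zero>\<^bsub>M\<^esub>"
    using M.add.r_cancel_one [of t "y' \<odot>\<^bsub>M\<^esub> t"] t(1) y' yt smult_closed [of y' t] by simp
  have "\<not> (\<exists>z \<in> carrier R. y' \<otimes>\<^bsub>R\<^esub> z = e)"
  proof
    assume "\<exists>z \<in> carrier R. y' \<otimes>\<^bsub>R\<^esub> z = e"
    then obtain z where z: "z \<in> carrier R" "y' \<otimes>\<^bsub>R\<^esub> z = e" by blast
    then have "e \<odot>\<^bsub>M\<^esub> t = z \<odot>\<^bsub>M\<^esub> (y' \<odot>\<^bsub>M\<^esub> t)" using y' t smult_mult by metis
    then have "t = \<zero>\<^bsub>M\<^esub>" using t y't z by simp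
    with x show False by simp
  qed
  then obtain z where z: "z \<in> carrier R" "y \<otimes>\<^bsub>R\<^esub> z = e"
    using loc corner sum y y' unfolding corner_local_def by blast
  then have "x \<otimes>\<^bsub>R\<^esub> (a \<otimes>\<^bsub>R\<^esub> (e \<otimes>\<^bsub>R\<^esub> z)) = e"
    using x a e by (simp add: y_def R.m_assoc)
  then show ?thesis using a e z by blast
qed


subsection \<open>Finite sums of principal projective modules\<close>

lemma mod_homD:
  assumes "f \<in> mod_hom R M N"
  shows "x \<in> carrier M \<Longrightarrow> f x \<in> carrier N"
    "\<lbrakk>x \<in> carrier M; y \<in> carrier M\<rbrakk> \<Longrightarrow> f (x \<oplus>\<^bsub>M\<^esub> y) = f x \<oplus>\<^bsub>N\<^esub> f y"
    "\<lbrakk>a \<in> carrier R; x \<in> carrier M\<rbrakk> \<Longrightarrow> f (a \<odot>\<^bsub>M\<^esub> x) = a \<odot>\<^bsub>N\<^esub> f x"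
  using assms by (auto simp: mod_hom_def)

lemma mod_hom_zero:
  assumes "f \<in> mod_hom R M N" "right_module R M" "right_module R N"
  shows "f \<zero>\<^bsub>M\<^esub> = \<zero>\<^bsub>N\<^esub>"
proof -
  interpret M: right_module R M by fact
  interpret N: right_module R N by fact
  have "f (\<zero>\<^bsub>R\<^esub> \<odot>\<^bsub>M\<^esub> \<zero>\<^bsub>M\<^esub>) = \<zero>\<^bsub>R\<^esub> \<odot>\<^bsub>N\<^esub> f \<zero>\<^bsub>M\<^esub>"
    by (intro mod_homD(3) [OF assms(1)]) auto
  then show ?thesis using mod_homD(1) [OF assms(1)] by simp
qed

lemma mod_ker_submodule:
  assumes "f \<in> mod_hom R M N" "right_module R M" "right_module R N"
  shows "submodule (mod_ker M N f) R M"
proof -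
  interpret M: right_module R M by fact
  interpret N: right_module R N by fact
  show ?thesis
    by (rule M.submodule_criterion)
      (auto simp: mod_ker_def mod_homD [OF assms(1)] mod_hom_zero [OF assms] M.smult_closed)
qed

lemma mod_hom_image_submodule:
  assumes "f \<in> mod_hom R M N" "right_module R M" "right_module R N"
  shows "submodule (f ` carrier M) R N"
proof -
  interpret M: right_module R M by fact
  interpret N: right_module R N by fact
  show ?thesis
  proof (rule N.submodule_criterion)
    show "f ` carrier M \<subseteq> carrier N" using mod_homD(1) [OF assms(1)] by blast
    show "\<zero>\<^bsub>N\<^esub> \<in> f ` carrier M"
      using mod_hom_zero [OF assms] by (intro image_eqI [of _ _ "\<zero>\<^bsub>M\<^esub>"]) auto
    show "x \<oplus>\<^bsub>N\<^esub> y \<in> f ` carrier M" if "x \<in> f ` carrier M" "y \<in> f ` carrier M" for x y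
    proof -
      obtain u v where uv: "u \<in> carrier M" "v \<in> carrier M" "x = f u" "y = f v"
        using \<open>x \<in> f ` carrier M\<close> \<open>y \<in> f ` carrier M\<close> by blast
      then show ?thesis
        using mod_homD(2) [OF assms(1) uv(1,2)] by (intro image_eqI [of _ _ "u \<oplus>\<^bsub>M\<^esub> v"]) auto
    qed
    show "a \<odot>\<^bsub>N\<^esub> x \<in> f ` carrier M" if "a \<in> carrier R" "x \<in> f ` carrier M" for a x
    proof -
      obtain u where u: "u \<in> carrier M" "x = f u" using \<open>x \<in> f ` carrier M\<close> by blast
      then show ?thesis
        using mod_homD(3) [OF assms(1) \<open>a \<in> carrier R\<close> u(1)] M.smult_closed [OF \<open>a \<in> carrier R\<close> u(1)]
        by (intro image_eqI [of _ _ "a \<odot>\<^bsub>M\<^esub> u"]) auto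
    qed
  qed
qed

lemma restrict_scalars_right_module:
  assumes f: "f \<in> ring_hom A B" and A: "ring A" and M: "right_module B M"
  shows "right_module A (restrict_scalars f M)"
proof -
  interpret M: right_module B M by fact
  have "abelian_group (restrict_scalars f M)"
    by (rule abelian_groupI)
      (auto simp: restrict_scalars_def M.M.a_ac intro: M.M.l_neg M.M.a_inv_closed bexI [where x = "\<ominus>\<^bsub>M\<^esub> x" for x])
  then show ?thesis
    by (intro right_module.intro right_module_axioms.intro A)
      (auto simp: restrict_scalars_def ring_hom_closed [OF f] ring_hom_add [OF f]
        ring_hom_mult [OF f] ring_hom_one [OF f] M.smult_closed M.smult_add_scalar
        M.smult_add_vector M.smult_mult M.smult_one)
qed

text \<open>In use, \<open>b t\<close> is fixed by the t-th idempotent, and this is the map from a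
  sum of right ideals that sends the t-th idempotent to \<open>b t\<close>. Recursion reduces
  linearity to plain induction on \<open>k\<close>.\<close>

primrec lin_comb ::
    "('r, 'm) module \<Rightarrow> (nat \<Rightarrow> 'm) \<Rightarrow> nat \<Rightarrow> (nat \<Rightarrow> 'r) \<Rightarrow> 'm" where
  "lin_comb M b 0 x = \<zero>\<^bsub>M\<^esub>"
| "lin_comb M b (Suc k) x = lin_comb M b k x \<oplus>\<^bsub>M\<^esub> x k \<odot>\<^bsub>M\<^esub> b k"

context right_module
begin

lemma lin_comb_closed:
  "\<lbrakk>\<And>t. b t \<in> carrier M; \<And>t. x t \<in> carrier R\<rbrakk> \<Longrightarrow> lin_comb M b k x \<in> carrier M"
  by (induction k) (auto simp: smult_closed)

lemma lin_comb_add: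
  "\<lbrakk>\<And>t. b t \<in> carrier M; \<And>t. x t \<in> carrier R; \<And>t. y t \<in> carrier R\<rbrakk>
    \<Longrightarrow> lin_comb M b k (\<lambda>t. x t \<oplus>\<^bsub>R\<^esub> y t) = lin_comb M b k x \<oplus>\<^bsub>M\<^esub> lin_comb M b k y"
  by (induction k) (simp_all add: smult_closed smult_add_scalar lin_comb_closed M.a_ac)

lemma lin_comb_smult:
  "\<lbrakk>\<And>t. b t \<in> carrier M; \<And>t. x t \<in> carrier R; a \<in> carrier R\<rbrakk>
    \<Longrightarrow> lin_comb M b k (\<lambda>t. x t \<otimes>\<^bsub>R\<^esub> a) = a \<odot>\<^bsub>M\<^esub> lin_comb M b k x"
  by (induction k) (simp_all add: smult_closed smult_mult smult_add_vector lin_comb_closed)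

lemma lin_comb_single:
  "\<lbrakk>\<And>t. b t \<in> carrier M; y \<in> carrier R\<rbrakk>
    \<Longrightarrow> lin_comb M b k (\<lambda>s. if s = t then y else \<zero>\<^bsub>R\<^esub>) = (if t < k then y \<odot>\<^bsub>M\<^esub> b t else \<zero>\<^bsub>M\<^esub>)"
  by (induction k) (auto simp: smult_closed less_Suc_eq)

text \<open>Coefficients that vanish excuse their generator from lying in \<open>B\<close>; this is
  how a single generator is dropped later.\<close>

lemma lin_comb_in_mod_span:
  assumes "B \<subseteq> carrier M" "\<And>t. b t \<in> carrier M" "\<And>t. x t \<in> carrier R"
    and "\<And>t. t < k \<Longrightarrow> b t \<in> B \<or> x t = \<zero>\<^bsub>R\<^esub>"
  shows "lin_comb M b k x \<in> mod_span R M B"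
  using assms(4)
proof (induction k)
  case 0
  show ?case by (simp add: mod_span.zero)
next
  case (Suc k)
  have "x k \<odot>\<^bsub>M\<^esub> b k \<in> mod_span R M B"
  proof (cases "b k \<in> B")
    case True
    show ?thesis by (rule mod_span_smult [OF mod_span_superset [OF True assms(1)] assms(3) assms(1)])
  next
    case False
    then show ?thesis using Suc.prems [of k] assms(2) by (simp add: mod_span.zero)
  qed
  then show ?case using Suc by (simp add: mod_span_add [OF _ _ assms(1)])
qed

end

text \<open>The module \<open>\<Oplus>\<^sub>t E\<^sub>tR\<close>; in use, \<open>E\<^sub>t = 0\<close> for all but finitely many \<open>t\<close>.\<close>

definition idem_sum :: "('r, 's) ring_scheme \<Rightarrow> (nat \<Rightarrow> 'r) \<Rightarrow> ('r, nat \<Rightarrow> 'r) module" where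
  "idem_sum R E = \<lparr>carrier = {x. \<forall>t. x t \<in> carrier R \<and> E t \<otimes>\<^bsub>R\<^esub> x t = x t},
     monoid.mult = undefined, one = undefined, ring.zero = (\<lambda>_. \<zero>\<^bsub>R\<^esub>),
     add = (\<lambda>x y t. x t \<oplus>\<^bsub>R\<^esub> y t), smult = (\<lambda>a x t. x t \<otimes>\<^bsub>R\<^esub> a)\<rparr>"

lemma idem_sum_simps [simp]:
  "x \<in> carrier (idem_sum R E) \<longleftrightarrow> (\<forall>t. x t \<in> carrier R \<and> E t \<otimes>\<^bsub>R\<^esub> x t = x t)"
  "\<zero>\<^bsub>idem_sum R E\<^esub> = (\<lambda>_. \<zero>\<^bsub>R\<^esub>)"
  "x \<oplus>\<^bsub>idem_sum R E\<^esub> y = (\<lambda>t. x t \<oplus>\<^bsub>R\<^esub> y t)"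
  "a \<odot>\<^bsub>idem_sum R E\<^esub> x = (\<lambda>t. x t \<otimes>\<^bsub>R\<^esub> a)"
  by (simp_all add: idem_sum_def)

text \<open>Neither orthogonality nor distinctness is asked: in use, the same e_i occurs once for
  every generator of type i. As \<open>E t\<close> vanishes from \<open>k\<close> on, so does
  \<open>x t\<close>, and functions on all of nat model a finite direct sum.\<close>

locale idem_family = ring R for R :: "('r, 's) ring_scheme" (structure) +
  fixes E :: "nat \<Rightarrow> 'r" and k :: nat
  assumes E_closed: "E t \<in> carrier R" and E_idem: "E t \<otimes> E t = E t"
    and E_zero: "k \<le> t \<Longrightarrow> E t = \<zero>"
begin

abbreviation Q where "Q \<equiv> idem_sum R E"

abbreviation single :: "nat \<Rightarrow> 'r \<Rightarrow> nat \<Rightarrow> 'r" where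
  "single t y \<equiv> \<lambda>s. if s = t then y else \<zero>"

lemma right_module_Q: "right_module R Q"
proof -
  have "abelian_group Q"
  proof (rule abelian_groupI)
    show "\<exists>y \<in> carrier Q. y \<oplus>\<^bsub>Q\<^esub> x = \<zero>\<^bsub>Q\<^esub>" if "x \<in> carrier Q" for x
      using that E_closed by (intro bexI [of _ "\<lambda>t. \<ominus> x t"]) (auto simp: l_neg r_minus)
  qed (use E_closed in \<open>auto simp: a_ac r_distr\<close>)
  then show ?thesis
    using E_closed
    by (intro right_module.intro right_module_axioms.intro ring_axioms)
      (auto simp: r_distr l_distr m_assoc [symmetric])
qed

lemma single_in_Q: "\<lbrakk>y \<in> carrier R; E t \<otimes> y = y\<rbrakk> \<Longrightarrow> single t y \<in> carrier Q"
  using E_closed by auto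

lemma vanishes_beyond: "x \<in> carrier Q \<Longrightarrow> k \<le> t \<Longrightarrow> x t = \<zero>"
  using E_zero [of t] by (metis idem_sum_simps(1) l_null)

text \<open>An element is the finite sum of its coordinates. The \<open>single\<close> case speaks
  only of the coordinates of \<open>x\<close> itself, which keeps at hand that \<open>E t\<close>
  fixes them.\<close>

lemma Q_induct [consumes 1, case_names zero single add]:
  assumes "x \<in> carrier Q"
    and "P \<zero>\<^bsub>Q\<^esub>"
    and single: "\<And>t. t < k \<Longrightarrow> P (single t (x t))"
    and add: "\<And>y z. \<lbrakk>y \<in> carrier Q; z \<in> carrier Q; P y; P z\<rbrakk> \<Longrightarrow> P (y \<oplus>\<^bsub>Q\<^esub> z)"
  shows "P x"
proof -
  have x: "x t \<in> carrier R" "E t \<otimes> x t = x t" for t using assms(1) by auto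
  \<comment> \<open>The truncations of \<open>x\<close> to its first \<open>l\<close> coordinates;
    at l = k nothing is cut off.\<close>
  have "P (\<lambda>t. if t < l then x t else \<zero>)" if "l \<le> k" for l
    using that
  proof (induction l)
    case 0
    then show ?case using assms(2) by simp
  next
    case (Suc l)
    have "P ((\<lambda>t. if t < l then x t else \<zero>) \<oplus>\<^bsub>Q\<^esub> single l (x l))"
      using Suc x E_closed by (intro add single single_in_Q) auto
    moreover have "(\<lambda>t. if t < l then x t else \<zero>) \<oplus>\<^bsub>Q\<^esub> single l (x l)
        = (\<lambda>t. if t < Suc l then x t else \<zero>)"
      using x by (auto simp: less_Suc_eq)
    ultimately show ?case by simp
  qed
  moreover have "(\<lambda>t. if t < k then x t else \<zero>) = x"
    using vanishes_beyond [OF assms(1)] by auto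
  ultimately show ?thesis by (metis order_refl)
qed

lemma lin_comb_hom:
  assumes "right_module R N" "\<And>t. b t \<in> carrier N"
  shows "lin_comb N b k \<in> mod_hom R Q N"
proof -
  interpret N: right_module R N by fact
  show ?thesis
    using assms(2)
    by (auto simp: mod_hom_def N.lin_comb_closed N.lin_comb_add N.lin_comb_smult)
qed

lemma single_eq_smult:
  assumes "y \<in> carrier R" "E t \<otimes> y = y"
  shows "single t y = y \<odot>\<^bsub>Q\<^esub> single t (E t)"
  using assms by auto

lemma fin_gen_Q: "fin_gen R Q"
proof -
  interpret Q: right_module R Q by (rule right_module_Q)
  let ?A = "(\<lambda>t. single t (E t)) ` {..<k}"
  have A: "?A \<subseteq> carrier Q" using single_in_Q E_closed E_idem by blast
  have "x \<in> mod_span R Q ?A" if "x \<in> carrier Q" for x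
    using that
  proof (induction rule: Q_induct)
    case zero
    show ?case by (rule mod_span.zero)
  next
    case (single t)
    have "x t \<odot>\<^bsub>Q\<^esub> single t (E t) \<in> mod_span R Q ?A"
      using single that by (intro Q.mod_span_smult Q.mod_span_superset A) auto
    then show ?case using single_eq_smult [of "x t" t] that by simp
  next
    case (add y z)
    then show ?case using A by (intro Q.mod_span_add)
  qed
  then show ?thesis
    using Q.fin_gen_iff_mod_span A by blast
qed

text \<open>Preimages under g of the images of the generators are chosen freely. A preimage
  \<open>a t\<close> need not be fixed by \<open>E t\<close>, since the coefficients already satisfy
  E_t x_t = x_t.\<close>

lemma projective_Q: "projective_module R Q"
  unfolding projective_module_def
proof (intro conjI allI impI right_module_Q)
  fix A :: "('r, (nat \<Rightarrow> 'r) \<Rightarrow> 'r) module" and B :: "('r, nat \<Rightarrow> 'r) module" and g h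
  assume A: "right_module R A" and B: "right_module R B" and g: "g \<in> mod_hom R A B"
    and surj: "g ` carrier A = carrier B" and h: "h \<in> mod_hom R Q B"
  interpret A: right_module R A by fact
  have s: "single t (E t) \<in> carrier Q" for t using single_in_Q E_closed E_idem by blast
  have "\<exists>a \<in> carrier A. g a = h (single t (E t))" for t
  proof -
    have "h (single t (E t)) \<in> g ` carrier A"
      unfolding surj by (rule mod_homD(1) [OF h s])
    then show ?thesis by (elim imageE) (rule bexI, rule sym, assumption+)
  qed
  then obtain a where a: "\<And>t. a t \<in> carrier A" "\<And>t. g (a t) = h (single t (E t))" by metis
  note l = lin_comb_hom [of A a, OF A a(1)]
  have "g (lin_comb A a k x) = h x" if "x \<in> carrier Q" for x
    using that
  proof (induction rule: Q_induct)
    case zero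
    then show ?case
      using mod_hom_zero [OF l right_module_Q A] mod_hom_zero [OF g A B] mod_hom_zero [OF h right_module_Q B]
      by simp
  next
    case (single t)
    have x: "x t \<in> carrier R" "E t \<otimes> x t = x t" using that by auto
    have "g (lin_comb A a k (single t (x t))) = x t \<odot>\<^bsub>B\<^esub> h (single t (E t))"
      using A.lin_comb_single [of a "x t" k t] single x a mod_homD(3) [OF g x(1) a(1) [of t]] by simp
    also have "\<dots> = h (single t (x t))"
      unfolding single_eq_smult [OF x] using mod_homD(3) [OF h x(1) s] by simp
    finally show ?case .
  next
    case (add y z)
    then show ?case
      using mod_homD(2) [OF l add.hyps(1,2)] mod_homD(2) [OF h add.hyps(1,2)]
        mod_homD(2) [OF g mod_homD(1) [OF l add.hyps(1)] mod_homD(1) [OF l add.hyps(2)]]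
      by simp
  qed
  with l show "\<exists>l \<in> mod_hom R Q A. \<forall>x \<in> carrier Q. g (l x) = h x" by blast
qed

lemma lin_comb_image:
  assumes "right_module R N" "\<And>t. b t \<in> carrier N" "\<And>t. t < k \<Longrightarrow> E t \<odot>\<^bsub>N\<^esub> b t = b t"
  shows "mod_span R N (b ` {..<k}) \<subseteq> lin_comb N b k ` carrier Q"
proof -
  interpret N: right_module R N by fact
  show ?thesis
  proof (rule N.mod_span_least)
    show "submodule (lin_comb N b k ` carrier Q) R N"
      by (rule mod_hom_image_submodule [OF lin_comb_hom [OF assms(1,2)] right_module_Q assms(1)])
    show "b ` {..<k} \<subseteq> lin_comb N b k ` carrier Q"
    proof clarify
      fix t assume t: "t < k"
      have "lin_comb N b k (single t (E t)) = b t"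
        using N.lin_comb_single [of b "E t" k t] E_closed assms(2,3) t by simp
      then show "b t \<in> lin_comb N b k ` carrier Q"
        using single_in_Q [OF E_closed E_idem] by (rule image_eqI [OF sym])
    qed
  qed
qed

end


subsection \<open>Partial projective covers\<close>

text \<open>With the action read on the right, r = sum b c gives m r = sum (m b) c. This transports
  decompositions inside the ring, of 1 or of elements of J, to an arbitrary module.\<close>

lemma (in right_module) smult_in_mod_span:
  assumes "r \<in> mod_span R (regular_module R) B" "B \<subseteq> carrier R" "m \<in> carrier M"
  shows "r \<odot>\<^bsub>M\<^esub> m \<in> mod_span R M ((\<lambda>b. b \<odot>\<^bsub>M\<^esub> m) ` B)"
  using assms(1)
proof induction
  case zero
  then show ?case using assms by (simp add: right_principal_def mod_span.zero)
next
  case (step b c r)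
  have "mod_span R (regular_module R) B \<subseteq> carrier R"
    using right_module.mod_span_closed [OF right_module_regular [OF R.ring_axioms], of B] assms(2)
    by (simp add: regular_module_simps [OF R.ring_axioms])
  then have bcr: "b \<in> carrier R" "c \<in> carrier R" "r \<in> carrier R" using step assms(2) by auto
  have "(c \<odot>\<^bsub>regular_module R\<^esub> b \<oplus>\<^bsub>regular_module R\<^esub> r) \<odot>\<^bsub>M\<^esub> m = c \<odot>\<^bsub>M\<^esub> (b \<odot>\<^bsub>M\<^esub> m) \<oplus>\<^bsub>M\<^esub> r \<odot>\<^bsub>M\<^esub> m"
    using bcr assms(3) by (simp add: right_principal_def smult_add_scalar smult_mult)
  then show ?case using mod_span.step [OF imageI [OF step(1)] step(2) step(4)] by simp
qed

text \<open>\<open>L\<close> plays the role of \<open>\<Lambda>\<close>, \<open>J\<close> of \<open>[proj]\<close>, \<open>E 0\<close> of the idempotent of the summand \<open>P\<close>,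
  and \<open>E i\<close> of \<open>e\<^sub>i\<close>.\<close>

locale contraction_setting = ideal J L
  for L :: "('r, 's) ring_scheme" (structure) and J +
  fixes E :: "nat \<Rightarrow> 'r" and n :: nat
  assumes noetherian: "noetherian_module L (regular_module L)"
    and E_closed: "i \<le> n \<Longrightarrow> E i \<in> carrier L" and E_idem: "i \<le> n \<Longrightarrow> E i \<otimes> E i = E i"
    and E_0: "E 0 \<in> J"
    and J_span: "J \<subseteq> mod_span L (regular_module L) {b \<in> carrier L. b \<otimes> E 0 = b}"
    and one_span: "\<one> \<in> mod_span L (regular_module L) {b \<in> carrier L. \<exists>i\<le>n. b \<otimes> E i = b}"
    and local: "i \<in> {1..n} \<Longrightarrow> corner_local (L Quot J) (J +> E i)"
begin

abbreviation T :: "nat \<Rightarrow> ('r set, 'r set set) module" where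
  "T i \<equiv> mod_top (L Quot J) (right_principal (L Quot J) (J +> E i))"

abbreviation S :: "('r, nat \<Rightarrow> 'r set set) module" where
  "S \<equiv> restrict_scalars ((+>) J) (dsum_mod {1..n} T)"

text \<open>The index is stored with the generator because an element can be fixed by several of the
  idempotents (zero by all of them). It determines both the summand mapped to the generator and
  whether the generator is counted.\<close>

definition admissible :: "('r, 'm) module \<Rightarrow> (nat \<times> 'm) set \<Rightarrow> bool" where
  "admissible M G \<longleftrightarrow> finite G \<and>
     (\<forall>(i, m) \<in> G. i \<le> n \<and> m \<in> carrier M \<and> E i \<odot>\<^bsub>M\<^esub> m = m) \<and>
     carrier M \<subseteq> mod_span L M (snd ` G)"

text \<open>By \<open>one_span\<close> the idempotents are full: 1 is a sum of products b c with b
  e_i = b. Then each given generator a is a sum of elements (a b) c with a b in Me_i, and finitely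
  many of these suffice.\<close>

lemma exists_admissible:
  assumes "right_module L M" "fin_gen L M"
  shows "\<exists>G. admissible M G"
proof -
  interpret M: right_module L M by fact
  obtain A where A: "finite A" "A \<subseteq> carrier M" "carrier M \<subseteq> mod_span L M A"
    using assms(2) M.fin_gen_iff_mod_span by blast
  let ?T = "{m \<in> carrier M. \<exists>i\<le>n. E i \<odot>\<^bsub>M\<^esub> m = m}"
  let ?B = "{b \<in> carrier L. \<exists>i\<le>n. b \<otimes> E i = b}"
  have "\<exists>B \<subseteq> ?T. finite B \<and> a \<in> mod_span L M B" if "a \<in> A" for a
  proof -
    have a: "a \<in> carrier M" using A that by blast
    have "\<one> \<odot>\<^bsub>M\<^esub> a \<in> mod_span L M ((\<lambda>b. b \<odot>\<^bsub>M\<^esub> a) ` ?B)"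
      by (rule M.smult_in_mod_span [OF one_span _ a]) auto
    moreover have "(\<lambda>b. b \<odot>\<^bsub>M\<^esub> a) ` ?B \<subseteq> ?T"
      using a M.smult_closed M.smult_mult [OF _ E_closed a] by force
    ultimately have "a \<in> mod_span L M ?T"
      using mod_span_mono M.smult_one [OF a] by (metis (no_types, lifting) subsetD)
    then show ?thesis by (rule mod_span_finite_subset)
  qed
  then have "\<forall>a \<in> A. \<exists>B. B \<subseteq> ?T \<and> finite B \<and> a \<in> mod_span L M B" by blast
  from bchoice [OF this] obtain B where "\<forall>a \<in> A. B a \<subseteq> ?T \<and> finite (B a) \<and> a \<in> mod_span L M (B a)"
    by blast
  then have B: "\<And>a. a \<in> A \<Longrightarrow> B a \<subseteq> ?T" "\<And>a. a \<in> A \<Longrightarrow> finite (B a)"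
    "\<And>a. a \<in> A \<Longrightarrow> a \<in> mod_span L M (B a)" by blast+
  define C where "C = (\<Union>a\<in>A. B a)"
  have C: "finite C" "C \<subseteq> ?T" using A(1) B by (auto simp: C_def)
  then have CM: "C \<subseteq> carrier M" by blast
  have "A \<subseteq> mod_span L M C"
  proof
    fix a assume a: "a \<in> A"
    then show "a \<in> mod_span L M C" using B(3) [OF a] mod_span_mono [of "B a" C L M] by (auto simp: C_def)
  qed
  then have gen: "carrier M \<subseteq> mod_span L M C"
    using M.mod_span_least [OF M.mod_span_submodule [OF CM]] A(3) by blast
  have "\<forall>m \<in> C. \<exists>i. i \<le> n \<and> E i \<odot>\<^bsub>M\<^esub> m = m" using C(2) by blast
  then obtain i where i: "\<And>m. m \<in> C \<Longrightarrow> i m \<le> n \<and> E (i m) \<odot>\<^bsub>M\<^esub> m = m" by metis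
  have "admissible M ((\<lambda>m. (i m, m)) ` C)"
    unfolding admissible_def using C CM i gen by (auto simp: image_image)
  then show ?thesis by blast
qed

text \<open>Take \<open>G\<close> with as few elements of nonzero index as possible.\<close>

lemma exists_minimal_admissible:
  fixes M :: "('r, 'm) module"
  assumes "right_module L M" "fin_gen L M"
  shows "\<exists>G. admissible M G \<and> (\<forall>g \<in> G. fst g \<noteq> 0 \<longrightarrow>
    snd g \<notin> mod_span L M (snd ` (G - {g}) \<union> {m \<in> carrier M. E 0 \<odot>\<^bsub>M\<^esub> m = m}))"
proof -
  interpret M: right_module L M by fact
  define \<mu> where "\<mu> G = card {g \<in> G. fst g \<noteq> 0}" for G :: "(nat \<times> 'm) set"
  obtain G0 where "admissible M G0" using exists_admissible assms by blast
  then obtain G where G: "admissible M G" "\<And>G'. admissible M G' \<Longrightarrow> \<mu> G \<le> \<mu> G'"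
    using ex_has_least_nat [of "admissible M" G0 \<mu>] by blast
  let ?W = "{m \<in> carrier M. E 0 \<odot>\<^bsub>M\<^esub> m = m}"
  have False
    if g: "g \<in> G" "fst g \<noteq> 0" "snd g \<in> mod_span L M (snd ` (G - {g}) \<union> ?W)" for g
  proof -
    obtain B where B: "B \<subseteq> snd ` (G - {g}) \<union> ?W" "finite B" "snd g \<in> mod_span L M B"
      using mod_span_finite_subset [OF g(3)] by blast
    \<comment> \<open>The generator \<open>g\<close> is traded for the finitely many elements of
      Me_0 that its expression uses; they get index 0 and are not counted by
      \<open>\<mu>\<close>.\<close>
    define G' where "G' = (G - {g}) \<union> (\<lambda>m. (0, m)) ` (B \<inter> ?W)"
    have sub: "snd ` G' \<subseteq> carrier M"
      using G(1) by (auto simp: G'_def admissible_def)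
    have "snd ` G' = snd ` (G - {g}) \<union> (B \<inter> ?W)" by (simp add: G'_def image_Un image_image)
    then have "B \<subseteq> snd ` G'" "snd ` (G - {g}) \<subseteq> snd ` G'" using B(1) by blast+
    then have "snd g \<in> mod_span L M (snd ` G')" "snd ` (G - {g}) \<subseteq> mod_span L M (snd ` G')"
      using B(3) mod_span_mono [of B "snd ` G'" L M] M.mod_span_superset [OF _ sub] by blast+
    then have "snd ` G \<subseteq> mod_span L M (snd ` G')" by blast
    then have "carrier M \<subseteq> mod_span L M (snd ` G')"
      using M.mod_span_least [OF M.mod_span_submodule [OF sub]] G(1) unfolding admissible_def by blast
    then have "admissible M G'"
      using G(1) B(2) unfolding admissible_def G'_def by auto
    moreover have "\<mu> G' < \<mu> G"
    proof -
      have fin: "finite {g \<in> G. fst g \<noteq> 0}" using G(1) by (simp add: admissible_def)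
      have "{g \<in> G'. fst g \<noteq> 0} \<subset> {g \<in> G. fst g \<noteq> 0}" using g by (auto simp: G'_def)
      then show ?thesis unfolding \<mu>_def by (rule psubset_card_mono [OF fin])
    qed
    ultimately show False using G(2) by fastforce
  qed
  with G(1) show ?thesis by blast
qed

lemma coset_ring: "ring (L Quot J)"
  by (rule quotient_is_ring)

lemma T_props:
  assumes "i \<in> {1..n}"
  shows "right_module (L Quot J) (T i)"
    and "\<lbrakk>s \<in> carrier (T i); t \<in> carrier (T i); s \<noteq> \<zero>\<^bsub>T i\<^esub>\<rbrakk>
      \<Longrightarrow> \<exists>a \<in> carrier (L Quot J). a \<odot>\<^bsub>T i\<^esub> s = t"
  using ring.mod_top_corner_local [OF coset_ring local [OF assms]] by blast+

text \<open>The last conjunct is what the next differential needs: its image is the kernel of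
  \<open>\<epsilon>\<close>, so each homomorphism to S composes with it to zero. The cover is
  economical only in the summands of nonzero index.\<close>

lemma partial_cover_step:
  assumes M: "right_module L M" "fin_gen L M"
  shows "\<exists>(Q :: ('r, nat \<Rightarrow> 'r) module) \<epsilon>. projective_module L Q \<and> fin_gen L Q \<and> \<epsilon> \<in> mod_hom L Q M \<and>
    \<epsilon> ` carrier Q = carrier M \<and> (\<forall>\<phi> \<in> mod_hom L Q S. \<forall>x \<in> mod_ker Q M \<epsilon>. \<phi> x = \<zero>\<^bsub>S\<^esub>)"
proof -
  interpret M: right_module L M by fact
  let ?W = "{m \<in> carrier M. E 0 \<odot>\<^bsub>M\<^esub> m = m}"
  obtain G where adm: "admissible M G" and
    min: "\<And>g. g \<in> G \<Longrightarrow> fst g \<noteq> 0 \<Longrightarrow> snd g \<notin> mod_span L M (snd ` (G - {g}) \<union> ?W)"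
    using exists_minimal_admissible [OF M] by blast
  have G: "finite G" "\<And>g. g \<in> G \<Longrightarrow> fst g \<le> n \<and> snd g \<in> carrier M \<and> E (fst g) \<odot>\<^bsub>M\<^esub> snd g = snd g"
    "carrier M \<subseteq> mod_span L M (snd ` G)"
    using adm unfolding admissible_def by auto
  define k where "k = card G"
  obtain h where h: "bij_betw h {..<k} G"
    using ex_bij_betw_nat_finite [OF G(1)] by (auto simp: k_def atLeast0LessThan)
  have hG: "h t \<in> G" if "t < k" for t using h that by (auto simp: bij_betw_def)
  \<comment> \<open>The value zero from \<open>k\<close> on meets the requirement of
    \<open>idem_family\<close>; likewise \<open>m\<close> is padded by zero so that all its values
    lie in M.\<close>
  define F where "F t = (if t < k then E (fst (h t)) else \<zero>)" for t
  define m where "m t = (if t < k then snd (h t) else \<zero>\<^bsub>M\<^esub>)" for t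
  interpret F: idem_family L F k
    by unfold_locales (use hG G(2) E_closed E_idem in \<open>auto simp: F_def\<close>)
  have m: "m t \<in> carrier M" for t using hG G(2) by (simp add: m_def)
  have Fm: "F t \<odot>\<^bsub>M\<^esub> m t = m t" if "t < k" for t using hG G(2) that by (simp add: m_def F_def)
  let ?Q = "idem_sum L F" and ?\<epsilon> = "lin_comb M m k"
  have \<epsilon>: "?\<epsilon> \<in> mod_hom L ?Q M" by (rule F.lin_comb_hom [OF M(1) m])
  have "m ` {..<k} = snd ` G"
    using h by (auto simp: m_def bij_betw_def image_image [symmetric] cong: image_cong_simp)
  then have "carrier M \<subseteq> ?\<epsilon> ` carrier ?Q"
    using F.lin_comb_image [OF M(1) m Fm] G(3) by simp
  then have surj: "?\<epsilon> ` carrier ?Q = carrier M" using mod_homD(1) [OF \<epsilon>] by blast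
  have "\<phi> x = \<zero>\<^bsub>S\<^esub>" if \<phi>: "\<phi> \<in> mod_hom L ?Q S" and x: "x \<in> mod_ker ?Q M ?\<epsilon>" for \<phi> x
  proof (rule ccontr)
    assume nz: "\<phi> x \<noteq> \<zero>\<^bsub>S\<^esub>"
    have xQ: "x \<in> carrier ?Q" and \<epsilon>x: "?\<epsilon> x = \<zero>\<^bsub>M\<^esub>" using x by (simp_all add: mod_ker_def)
    have x': "x t \<in> carrier L" "F t \<otimes> x t = x t" for t using xQ by auto
    have \<phi>S: "\<phi> y \<in> (\<Pi>\<^sub>E i\<in>{1..n}. carrier (T i))" if "y \<in> carrier ?Q" for y
      using mod_homD(1) [OF \<phi> that] by (simp add: restrict_scalars_def dsum_mod_def)
    have "\<exists>i \<in> {1..n}. \<phi> x i \<noteq> \<zero>\<^bsub>T i\<^esub>"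
    proof (rule ccontr)
      assume "\<not> (\<exists>i \<in> {1..n}. \<phi> x i \<noteq> \<zero>\<^bsub>T i\<^esub>)"
      then have "\<phi> x = (\<lambda>i\<in>{1..n}. \<zero>\<^bsub>T i\<^esub>)"
        using \<phi>S [OF xQ] by (intro extensionalityI [of _ "{1..n}"]) (auto simp: PiE_iff)
      with nz show False by (simp add: restrict_scalars_def dsum_mod_def)
    qed
    then obtain i where i: "i \<in> {1..n}" "\<phi> x i \<noteq> \<zero>\<^bsub>T i\<^esub>" by blast
    let ?Ti = "restrict_scalars ((+>) J) (T i)"
    interpret Ti: right_module "L Quot J" "T i" by (rule T_props(1) [OF i(1)])
    have Ti: "right_module L ?Ti"
      by (rule restrict_scalars_right_module [OF rcos_ring_hom ring_axioms T_props(1) [OF i(1)]])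
    \<comment> \<open>The component of \<open>\<phi>\<close> in a simple factor in which
      \<open>\<phi> x\<close> does not vanish.\<close>
    define \<psi> where "\<psi> y = \<phi> y i" for y
    have \<psi>: "\<psi> \<in> mod_hom L ?Q ?Ti"
      using mod_homD [OF \<phi>] \<phi>S i(1)
      by (auto simp: mod_hom_def \<psi>_def restrict_scalars_def dsum_mod_def PiE_iff)
    have simps: "carrier ?Ti = carrier (T i)" "\<zero>\<^bsub>?Ti\<^esub> = \<zero>\<^bsub>T i\<^esub>" "add ?Ti = add (T i)"
      "smult ?Ti = (\<lambda>a x. (J +> a) \<odot>\<^bsub>T i\<^esub> x)"
      by (simp_all add: restrict_scalars_def)
    \<comment> \<open>As \<open>x\<close> is the sum of its coordinates, \<open>\<psi>\<close>
      cannot kill all of them.\<close>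
    have "\<exists>t<k. \<psi> (F.single t (x t)) \<noteq> \<zero>\<^bsub>T i\<^esub>"
    proof (rule ccontr)
      assume *: "\<not> (\<exists>t<k. \<psi> (F.single t (x t)) \<noteq> \<zero>\<^bsub>T i\<^esub>)"
      have "\<psi> x = \<zero>\<^bsub>T i\<^esub>"
        using xQ
      proof (induction rule: F.Q_induct)
        case zero
        show ?case using mod_hom_zero [OF \<psi> F.right_module_Q Ti] by (simp add: simps)
      next
        case (single t)
        then show ?case using * by blast
      next
        case (add y z)
        then show ?case using mod_homD(2) [OF \<psi> add.hyps(1,2)] by (simp add: simps)
      qed
      then show False using i(2) by (simp add: \<psi>_def)
    qed
    then obtain t where t: "t < k" "\<psi> (F.single t (x t)) \<noteq> \<zero>\<^bsub>T i\<^esub>" by blast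
    define e where "e = E (fst (h t))"
    have e: "e = F t" "e \<in> carrier L" "e \<otimes> e = e"
      using t F.E_closed [of t] F.E_idem [of t] by (auto simp: e_def F_def)
    have s: "F.single t e \<in> carrier ?Q" using F.single_in_Q e by simp
    \<comment> \<open>The image of the t-th generator. It determines \<open>\<psi>\<close> on the
      t-th summand, where \<open>\<psi>\<close> is the action on \<open>s0\<close>.\<close>
    define s0 where "s0 = \<psi> (F.single t e)"
    have s0: "s0 \<in> carrier (T i)" using mod_homD(1) [OF \<psi> s] by (simp add: s0_def simps)
    have \<psi>_single: "\<psi> (F.single t y) = (J +> y) \<odot>\<^bsub>T i\<^esub> s0" if "y \<in> carrier L" "e \<otimes> y = y" for y
    proof -
      have "F.single t y = y \<odot>\<^bsub>?Q\<^esub> F.single t e"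
        using that unfolding e(1) by (intro F.single_eq_smult)
      then show ?thesis
        using mod_homD(3) [OF \<psi> that(1) s] by (simp only: s0_def simps)
    qed
    have es0: "(J +> e) \<odot>\<^bsub>T i\<^esub> s0 = s0" using \<psi>_single [of e] e by (simp add: s0_def)
    have xt: "x t \<in> carrier L" "e \<otimes> x t = x t" using x' e by auto
    have xs0: "(J +> x t) \<odot>\<^bsub>T i\<^esub> s0 \<noteq> \<zero>\<^bsub>T i\<^esub>" using \<psi>_single [OF xt] t by simp
    have coset_closed: "J +> y \<in> carrier (L Quot J)" if "y \<in> carrier L" for y
      using ring_hom_closed [OF rcos_ring_hom that] .
    \<comment> \<open>With index 0 the idempotent \<open>e\<close> lies in J and acts as zero on
      \<open>T i\<close>, although it fixes the nonzero element \<open>s0\<close>.\<close>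
    have fst_nz: "fst (h t) \<noteq> 0"
    proof
      assume "fst (h t) = 0"
      then have "J +> e = \<zero>\<^bsub>L Quot J\<^esub>"
        using E_0 a_coset_join2 [of e J] e a_subgroup by (simp add: e_def FactRing_def)
      then have "s0 = \<zero>\<^bsub>T i\<^esub>" using es0 s0 by simp
      with xs0 show False using coset_closed [OF xt(1)] by simp
    qed
    have "fst (h t) \<in> {1..n}" using fst_nz G(2) [OF hG [OF t(1)]] by simp
    then have "corner_local (L Quot J) (J +> e)" using local by (simp add: e_def)
    \<comment> \<open>Locality is that of the corner at the class of \<open>e\<close>, simplicity
      that of \<open>T i\<close>. Together they make the class of \<open>x t\<close> right
      invertible up to \<open>e\<close>.\<close>
    then have "\<exists>b \<in> carrier (L Quot J). (J +> x t) \<otimes>\<^bsub>L Quot J\<^esub> b = J +> e"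
      using T_props(2) [OF i(1)] s0 es0 coset_closed [OF xt(1)] xs0
        ring_hom_mult [OF rcos_ring_hom e(2) xt(1)] xt(2)
      by (intro Ti.right_inverse_of_nonzero_action) auto
    then obtain b where b: "b \<in> carrier (L Quot J)" "(J +> x t) \<otimes>\<^bsub>L Quot J\<^esub> b = J +> e" by blast
    obtain l where l: "l \<in> carrier L" "b = J +> l"
      using b(1) by (auto simp: FactRing_def A_RCOSETS_def')
    then have "J +> (x t \<otimes> l) = J +> e"
      using b(2) ring_hom_mult [OF rcos_ring_hom xt(1) l(1)] by simp
    \<comment> \<open>Back in L, right invertibility holds up to an error term in J.\<close>
    then have p: "e \<ominus> x t \<otimes> l \<in> J"
      using xt l e a_rcos_module_minus [OF ring_axioms, of "x t \<otimes> l" e] a_rcos_self [OF e(2)] by auto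
    let ?B = "snd ` (G - {h t}) \<union> ?W"
    have BM: "?B \<subseteq> carrier M" using G(2) by auto
    note span = M.submoduleD [OF M.mod_span_submodule [OF BM]]
    have mt: "m t = snd (h t)" using t by (simp add: m_def)
    \<comment> \<open>The error acts harmlessly: by \<open>J_span\<close> it is a sum of terms b c
      with b e_0 = b, and it sends m_t into the submodule generated by Me_0.\<close>
    have pm: "(e \<ominus> x t \<otimes> l) \<odot>\<^bsub>M\<^esub> m t \<in> mod_span L M ?B"
    proof -
      let ?C = "{b \<in> carrier L. b \<otimes> E 0 = b}"
      have "(e \<ominus> x t \<otimes> l) \<odot>\<^bsub>M\<^esub> m t \<in> mod_span L M ((\<lambda>b. b \<odot>\<^bsub>M\<^esub> m t) ` ?C)"
        using p J_span by (intro M.smult_in_mod_span m) auto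
      moreover have "(\<lambda>b. b \<odot>\<^bsub>M\<^esub> m t) ` ?C \<subseteq> ?B"
        using M.smult_closed [OF _ m] M.smult_mult [OF _ E_closed m, of _ 0] by force
      ultimately show ?thesis using mod_span_mono by blast
    qed
    \<comment> \<open>\<open>x\<close> with its t-th coordinate deleted. Since \<open>x\<close> lies
      in the kernel, m_t x_t is minus the image of \<open>z\<close>, a combination of the other
      generators.\<close>
    define z where "z s = (if s = t then \<zero> else x s)" for s
    have z: "z s \<in> carrier L" for s using x' by (simp add: z_def)
    have "?\<epsilon> z \<in> mod_span L M ?B"
    proof (rule M.lin_comb_in_mod_span [OF BM m z])
      fix s assume s: "s < k"
      show "m s \<in> ?B \<or> z s = \<zero>"
      proof (cases "s = t")
        case False
        then have "h s \<noteq> h t" using h s t by (auto simp: bij_betw_def inj_on_def)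
        then show ?thesis using hG [OF s] s by (auto simp: m_def)
      qed (simp add: z_def)
    qed
    moreover have "?\<epsilon> x = x t \<odot>\<^bsub>M\<^esub> m t \<oplus>\<^bsub>M\<^esub> ?\<epsilon> z"
    proof -
      have "x = (\<lambda>s. F.single t (x t) s \<oplus> z s)" using x' by (auto simp: z_def)
      then have "?\<epsilon> x = ?\<epsilon> (F.single t (x t)) \<oplus>\<^bsub>M\<^esub> ?\<epsilon> z"
        using M.lin_comb_add [of m "F.single t (x t)" z k] m x' z by simp
      then show ?thesis using M.lin_comb_single [of m "x t" k t] m x' t by simp
    qed
    ultimately have xm: "x t \<odot>\<^bsub>M\<^esub> m t \<in> mod_span L M ?B"
      using \<epsilon>x span(1,5) M.minus_equality [of "x t \<odot>\<^bsub>M\<^esub> m t" "?\<epsilon> z"]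
        M.smult_closed [OF xt(1) m] by force
    \<comment> \<open>With p = e - x_t l, and the action on the right, m_t = m_t e = m_t p + (m_t
      x_t) l. Both terms lie in the span of the other generators and Me_0, against
      minimality.\<close>
    have "e \<odot>\<^bsub>M\<^esub> m t = (e \<ominus> x t \<otimes> l \<oplus> x t \<otimes> l) \<odot>\<^bsub>M\<^esub> m t"
      using xt l e by (simp add: minus_eq a_assoc l_neg)
    also have "\<dots> = (e \<ominus> x t \<otimes> l) \<odot>\<^bsub>M\<^esub> m t \<oplus>\<^bsub>M\<^esub> l \<odot>\<^bsub>M\<^esub> (x t \<odot>\<^bsub>M\<^esub> m t)"
      using xt l e m by (simp add: M.smult_add_scalar M.smult_mult)
    finally have "m t \<in> mod_span L M ?B"
      using Fm [OF t(1)] e(1) span(3) [OF pm span(4) [OF l(1) xm]] by simp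
    then show False using min [OF hG [OF t(1)] fst_nz] mt by simp
  qed
  with F.projective_Q F.fin_gen_Q \<epsilon> surj show ?thesis
    by (intro exI [of _ ?Q] exI [of _ ?\<epsilon>] conjI ballI)
qed

text \<open>Dependent choice, repeatedly covering a kernel. Each kernel is finitely generated
  because a finitely generated module over a right noetherian ring is noetherian, so
  \<open>partial_cover_step\<close> applies again.\<close>

theorem exists_partially_minimal_resolution:
  assumes M: "right_module L M" "fin_gen L M"
  shows "\<exists>Q \<epsilon> f. fg_projective_resolution L M Q \<epsilon> f \<and> partially_minimal L S Q f"
proof -
  \<comment> \<open>A state consists of a term Q of the resolution and the submodule H that the next
    differential must have as image. The invariant that S-valued maps vanish on H is the partial
    minimality of that differential.\<close>
  define good :: "('r, nat \<Rightarrow> 'r) module \<times> (nat \<Rightarrow> 'r) set \<Rightarrow> bool" where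
    "good = (\<lambda>(Q, H). projective_module L Q \<and> fin_gen L Q \<and> submodule H L Q \<and>
       (\<forall>\<phi> \<in> mod_hom L Q S. \<forall>x \<in> H. \<phi> x = \<zero>\<^bsub>S\<^esub>))"
  define next_term :: "('r, nat \<Rightarrow> 'r) module \<times> (nat \<Rightarrow> 'r) set \<Rightarrow>
      ('r, nat \<Rightarrow> 'r) module \<times> (nat \<Rightarrow> 'r) set \<Rightarrow> bool" where
    "next_term = (\<lambda>(Q, H) (Q', H'). \<exists>f. f \<in> mod_hom L Q' Q \<and>
     f ` carrier Q' = H \<and> H' = mod_ker Q' Q f)"
  have fg: "fin_gen L (Q\<lparr>carrier := H\<rparr>)" "right_module L (Q\<lparr>carrier := H\<rparr>)"
    if Q: "projective_module L Q" "fin_gen L Q" "submodule H L Q"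
    for Q :: "('r, nat \<Rightarrow> 'r) module" and H
  proof -
    interpret Q: right_module L Q using Q(1) by (simp add: projective_module_def)
    show rm: "right_module L (Q\<lparr>carrier := H\<rparr>)" by (rule Q.submodule_is_right_module [OF Q(3)])
    obtain A where "A \<subseteq> H" "finite A" "H \<subseteq> mod_span L Q A"
      using Q.fin_gen_imp_noetherian [OF noetherian Q(2)] Q(3) by (auto simp: noetherian_module_def)
    then show "fin_gen L (Q\<lparr>carrier := H\<rparr>)"
      unfolding right_module.fin_gen_iff_mod_span [OF rm] mod_span_carrier_update by auto
  qed
  have step: "\<exists>QH'. good QH' \<and> next_term QH QH'" if "good QH" for QH
  proof -
    obtain Q H where QH: "QH = (Q, H)" by fastforce
    have Q: "projective_module L Q" "fin_gen L Q" "submodule H L Q"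
      using that by (auto simp: good_def QH)
    let ?K = "Q\<lparr>carrier := H\<rparr>"
    obtain Q' :: "('r, nat \<Rightarrow> 'r) module" and f where Q': "projective_module L Q'" "fin_gen L Q'" "f \<in> mod_hom L Q' ?K"
      "f ` carrier Q' = carrier ?K" "\<forall>\<phi> \<in> mod_hom L Q' S. \<forall>x \<in> mod_ker Q' ?K f. \<phi> x = \<zero>\<^bsub>S\<^esub>"
      using partial_cover_step [OF fg(2,1) [OF Q]] by blast
    have ker: "mod_ker Q' ?K f = mod_ker Q' Q f" by (simp add: mod_ker_def)
    have "H \<subseteq> carrier Q"
      using right_module.submoduleD(1) Q(1,3) by (auto simp: projective_module_def)
    then have "f \<in> mod_hom L Q' Q" using Q'(3) by (auto simp: mod_hom_def)
    moreover have "submodule (mod_ker Q' Q f) L Q'"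
      using mod_ker_submodule [OF Q'(3)] Q'(1) fg(2) [OF Q] ker by (simp add: projective_module_def)
    ultimately show ?thesis
      using Q' ker by (intro exI [of _ "(Q', mod_ker Q' Q f)"]) (auto simp: good_def next_term_def QH)
  qed
  \<comment> \<open>M lives on a carrier type of its own, so the augmentation is constructed outside
    the iteration.\<close>
  obtain Q0 :: "('r, nat \<Rightarrow> 'r) module" and \<epsilon> where Q0: "projective_module L Q0" "fin_gen L Q0" "\<epsilon> \<in> mod_hom L Q0 M"
    "\<epsilon> ` carrier Q0 = carrier M" "\<forall>\<phi> \<in> mod_hom L Q0 S. \<forall>x \<in> mod_ker Q0 M \<epsilon>. \<phi> x = \<zero>\<^bsub>S\<^esub>"
    using partial_cover_step [OF M] by blast
  have "good (Q0, mod_ker Q0 M \<epsilon>)"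
    using Q0 mod_ker_submodule [OF Q0(3) _ M(1)] by (auto simp: good_def projective_module_def)
  \<comment> \<open>The clause for i = 0 pins the start of the sequence to the chosen
    augmentation.\<close>
  then have "\<exists>QH. \<forall>i. (good (QH i) \<and> (i = 0 \<longrightarrow> QH i = (Q0, mod_ker Q0 M \<epsilon>))) \<and>
      next_term (QH i) (QH (Suc i))"
    using step by (intro dependent_nat_choice) auto
  then obtain QH where QH: "QH 0 = (Q0, mod_ker Q0 M \<epsilon>)" "\<And>i. good (QH i)"
    "\<And>i. next_term (QH i) (QH (Suc i))" by blast
  define Q where "Q i = fst (QH i)" for i
  have "\<forall>i. \<exists>f. f \<in> mod_hom L (Q (Suc i)) (Q i) \<and> f ` carrier (Q (Suc i)) = snd (QH i) \<and>
      snd (QH (Suc i)) = mod_ker (Q (Suc i)) (Q i) f"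
    using QH(3) by (simp add: next_term_def Q_def case_prod_unfold)
  from choice [OF this] obtain f where
    "\<forall>i. f i \<in> mod_hom L (Q (Suc i)) (Q i) \<and> f i ` carrier (Q (Suc i)) = snd (QH i) \<and>
      snd (QH (Suc i)) = mod_ker (Q (Suc i)) (Q i) (f i)" by blast
  then have f: "\<And>i. f i \<in> mod_hom L (Q (Suc i)) (Q i)"
    "\<And>i. f i ` carrier (Q (Suc i)) = snd (QH i)"
    "\<And>i. snd (QH (Suc i)) = mod_ker (Q (Suc i)) (Q i) (f i)" by blast+
  have good: "projective_module L (Q i)" "fin_gen L (Q i)"
    "\<And>\<phi> x. \<phi> \<in> mod_hom L (Q i) S \<Longrightarrow> x \<in> snd (QH i) \<Longrightarrow> \<phi> x = \<zero>\<^bsub>S\<^esub>" for i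
    using QH(2) [of i] by (auto simp: good_def Q_def case_prod_unfold)
  have "fg_projective_resolution L M Q \<epsilon> f"
    unfolding fg_projective_resolution_def
    using good f Q0 QH(1) by (simp add: Q_def)
  moreover have "partially_minimal L S Q f"
    unfolding partially_minimal_def hom_induced_zero_def using good(3) f(2) by blast
  ultimately show ?thesis by blast
qed

end


subsection \<open>Direct sums in linear categories\<close>

context linear_category
begin

lemma hom_abelian_group: "\<lbrakk>A \<in> Obj \<C>; B \<in> Obj \<C>\<rbrakk> \<Longrightarrow> abelian_group (Hom \<C> A B)"
  using hom_module by (auto simp: module_def)

lemma hom_zero_closed: "\<lbrakk>A \<in> Obj \<C>; B \<in> Obj \<C>\<rbrakk> \<Longrightarrow> \<zero>\<^bsub>Hom \<C> A B\<^esub> \<in> Mor \<C> A B"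
  by (rule abelian_groupE(2) [OF hom_abelian_group])

lemma hom_add_closed:
  "\<lbrakk>A \<in> Obj \<C>; B \<in> Obj \<C>; f \<in> Mor \<C> A B; g \<in> Mor \<C> A B\<rbrakk> \<Longrightarrow> f \<oplus>\<^bsub>Hom \<C> A B\<^esub> g \<in> Mor \<C> A B"
  by (rule abelian_groupE(1) [OF hom_abelian_group])

lemma hom_add_zero:
  assumes "A \<in> Obj \<C>" "B \<in> Obj \<C>" "f \<in> Mor \<C> A B"
  shows "f \<oplus>\<^bsub>Hom \<C> A B\<^esub> \<zero>\<^bsub>Hom \<C> A B\<^esub> = f" "\<zero>\<^bsub>Hom \<C> A B\<^esub> \<oplus>\<^bsub>Hom \<C> A B\<^esub> f = f"
proof -
  interpret H: abelian_group "Hom \<C> A B" by (rule hom_abelian_group [OF assms(1,2)])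
  show "f \<oplus>\<^bsub>Hom \<C> A B\<^esub> \<zero>\<^bsub>Hom \<C> A B\<^esub> = f" "\<zero>\<^bsub>Hom \<C> A B\<^esub> \<oplus>\<^bsub>Hom \<C> A B\<^esub> f = f"
    using assms by simp_all
qed

lemma finsum_hom_closed:
  assumes "A \<in> Obj \<C>" "B \<in> Obj \<C>" "\<And>j. j \<in> J \<Longrightarrow> f j \<in> Mor \<C> A B"
  shows "(\<Oplus>\<^bsub>Hom \<C> A B\<^esub>j \<in> J. f j) \<in> Mor \<C> A B"
proof -
  interpret H: abelian_group "Hom \<C> A B" by (rule hom_abelian_group [OF assms(1,2)])
  show ?thesis using assms(3) by (intro H.finsum_closed) auto
qed

lemma finsum_hom_insert:
  assumes "A \<in> Obj \<C>" "B \<in> Obj \<C>" "finite J" "i \<notin> J" "\<And>j. j \<in> insert i J \<Longrightarrow> f j \<in> Mor \<C> A B"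
  shows "(\<Oplus>\<^bsub>Hom \<C> A B\<^esub>j \<in> insert i J. f j) = f i \<oplus>\<^bsub>Hom \<C> A B\<^esub> (\<Oplus>\<^bsub>Hom \<C> A B\<^esub>j \<in> J. f j)"
proof -
  interpret H: abelian_group "Hom \<C> A B" by (rule hom_abelian_group [OF assms(1,2)])
  show ?thesis using assms(3-5) by (intro H.finsum_insert) auto
qed

lemma finsum_hom_empty:
  assumes "A \<in> Obj \<C>" "B \<in> Obj \<C>"
  shows "(\<Oplus>\<^bsub>Hom \<C> A B\<^esub>j \<in> {}. f j) = \<zero>\<^bsub>Hom \<C> A B\<^esub>"
proof -
  interpret H: abelian_group "Hom \<C> A B" by (rule hom_abelian_group [OF assms(1,2)])
  show ?thesis by simp
qed

lemma finsum_hom_cong: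
  assumes "A \<in> Obj \<C>" "B \<in> Obj \<C>" "\<And>j. j \<in> J \<Longrightarrow> g j \<in> Mor \<C> A B" "\<And>j. j \<in> J \<Longrightarrow> f j = g j"
  shows "(\<Oplus>\<^bsub>Hom \<C> A B\<^esub>j \<in> J. f j) = (\<Oplus>\<^bsub>Hom \<C> A B\<^esub>j \<in> J. g j)"
proof -
  interpret H: abelian_group "Hom \<C> A B" by (rule hom_abelian_group [OF assms(1,2)])
  show ?thesis using assms(3,4) by (intro H.finsum_cong') auto
qed

lemma finsum_hom_in:
  assumes "A \<in> Obj \<C>" "B \<in> Obj \<C>" "finite J"
    and "\<And>j. j \<in> J \<Longrightarrow> f j \<in> H" "H \<subseteq> Mor \<C> A B" "\<zero>\<^bsub>Hom \<C> A B\<^esub> \<in> H"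
    and "\<And>x y. x \<in> H \<Longrightarrow> y \<in> H \<Longrightarrow> x \<oplus>\<^bsub>Hom \<C> A B\<^esub> y \<in> H"
  shows "(\<Oplus>\<^bsub>Hom \<C> A B\<^esub>j \<in> J. f j) \<in> H"
  using assms(3,4)
proof (induction J)
  case empty
  then show ?case using assms by (simp add: finsum_hom_empty)
next
  case (insert i J)
  have "(\<Oplus>\<^bsub>Hom \<C> A B\<^esub>j \<in> insert i J. f j) = f i \<oplus>\<^bsub>Hom \<C> A B\<^esub> (\<Oplus>\<^bsub>Hom \<C> A B\<^esub>j \<in> J. f j)"
    using insert assms(5) by (intro finsum_hom_insert assms(1,2)) auto
  then show ?case using insert assms(7) by simp
qed

lemma comp_zero_left:
  assumes "A \<in> Obj \<C>" "B \<in> Obj \<C>" "C \<in> Obj \<C>" "f \<in> Mor \<C> A B"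
  shows "Comp \<C> A B C \<zero>\<^bsub>Hom \<C> B C\<^esub> f = \<zero>\<^bsub>Hom \<C> A C\<^esub>"
proof -
  interpret BC: module R "Hom \<C> B C" by (rule hom_module [OF assms(2,3)])
  interpret AC: module R "Hom \<C> A C" by (rule hom_module [OF assms(1,3)])
  have "Comp \<C> A B C (\<zero>\<^bsub>R\<^esub> \<odot>\<^bsub>Hom \<C> B C\<^esub> \<zero>\<^bsub>Hom \<C> B C\<^esub>) f
      = \<zero>\<^bsub>R\<^esub> \<odot>\<^bsub>Hom \<C> A C\<^esub> Comp \<C> A B C \<zero>\<^bsub>Hom \<C> B C\<^esub> f"
    using assms by (intro comp_smult_left) auto
  then show ?thesis using comp_closed [OF assms BC.M.zero_closed] by simp
qed

lemma comp_zero_right: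
  assumes "A \<in> Obj \<C>" "B \<in> Obj \<C>" "C \<in> Obj \<C>" "g \<in> Mor \<C> B C"
  shows "Comp \<C> A B C g \<zero>\<^bsub>Hom \<C> A B\<^esub> = \<zero>\<^bsub>Hom \<C> A C\<^esub>"
proof -
  interpret AB: module R "Hom \<C> A B" by (rule hom_module [OF assms(1,2)])
  interpret AC: module R "Hom \<C> A C" by (rule hom_module [OF assms(1,3)])
  have "Comp \<C> A B C g (\<zero>\<^bsub>R\<^esub> \<odot>\<^bsub>Hom \<C> A B\<^esub> \<zero>\<^bsub>Hom \<C> A B\<^esub>)
      = \<zero>\<^bsub>R\<^esub> \<odot>\<^bsub>Hom \<C> A C\<^esub> Comp \<C> A B C g \<zero>\<^bsub>Hom \<C> A B\<^esub>"
    using assms by (intro comp_smult_right) auto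
  then show ?thesis using comp_closed [OF assms(1-3) AB.M.zero_closed assms(4)] by simp
qed

lemma comp_finsum_right:
  assumes "A \<in> Obj \<C>" "B \<in> Obj \<C>" "C \<in> Obj \<C>" "g \<in> Mor \<C> B C" "finite J"
    and "\<And>j. j \<in> J \<Longrightarrow> f j \<in> Mor \<C> A B"
  shows "Comp \<C> A B C g (\<Oplus>\<^bsub>Hom \<C> A B\<^esub>j \<in> J. f j) = (\<Oplus>\<^bsub>Hom \<C> A C\<^esub>j \<in> J. Comp \<C> A B C g (f j))"
  using assms(5,6)
proof (induction J)
  case empty
  then show ?case using assms by (simp add: finsum_hom_empty comp_zero_right)
next
  case (insert i J)
  have "(\<Oplus>\<^bsub>Hom \<C> A B\<^esub>j \<in> insert i J. f j) = f i \<oplus>\<^bsub>Hom \<C> A B\<^esub> (\<Oplus>\<^bsub>Hom \<C> A B\<^esub>j \<in> J. f j)"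
    using insert by (intro finsum_hom_insert assms(1,2)) auto
  moreover have "(\<Oplus>\<^bsub>Hom \<C> A C\<^esub>j \<in> insert i J. Comp \<C> A B C g (f j))
      = Comp \<C> A B C g (f i) \<oplus>\<^bsub>Hom \<C> A C\<^esub> (\<Oplus>\<^bsub>Hom \<C> A C\<^esub>j \<in> J. Comp \<C> A B C g (f j))"
    using insert by (intro finsum_hom_insert comp_closed assms(1-4)) auto
  moreover have "(\<Oplus>\<^bsub>Hom \<C> A B\<^esub>j \<in> J. f j) \<in> Mor \<C> A B"
    using insert by (intro finsum_hom_closed assms(1,2)) auto
  ultimately show ?case using insert assms(1-4) by (simp add: comp_add_right)
qed

lemma comp_finsum_left:
  assumes "A \<in> Obj \<C>" "B \<in> Obj \<C>" "C \<in> Obj \<C>" "f \<in> Mor \<C> A B" "finite J"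
    and "\<And>j. j \<in> J \<Longrightarrow> g j \<in> Mor \<C> B C"
  shows "Comp \<C> A B C (\<Oplus>\<^bsub>Hom \<C> B C\<^esub>j \<in> J. g j) f = (\<Oplus>\<^bsub>Hom \<C> A C\<^esub>j \<in> J. Comp \<C> A B C (g j) f)"
  using assms(5,6)
proof (induction J)
  case empty
  then show ?case using assms by (simp add: finsum_hom_empty comp_zero_left)
next
  case (insert i J)
  have "(\<Oplus>\<^bsub>Hom \<C> B C\<^esub>j \<in> insert i J. g j) = g i \<oplus>\<^bsub>Hom \<C> B C\<^esub> (\<Oplus>\<^bsub>Hom \<C> B C\<^esub>j \<in> J. g j)"
    using insert by (intro finsum_hom_insert assms(2,3)) auto
  moreover have "(\<Oplus>\<^bsub>Hom \<C> A C\<^esub>j \<in> insert i J. Comp \<C> A B C (g j) f)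
      = Comp \<C> A B C (g i) f \<oplus>\<^bsub>Hom \<C> A C\<^esub> (\<Oplus>\<^bsub>Hom \<C> A C\<^esub>j \<in> J. Comp \<C> A B C (g j) f)"
    using insert by (intro finsum_hom_insert comp_closed assms(1-4)) auto
  moreover have "(\<Oplus>\<^bsub>Hom \<C> B C\<^esub>j \<in> J. g j) \<in> Mor \<C> B C"
    using insert by (intro finsum_hom_closed assms(2,3)) auto
  ultimately show ?case using insert assms(1-4) by (simp add: comp_add_left)
qed

lemma direct_sumD:
  assumes "direct_sum \<C> J F Y \<iota> \<pi>"
  shows "finite J" "Y \<in> Obj \<C>"
    "\<And>j. j \<in> J \<Longrightarrow> F j \<in> Obj \<C>" "\<And>j. j \<in> J \<Longrightarrow> \<iota> j \<in> Mor \<C> (F j) Y"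
    "\<And>j. j \<in> J \<Longrightarrow> \<pi> j \<in> Mor \<C> Y (F j)"
    "\<And>j. j \<in> J \<Longrightarrow> Comp \<C> (F j) Y (F j) (\<pi> j) (\<iota> j) = Id \<C> (F j)"
    "\<And>j l. j \<in> J \<Longrightarrow> l \<in> J \<Longrightarrow> j \<noteq> l \<Longrightarrow> Comp \<C> (F j) Y (F l) (\<pi> l) (\<iota> j) = \<zero>\<^bsub>Hom \<C> (F j) (F l)\<^esub>"
    "(\<Oplus>\<^bsub>Hom \<C> Y Y\<^esub>j \<in> J. Comp \<C> Y (F j) Y (\<iota> j) (\<pi> j)) = Id \<C> Y"
  using assms by (auto simp: direct_sum_def)

text \<open>Only the l-th term survives composition with \<open>\<pi> l\<close>. The set
  \<open>J'\<close> may be smaller than \<open>J\<close>, which allows maps from the sum of some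
  summands into the whole object.\<close>

lemma proj_of_sum:
  assumes ds: "direct_sum \<C> J F Y \<iota> \<pi>" and "J' \<subseteq> J" "l \<in> J" "A \<in> Obj \<C>"
    and f: "\<And>j. j \<in> J' \<Longrightarrow> f j \<in> Mor \<C> A (F j)"
  shows "Comp \<C> A Y (F l) (\<pi> l) (\<Oplus>\<^bsub>Hom \<C> A Y\<^esub>j \<in> J'. Comp \<C> A (F j) Y (\<iota> j) (f j))
    = (if l \<in> J' then f l else \<zero>\<^bsub>Hom \<C> A (F l)\<^esub>)"
proof -
  note D = direct_sumD [OF ds]
  interpret H: abelian_group "Hom \<C> A (F l)" using assms D by (intro hom_abelian_group) auto
  have fin: "finite J'" using D(1) assms(2) finite_subset by blast
  have J': "j \<in> J" if "j \<in> J'" for j using that assms(2) by blast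
  have "Comp \<C> A Y (F l) (\<pi> l) (\<Oplus>\<^bsub>Hom \<C> A Y\<^esub>j \<in> J'. Comp \<C> A (F j) Y (\<iota> j) (f j))
      = (\<Oplus>\<^bsub>Hom \<C> A (F l)\<^esub>j \<in> J'. Comp \<C> A Y (F l) (\<pi> l) (Comp \<C> A (F j) Y (\<iota> j) (f j)))"
    using fin f J' assms(3,4) D by (intro comp_finsum_right comp_closed) auto
  also have "\<dots> = (\<Oplus>\<^bsub>Hom \<C> A (F l)\<^esub>j \<in> J'. if l = j then f l else \<zero>\<^bsub>Hom \<C> A (F l)\<^esub>)"
  proof (rule finsum_hom_cong)
    fix j assume j: "j \<in> J'"
    have "Comp \<C> A Y (F l) (\<pi> l) (Comp \<C> A (F j) Y (\<iota> j) (f j))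
        = Comp \<C> A (F j) (F l) (Comp \<C> (F j) Y (F l) (\<pi> l) (\<iota> j)) (f j)"
      using J' [OF j] f [OF j] assms(3,4) D by (intro comp_assoc [symmetric]) auto
    then show "Comp \<C> A Y (F l) (\<pi> l) (Comp \<C> A (F j) Y (\<iota> j) (f j))
        = (if l = j then f l else \<zero>\<^bsub>Hom \<C> A (F l)\<^esub>)"
      using D(6) [of l] D(7) [of j l] J' [OF j] f [OF j] assms(3,4) D(3)
      by (auto simp: comp_id_left comp_zero_left)
    show "(if l = j then f l else \<zero>\<^bsub>Hom \<C> A (F l)\<^esub>) \<in> Mor \<C> A (F l)" using f j by auto
  qed (use assms D in auto)
  also have "\<dots> = (if l \<in> J' then f l else \<zero>\<^bsub>Hom \<C> A (F l)\<^esub>)"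
  proof (cases "l \<in> J'")
    case True
    then show ?thesis using H.finsum_singleton [of l J' "\<lambda>_. f l"] fin f by simp
  next
    case False
    then have "(\<Oplus>\<^bsub>Hom \<C> A (F l)\<^esub>j \<in> J'. if l = j then f l else \<zero>\<^bsub>Hom \<C> A (F l)\<^esub>)
        = (\<Oplus>\<^bsub>Hom \<C> A (F l)\<^esub>j \<in> J'. \<zero>\<^bsub>Hom \<C> A (F l)\<^esub>)"
      using assms D by (intro finsum_hom_cong) auto
    then show ?thesis using False by simp
  qed
  finally show ?thesis .
qed

lemma binary_sumI:
  assumes "A \<in> Obj \<C>" "B \<in> Obj \<C>" "Y \<in> Obj \<C>"
    and "i \<in> Mor \<C> A Y" "p \<in> Mor \<C> Y A" "j \<in> Mor \<C> B Y" "q \<in> Mor \<C> Y B"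
    and "Comp \<C> A Y A p i = Id \<C> A" "Comp \<C> B Y B q j = Id \<C> B"
    and "Comp \<C> A Y B q i = \<zero>\<^bsub>Hom \<C> A B\<^esub>" "Comp \<C> B Y A p j = \<zero>\<^bsub>Hom \<C> B A\<^esub>"
    and "Comp \<C> Y A Y i p \<oplus>\<^bsub>Hom \<C> Y Y\<^esub> Comp \<C> Y B Y j q = Id \<C> Y"
  shows "is_binary_sum \<C> A B Y"
proof -
  interpret H: abelian_group "Hom \<C> Y Y" by (rule hom_abelian_group [OF assms(3,3)])
  have "Comp \<C> Y A Y i p \<in> Mor \<C> Y Y" "Comp \<C> Y B Y j q \<in> Mor \<C> Y Y"
    using assms by (auto intro: comp_closed)
  then have "direct_sum \<C> UNIV (\<lambda>b. if b then A else B) Y (\<lambda>b. if b then i else j) (\<lambda>b. if b then p else q)"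
    using assms by (auto simp: direct_sum_def UNIV_bool H.a_comm)
  then show ?thesis unfolding is_binary_sum_def is_direct_sum_def by blast
qed

text \<open>Splitting off one summand with local endomorphism ring leaves a complement that must vanish.\<close>

lemma indecomposable_local:
  assumes indec: "indecomposable \<C> A" and ks: "krull_schmidt \<C>"
    and sums: "\<And>(n :: nat) F. (\<And>j. j < n \<Longrightarrow> F j \<in> Obj \<C>) \<Longrightarrow> \<exists>Y. is_direct_sum \<C> {..<n} F Y"
    and y: "y \<in> Mor \<C> A A" "y' \<in> Mor \<C> A A" "y \<oplus>\<^bsub>Hom \<C> A A\<^esub> y' = Id \<C> A"
  shows "(\<exists>z \<in> Mor \<C> A A. Comp \<C> A A A y z = Id \<C> A) \<or> (\<exists>z \<in> Mor \<C> A A. Comp \<C> A A A y' z = Id \<C> A)"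
proof -
  have A: "A \<in> Obj \<C>" "Id \<C> A \<noteq> \<zero>\<^bsub>Hom \<C> A A\<^esub>"
    using indec by (auto simp: indecomposable_def zero_object_def)
  obtain n F \<iota> \<pi> where ds: "direct_sum \<C> {..<n::nat} F A \<iota> \<pi>"
    and loc: "\<And>j. j < n \<Longrightarrow> nc_local_ring (End_ring \<C> (F j))"
    using ks A(1) unfolding krull_schmidt_def is_direct_sum_def by blast
  note D = direct_sumD [OF ds]
  \<comment> \<open>An empty sum would make A zero. The last summand is split off as
    \<open>B\<close>; \<open>Y\<close> is a direct sum of the others.\<close>
  have "n \<noteq> 0" using D(8) A(2) by (intro notI) (simp add: finsum_hom_empty [OF A(1,1)])
  then obtain m where n: "n = Suc m" using not0_implies_Suc by blast
  have F: "F j \<in> Obj \<C>" if "j \<le> m" for j using D(3) that n by simp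
  obtain Y \<iota>' \<pi>' where ds': "direct_sum \<C> {..<m} F Y \<iota>' \<pi>'"
    using sums [of m F] F unfolding is_direct_sum_def by auto
  note D' = direct_sumD [OF ds']
  define B where "B = F m"
  define i where "i = \<iota> m"
  define p where "p = \<pi> m"
  have B: "B \<in> Obj \<C>" "i \<in> Mor \<C> B A" "p \<in> Mor \<C> A B" "Comp \<C> B A B p i = Id \<C> B"
    using D(3-6) n by (auto simp: B_def i_def p_def)
  \<comment> \<open>\<open>s\<close> and \<open>r\<close> are the inclusion of and the projection to
    the partial sum \<open>Y\<close>, obtained by matching its structure maps with those of
    A.\<close>
  define s where "s = (\<Oplus>\<^bsub>Hom \<C> Y A\<^esub>j \<in> {..<m}. Comp \<C> Y (F j) A (\<iota> j) (\<pi>' j))"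
  define r where "r = (\<Oplus>\<^bsub>Hom \<C> A Y\<^esub>j \<in> {..<m}. Comp \<C> A (F j) Y (\<iota>' j) (\<pi> j))"
  have s: "s \<in> Mor \<C> Y A" unfolding s_def
    using D D' A n by (intro finsum_hom_closed comp_closed) auto
  have r: "r \<in> Mor \<C> A Y" unfolding r_def
    using D D' A n by (intro finsum_hom_closed comp_closed) auto
  have \<pi>s: "Comp \<C> Y A (F l) (\<pi> l) s = (if l < m then \<pi>' l else \<zero>\<^bsub>Hom \<C> Y (F l)\<^esub>)" if "l < n" for l
    unfolding s_def using proj_of_sum [OF ds, of "{..<m}" l Y \<pi>'] that n D' by auto
  have \<pi>'r: "Comp \<C> A Y (F l) (\<pi>' l) r = \<pi> l" if "l < m" for l
    unfolding r_def using proj_of_sum [OF ds', of "{..<m}" l A \<pi>] that n D A by auto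
  have rs: "Comp \<C> Y A Y r s = Id \<C> Y"
  proof -
    have "Comp \<C> Y A Y r s = (\<Oplus>\<^bsub>Hom \<C> Y Y\<^esub>j \<in> {..<m}. Comp \<C> Y A Y (Comp \<C> A (F j) Y (\<iota>' j) (\<pi> j)) s)"
      unfolding r_def using D D' A n s by (intro comp_finsum_left comp_closed) auto
    also have "\<dots> = (\<Oplus>\<^bsub>Hom \<C> Y Y\<^esub>j \<in> {..<m}. Comp \<C> Y (F j) Y (\<iota>' j) (\<pi>' j))"
    proof (rule finsum_hom_cong)
      fix j assume j: "j \<in> {..<m}"
      have "Comp \<C> Y A Y (Comp \<C> A (F j) Y (\<iota>' j) (\<pi> j)) s
          = Comp \<C> Y (F j) Y (\<iota>' j) (Comp \<C> Y A (F j) (\<pi> j) s)"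
        using D D' A n s j by (intro comp_assoc) auto
      then show "Comp \<C> Y A Y (Comp \<C> A (F j) Y (\<iota>' j) (\<pi> j)) s = Comp \<C> Y (F j) Y (\<iota>' j) (\<pi>' j)"
        using \<pi>s [of j] j n by simp
      show "Comp \<C> Y (F j) Y (\<iota>' j) (\<pi>' j) \<in> Mor \<C> Y Y"
        using D' j by (intro comp_closed) auto
    qed (use D' in auto)
    finally show ?thesis using D'(8) by simp
  qed
  have sr: "Comp \<C> A Y A s r = (\<Oplus>\<^bsub>Hom \<C> A A\<^esub>j \<in> {..<m}. Comp \<C> A (F j) A (\<iota> j) (\<pi> j))"
  proof -
    have "Comp \<C> A Y A s r = (\<Oplus>\<^bsub>Hom \<C> A A\<^esub>j \<in> {..<m}. Comp \<C> A Y A (Comp \<C> Y (F j) A (\<iota> j) (\<pi>' j)) r)"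
      unfolding s_def using D D' A n r by (intro comp_finsum_left comp_closed) auto
    also have "\<dots> = (\<Oplus>\<^bsub>Hom \<C> A A\<^esub>j \<in> {..<m}. Comp \<C> A (F j) A (\<iota> j) (\<pi> j))"
    proof (rule finsum_hom_cong)
      fix j assume j: "j \<in> {..<m}"
      have "Comp \<C> A Y A (Comp \<C> Y (F j) A (\<iota> j) (\<pi>' j)) r
          = Comp \<C> A (F j) A (\<iota> j) (Comp \<C> A Y (F j) (\<pi>' j) r)"
        using D D' A n r j by (intro comp_assoc) auto
      then show "Comp \<C> A Y A (Comp \<C> Y (F j) A (\<iota> j) (\<pi>' j)) r = Comp \<C> A (F j) A (\<iota> j) (\<pi> j)"
        using \<pi>'r [of j] j n by simp
      show "Comp \<C> A (F j) A (\<iota> j) (\<pi> j) \<in> Mor \<C> A A"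
        using D A j n by (intro comp_closed) auto
    qed (use A in auto)
    finally show ?thesis .
  qed
  have ri: "Comp \<C> B A Y r i = \<zero>\<^bsub>Hom \<C> B Y\<^esub>"
  proof -
    have "Comp \<C> B A Y r i = (\<Oplus>\<^bsub>Hom \<C> B Y\<^esub>j \<in> {..<m}. Comp \<C> B A Y (Comp \<C> A (F j) Y (\<iota>' j) (\<pi> j)) i)"
      unfolding r_def using D D' A n B by (intro comp_finsum_left comp_closed) auto
    also have "\<dots> = (\<Oplus>\<^bsub>Hom \<C> B Y\<^esub>j \<in> {..<m}. \<zero>\<^bsub>Hom \<C> B Y\<^esub>)"
    proof (rule finsum_hom_cong)
      fix j assume j: "j \<in> {..<m}"
      have "Comp \<C> B A Y (Comp \<C> A (F j) Y (\<iota>' j) (\<pi> j)) i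
          = Comp \<C> B (F j) Y (\<iota>' j) (Comp \<C> B A (F j) (\<pi> j) i)"
        using D D' A n B j by (intro comp_assoc) auto
      then show "Comp \<C> B A Y (Comp \<C> A (F j) Y (\<iota>' j) (\<pi> j)) i = \<zero>\<^bsub>Hom \<C> B Y\<^esub>"
        using D(7) [of m j] j n D' B by (simp add: B_def i_def comp_zero_right)
    qed (use D' B in \<open>auto intro: hom_zero_closed\<close>)
    also have "\<dots> = \<zero>\<^bsub>Hom \<C> B Y\<^esub>"
      by (rule abelian_monoid.finsum_zero [OF abelian_group.axioms(1) [OF hom_abelian_group [OF B(1) D'(2)]]])
    finally show ?thesis .
  qed
  have ps: "Comp \<C> Y A B p s = \<zero>\<^bsub>Hom \<C> Y B\<^esub>" using \<pi>s [of m] n by (simp add: p_def B_def)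
  have split: "Comp \<C> A B A i p \<oplus>\<^bsub>Hom \<C> A A\<^esub> Comp \<C> A Y A s r = Id \<C> A"
  proof -
    have "(\<Oplus>\<^bsub>Hom \<C> A A\<^esub>j \<in> insert m {..<m}. Comp \<C> A (F j) A (\<iota> j) (\<pi> j))
        = Comp \<C> A (F m) A (\<iota> m) (\<pi> m) \<oplus>\<^bsub>Hom \<C> A A\<^esub> (\<Oplus>\<^bsub>Hom \<C> A A\<^esub>j \<in> {..<m}. Comp \<C> A (F j) A (\<iota> j) (\<pi> j))"
      using D A n by (intro finsum_hom_insert comp_closed) auto
    then show ?thesis using D(8) n by (simp add: sr B_def i_def p_def lessThan_Suc)
  qed
  have "is_binary_sum \<C> B Y A"
    by (rule binary_sumI [OF B(1) D'(2) A(1) B(2,3) s r B(4) rs ri ps split])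
  \<comment> \<open>Of the two summands B and Y of A, B is not zero because a local ring has 1
    different from 0. So Y vanishes, and \<open>i\<close> and \<open>p\<close> are inverse
    isomorphisms between B and A.\<close>
  then have "zero_object \<C> B \<or> zero_object \<C> Y"
    using indec unfolding indecomposable_def by blast
  moreover have locB: "nc_local_ring (End_ring \<C> B)" using loc n by (simp add: B_def)
  then have "\<not> zero_object \<C> B"
    by (simp add: nc_local_ring_def zero_object_def End_ring_def)
  ultimately have "Id \<C> Y = \<zero>\<^bsub>Hom \<C> Y Y\<^esub>" using B(1) by (auto simp: zero_object_def)
  then have "s = \<zero>\<^bsub>Hom \<C> Y A\<^esub>"
    using comp_id_right [OF D'(2) A(1) s] comp_zero_right [OF D'(2) D'(2) A(1) s] by simp
  then have ip: "Comp \<C> A B A i p = Id \<C> A"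
    using split comp_zero_left [OF A(1) D'(2) A(1) r] hom_add_zero [OF A(1,1)] comp_closed [OF A(1) B(1) A(1) B(3,2)]
    by simp
  \<comment> \<open>Conjugation with this isomorphism moves the equation y + y' = 1 to the local
    ring of endomorphisms of B.\<close>
  define u where "u x = Comp \<C> B A B p (Comp \<C> B A A x i)" for x
  have u: "u x \<in> Mor \<C> B B" if "x \<in> Mor \<C> A A" for x
    unfolding u_def using that A B by (intro comp_closed) auto
  have "u y \<oplus>\<^bsub>Hom \<C> B B\<^esub> u y' = u (Id \<C> A)"
    unfolding u_def y(3) [symmetric] using y(1,2) A B by (simp add: comp_add_left comp_add_right comp_closed)
  also have "\<dots> = Id \<C> B" unfolding u_def using A B by (simp add: comp_id_left)
  finally have sum: "u y \<oplus>\<^bsub>End_ring \<C> B\<^esub> u y' = \<one>\<^bsub>End_ring \<C> B\<^esub>" by (simp add: End_ring_def)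
  have "\<one>\<^bsub>End_ring \<C> B\<^esub> \<in> Units (End_ring \<C> B)"
    using locB unfolding nc_local_ring_def by (intro monoid.Units_one_closed ring.is_monoid) simp
  moreover have "u y \<in> carrier (End_ring \<C> B)" "u y' \<in> carrier (End_ring \<C> B)"
    using u y(1,2) by (simp_all add: End_ring_def)
  ultimately have "u y \<in> Units (End_ring \<C> B) \<or> u y' \<in> Units (End_ring \<C> B)"
    using locB sum unfolding nc_local_ring_def by (metis DiffI)
  moreover have "\<exists>z \<in> Mor \<C> A A. Comp \<C> A A A x z = Id \<C> A"
    if x: "x \<in> Mor \<C> A A" and unit: "u x \<in> Units (End_ring \<C> B)" for x
  proof -
    obtain v where v: "v \<in> Mor \<C> B B" "Comp \<C> B B B (u x) v = Id \<C> B"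
      using unit by (auto simp: Units_def End_ring_def)
    define z where "z = Comp \<C> A B A i (Comp \<C> A B B v p)"
    have vp: "Comp \<C> A B B v p \<in> Mor \<C> A B" using v A B by (auto intro: comp_closed)
    then have z: "z \<in> Mor \<C> A A" unfolding z_def by (rule comp_closed [OF A(1) B(1) A(1) _ B(2)])
    have xi: "Comp \<C> B A A x i \<in> Mor \<C> B A" using x A B by (auto intro: comp_closed)
    have xz: "Comp \<C> A A A x z = Comp \<C> A B A (Comp \<C> B A A x i) (Comp \<C> A B B v p)"
      unfolding z_def using x A B vp by (intro comp_assoc [symmetric])
    also have "\<dots> = Comp \<C> A B A (Comp \<C> B A A (Id \<C> A) (Comp \<C> B A A x i)) (Comp \<C> A B B v p)"
      using A B xi by (simp add: comp_id_left)
    also have "Comp \<C> B A A (Id \<C> A) (Comp \<C> B A A x i) = Comp \<C> B B A i (u x)"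
      unfolding ip [symmetric] u_def using A B xi by (intro comp_assoc)
    also have "Comp \<C> A B A (Comp \<C> B B A i (u x)) (Comp \<C> A B B v p)
        = Comp \<C> A B A i (Comp \<C> A B B (u x) (Comp \<C> A B B v p))"
      using A B u [OF x] vp by (intro comp_assoc)
    also have "Comp \<C> A B B (u x) (Comp \<C> A B B v p) = Comp \<C> A B B (Comp \<C> B B B (u x) v) p"
      using A B u [OF x] v by (intro comp_assoc [symmetric])
    also have "\<dots> = p" using v A B by (simp add: comp_id_left)
    finally show ?thesis using z ip by (intro bexI [of _ z]) auto
  qed
  ultimately show ?thesis using y by blast
qed

text \<open>For e = i p with p i = 1, the corner e End(X) e is isomorphic to End(A) through x |-> p
  x i, so the hypothesis on End(A) passes to the corner.\<close>

lemma corner_local_of_summand: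
  assumes A: "A \<in> Obj \<C>" and X: "X \<in> Obj \<C>" and nz: "\<not> zero_object \<C> A"
    and i: "i \<in> Mor \<C> A X" and p: "p \<in> Mor \<C> X A" and pi: "Comp \<C> A X A p i = Id \<C> A"
    and loc: "\<And>y y'. \<lbrakk>y \<in> Mor \<C> A A; y' \<in> Mor \<C> A A; y \<oplus>\<^bsub>Hom \<C> A A\<^esub> y' = Id \<C> A\<rbrakk> \<Longrightarrow>
      (\<exists>z \<in> Mor \<C> A A. Comp \<C> A A A y z = Id \<C> A) \<or> (\<exists>z \<in> Mor \<C> A A. Comp \<C> A A A y' z = Id \<C> A)"
  shows "corner_local (End_ring \<C> X) (Comp \<C> X A X i p)"
proof -
  define e where "e = Comp \<C> X A X i p"
  have e: "e \<in> Mor \<C> X X" unfolding e_def using A X i p by (intro comp_closed)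
  have ei: "Comp \<C> A X X e i = i"
    unfolding e_def using comp_assoc [OF A X A X i p i] pi A X i by (simp add: comp_id_right)
  have pe: "Comp \<C> X X A p e = p"
    unfolding e_def using comp_assoc [OF X A X A p i p] pi A X p by (simp add: comp_id_left)
  have ee: "Comp \<C> X X X e e = e"
    using comp_assoc [OF X A X X p i e] ei A X i p e by (simp add: e_def)
  have nz': "e \<noteq> \<zero>\<^bsub>Hom \<C> X X\<^esub>"
  proof
    assume "e = \<zero>\<^bsub>Hom \<C> X X\<^esub>"
    then have "i = \<zero>\<^bsub>Hom \<C> A X\<^esub>" using ei comp_zero_left [OF A X X i] by simp
    then have "Id \<C> A = \<zero>\<^bsub>Hom \<C> A A\<^esub>" using pi comp_zero_right [OF A X A p] by simp
    with nz A show False by (simp add: zero_object_def)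
  qed
  define u where "u x = Comp \<C> A X A p (Comp \<C> A X X x i)" for x
  have u: "u x \<in> Mor \<C> A A" if "x \<in> Mor \<C> X X" for x
    unfolding u_def using that A X i p by (intro comp_closed) auto
  have inverse: "\<exists>z \<in> Mor \<C> X X. Comp \<C> X X X x z = e"
    if x: "x \<in> Mor \<C> X X" "Comp \<C> X X X (Comp \<C> X X X e x) e = x"
      and "z \<in> Mor \<C> A A" "Comp \<C> A A A (u x) z = Id \<C> A" for x z
  proof -
    \<comment> \<open>The right inverse \<open>z\<close> in End(A), carried back to the corner of
      X.\<close>
    define w where "w = Comp \<C> X A X i (Comp \<C> X A A z p)"
    have zp: "Comp \<C> X A A z p \<in> Mor \<C> X A" using that(3) A X p by (auto intro: comp_closed)
    have w: "w \<in> Mor \<C> X X" unfolding w_def by (rule comp_closed [OF X A X zp i])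
    have xi: "Comp \<C> A X X x i \<in> Mor \<C> A X" using x A X i by (auto intro: comp_closed)
    have ex: "Comp \<C> X X X e x = x"
      using x e comp_assoc [OF X X X X] comp_closed [OF X X X] ee by metis
    have "Comp \<C> X X X x w = Comp \<C> X A X (Comp \<C> A X X x i) (Comp \<C> X A A z p)"
      unfolding w_def using x A X i zp by (intro comp_assoc [symmetric])
    \<comment> \<open>From x = e x and e = i p one gets x i = i u(x); so x w = i u(x) z p = i p =
      e.\<close>
    also have "Comp \<C> A X X x i = Comp \<C> A X X e (Comp \<C> A X X x i)"
      using comp_assoc [OF A X X X i x(1) e] ex by simp
    also have "\<dots> = Comp \<C> A A X i (u x)"
      unfolding e_def u_def using A X i p xi by (intro comp_assoc)
    also have "Comp \<C> X A X (Comp \<C> A A X i (u x)) (Comp \<C> X A A z p)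
        = Comp \<C> X A X i (Comp \<C> X A A (u x) (Comp \<C> X A A z p))"
      using A X i zp u [OF x(1)] by (intro comp_assoc)
    also have "Comp \<C> X A A (u x) (Comp \<C> X A A z p) = Comp \<C> X A A (Comp \<C> A A A (u x) z) p"
      using A X p that(3) u [OF x(1)] by (intro comp_assoc [symmetric])
    also have "\<dots> = p" using that(4) A X p by (simp add: comp_id_left)
    finally show ?thesis using w by (auto simp: e_def)
  qed
  have "(\<exists>z \<in> Mor \<C> X X. Comp \<C> X X X y z = e) \<or> (\<exists>z \<in> Mor \<C> X X. Comp \<C> X X X y' z = e)"
    if y: "y \<in> Mor \<C> X X" "y' \<in> Mor \<C> X X" "Comp \<C> X X X (Comp \<C> X X X e y) e = y"
      "Comp \<C> X X X (Comp \<C> X X X e y') e = y'" "y \<oplus>\<^bsub>Hom \<C> X X\<^esub> y' = e" for y y'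
  proof -
    have "u y \<oplus>\<^bsub>Hom \<C> A A\<^esub> u y' = u e"
      unfolding u_def y(5) [symmetric] using y(1,2) A X i p
      by (simp add: comp_add_left comp_add_right comp_closed)
    also have "\<dots> = Id \<C> A" unfolding u_def ei by (rule pi)
    finally show ?thesis using loc [OF u u] y inverse by blast
  qed
  then show ?thesis
    unfolding corner_local_def e_def [symmetric] using e ee nz' by (simp add: End_ring_def)
qed

end


subsection \<open>The stable category\<close>

lemma right_module_imp_module:
  fixes M :: "('r, 'm) module"
  assumes "cring R" "right_module R M"
  shows "module R M"
proof -
  interpret R: cring R by fact
  interpret M: right_module R M by fact
  show ?thesis
    by (intro moduleI assms M.M.abelian_group_axioms)
      (auto simp: M.smult_closed M.smult_add_scalar M.smult_add_vector M.smult_one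
        M.smult_mult [symmetric] R.m_comm)
qed

section \<open>Projective objects and the maps that factor through them\<close>

context exact_category
begin

lemma deflationD: "deflation \<K> B C p \<Longrightarrow> B \<in> Obj \<C> \<and> C \<in> Obj \<C> \<and> p \<in> Mor \<C> B C"
  using conflation_kc by (auto simp: deflation_def kernel_cokernel_pair_def)

text \<open>Lift each restriction of f to a summand, and add up the lifts composed with the
  projections.\<close>

lemma proj_object_direct_sum:
  assumes ds: "direct_sum \<C> J F Y \<iota> \<pi>" and proj: "\<And>j. j \<in> J \<Longrightarrow> proj_object \<C> \<K> (F j)"
  shows "proj_object \<C> \<K> Y"
  unfolding proj_object_def
proof (intro conjI allI impI)
  note D = direct_sumD [OF ds]
  show "Y \<in> Obj \<C>" by (rule D(2))
  fix B C p f assume p: "deflation \<K> B C p" and f: "f \<in> Mor \<C> Y C"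
  have B: "B \<in> Obj \<C>" "C \<in> Obj \<C>" "p \<in> Mor \<C> B C" using deflationD [OF p] by auto
  have "\<exists>g. g \<in> Mor \<C> (F j) B \<and> Comp \<C> (F j) B C p g = Comp \<C> (F j) Y C f (\<iota> j)" if j: "j \<in> J" for j
  proof -
    have "Comp \<C> (F j) Y C f (\<iota> j) \<in> Mor \<C> (F j) C"
      by (rule comp_closed [OF D(3) [OF j] D(2) B(2) D(4) [OF j] f])
    then show ?thesis using proj [OF j] p unfolding proj_object_def by blast
  qed
  then have "\<forall>j \<in> J. \<exists>g. g \<in> Mor \<C> (F j) B \<and> Comp \<C> (F j) B C p g = Comp \<C> (F j) Y C f (\<iota> j)"
    by blast
  from bchoice [OF this] obtain g where g:
    "\<And>j. j \<in> J \<Longrightarrow> g j \<in> Mor \<C> (F j) B" "\<And>j. j \<in> J \<Longrightarrow> Comp \<C> (F j) B C p (g j) = Comp \<C> (F j) Y C f (\<iota> j)"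
    by blast
  have g\<pi>: "Comp \<C> Y (F j) B (g j) (\<pi> j) \<in> Mor \<C> Y B" if "j \<in> J" for j
    by (rule comp_closed [OF D(2) D(3) [OF that] B(1) D(5) [OF that] g(1) [OF that]])
  have \<iota>\<pi>: "Comp \<C> Y (F j) Y (\<iota> j) (\<pi> j) \<in> Mor \<C> Y Y" if "j \<in> J" for j
    by (rule comp_closed [OF D(2) D(3) [OF that] D(2) D(5) [OF that] D(4) [OF that]])
  let ?g = "\<Oplus>\<^bsub>Hom \<C> Y B\<^esub>j \<in> J. Comp \<C> Y (F j) B (g j) (\<pi> j)"
  have "?g \<in> Mor \<C> Y B" by (rule finsum_hom_closed [OF D(2) B(1) g\<pi>])
  moreover have "Comp \<C> Y B C p ?g = f"
  proof -
    have "Comp \<C> Y B C p ?g = (\<Oplus>\<^bsub>Hom \<C> Y C\<^esub>j \<in> J. Comp \<C> Y B C p (Comp \<C> Y (F j) B (g j) (\<pi> j)))"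
      by (rule comp_finsum_right [OF D(2) B(1,2,3) D(1) g\<pi>])
    also have "\<dots> = (\<Oplus>\<^bsub>Hom \<C> Y C\<^esub>j \<in> J. Comp \<C> Y Y C f (Comp \<C> Y (F j) Y (\<iota> j) (\<pi> j)))"
    proof (rule finsum_hom_cong [OF D(2) B(2)])
      fix j assume j: "j \<in> J"
      show "Comp \<C> Y Y C f (Comp \<C> Y (F j) Y (\<iota> j) (\<pi> j)) \<in> Mor \<C> Y C"
        by (rule comp_closed [OF D(2) D(2) B(2) \<iota>\<pi> [OF j] f])
      have "Comp \<C> Y B C p (Comp \<C> Y (F j) B (g j) (\<pi> j)) = Comp \<C> Y (F j) C (Comp \<C> (F j) B C p (g j)) (\<pi> j)"
        by (rule comp_assoc [OF D(2) D(3) [OF j] B(1,2) D(5) [OF j] g(1) [OF j] B(3), symmetric])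
      also have "\<dots> = Comp \<C> Y Y C f (Comp \<C> Y (F j) Y (\<iota> j) (\<pi> j))"
        unfolding g(2) [OF j]
        by (rule comp_assoc [OF D(2) D(3) [OF j] D(2) B(2) D(5) [OF j] D(4) [OF j] f])
      finally show "Comp \<C> Y B C p (Comp \<C> Y (F j) B (g j) (\<pi> j))
          = Comp \<C> Y Y C f (Comp \<C> Y (F j) Y (\<iota> j) (\<pi> j))" .
    qed
    also have "\<dots> = Comp \<C> Y Y C f (\<Oplus>\<^bsub>Hom \<C> Y Y\<^esub>j \<in> J. Comp \<C> Y (F j) Y (\<iota> j) (\<pi> j))"
      by (rule comp_finsum_right [OF D(2) D(2) B(2) f D(1) \<iota>\<pi>, symmetric])
    also have "\<dots> = f" unfolding D(8) by (rule comp_id_right [OF D(2) B(2) f])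
    finally show ?thesis .
  qed
  ultimately show "\<exists>g \<in> Mor \<C> Y B. Comp \<C> Y B C p g = f" by blast
qed

text \<open>The empty direct sum. Its projectivity is what puts the zero map into the ideal of maps
  factoring through projectives.\<close>

lemma exists_zero_object: "\<exists>Z. zero_object \<C> Z \<and> proj_object \<C> \<K> Z"
proof -
  obtain Z \<iota> \<pi> where ds: "direct_sum \<C> {..<0::nat} (\<lambda>_. undefined) Z \<iota> \<pi>"
    using finite_direct_sums [of 0 "\<lambda>_. undefined"] unfolding is_direct_sum_def by auto
  note D = direct_sumD [OF ds]
  have "zero_object \<C> Z"
    using D(2,8) by (simp add: zero_object_def finsum_hom_empty)
  moreover have "proj_object \<C> \<K> Z" by (rule proj_object_direct_sum [OF ds]) simp
  ultimately show ?thesis by blast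
qed

lemma proj_idealI:
  "\<lbrakk>proj_object \<C> \<K> Q; f \<in> Mor \<C> A Q; g \<in> Mor \<C> Q B\<rbrakk> \<Longrightarrow> Comp \<C> A Q B g f \<in> proj_ideal \<C> \<K> A B"
  by (auto simp: proj_ideal_def)

lemma proj_idealE:
  assumes "h \<in> proj_ideal \<C> \<K> A B"
  obtains Q f g where "proj_object \<C> \<K> Q" "Q \<in> Obj \<C>" "f \<in> Mor \<C> A Q" "g \<in> Mor \<C> Q B"
    "h = Comp \<C> A Q B g f"
  using assms by (auto simp: proj_ideal_def proj_object_def)

lemma proj_ideal_subset: "\<lbrakk>A \<in> Obj \<C>; B \<in> Obj \<C>\<rbrakk> \<Longrightarrow> proj_ideal \<C> \<K> A B \<subseteq> Mor \<C> A B"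
  by (auto elim!: proj_idealE intro: comp_closed)

lemma proj_ideal_comp_left:
  assumes "A \<in> Obj \<C>" "B \<in> Obj \<C>" "C \<in> Obj \<C>" "h \<in> proj_ideal \<C> \<K> A B" "k \<in> Mor \<C> B C"
  shows "Comp \<C> A B C k h \<in> proj_ideal \<C> \<K> A C"
  using assms(4)
proof (rule proj_idealE)
  fix Q f g assume Q: "proj_object \<C> \<K> Q" "Q \<in> Obj \<C>" "f \<in> Mor \<C> A Q" "g \<in> Mor \<C> Q B"
    and h: "h = Comp \<C> A Q B g f"
  have "Comp \<C> A B C k h = Comp \<C> A Q C (Comp \<C> Q B C k g) f"
    unfolding h by (rule comp_assoc [OF assms(1) Q(2) assms(2,3) Q(3,4) assms(5), symmetric])
  then show ?thesis
    using proj_idealI [OF Q(1,3) comp_closed [OF Q(2) assms(2,3) Q(4) assms(5)]] by simp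
qed

lemma proj_ideal_comp_right:
  assumes "A \<in> Obj \<C>" "B \<in> Obj \<C>" "C \<in> Obj \<C>" "h \<in> proj_ideal \<C> \<K> B C" "k \<in> Mor \<C> A B"
  shows "Comp \<C> A B C h k \<in> proj_ideal \<C> \<K> A C"
  using assms(4)
proof (rule proj_idealE)
  fix Q f g assume Q: "proj_object \<C> \<K> Q" "Q \<in> Obj \<C>" "f \<in> Mor \<C> B Q" "g \<in> Mor \<C> Q C"
    and h: "h = Comp \<C> B Q C g f"
  have "Comp \<C> A B C h k = Comp \<C> A Q C g (Comp \<C> A B Q f k)"
    unfolding h by (rule comp_assoc [OF assms(1,2) Q(2) assms(3,5) Q(3,4)])
  then show ?thesis
    using proj_idealI [OF Q(1) comp_closed [OF assms(1,2) Q(2) assms(5) Q(3)] Q(4)] by simp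
qed

text \<open>If h factors through Q and h' through Q', then h + h' factors through a direct sum of Q
  and Q', which is again projective.\<close>

lemma proj_ideal_add:
  assumes AB: "A \<in> Obj \<C>" "B \<in> Obj \<C>" and h: "h \<in> proj_ideal \<C> \<K> A B" "h' \<in> proj_ideal \<C> \<K> A B"
  shows "h \<oplus>\<^bsub>Hom \<C> A B\<^esub> h' \<in> proj_ideal \<C> \<K> A B"
proof -
  obtain Q f g where Q: "proj_object \<C> \<K> Q" "Q \<in> Obj \<C>" "f \<in> Mor \<C> A Q" "g \<in> Mor \<C> Q B"
    "h = Comp \<C> A Q B g f" using h(1) by (rule proj_idealE)
  obtain Q' f' g' where Q': "proj_object \<C> \<K> Q'" "Q' \<in> Obj \<C>" "f' \<in> Mor \<C> A Q'" "g' \<in> Mor \<C> Q' B"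
    "h' = Comp \<C> A Q' B g' f'" using h(2) by (rule proj_idealE)
  define F where "F j = (if j = (0::nat) then Q else Q')" for j
  have F: "F j \<in> Obj \<C>" "proj_object \<C> \<K> (F j)" for j using Q Q' by (simp_all add: F_def)
  obtain Y \<iota> \<pi> where ds: "direct_sum \<C> {..<2} F Y \<iota> \<pi>"
    using finite_direct_sums [of 2 F] F unfolding is_direct_sum_def by blast
  note D = direct_sumD [OF ds]
  have Y: "proj_object \<C> \<K> Y" by (rule proj_object_direct_sum [OF ds F(2)])
  define \<phi> where "\<phi> j = (if j = (0::nat) then f else f')" for j
  define \<gamma> where "\<gamma> j = (if j = (0::nat) then g else g')" for j
  have \<phi>: "\<phi> j \<in> Mor \<C> A (F j)" and \<gamma>: "\<gamma> j \<in> Mor \<C> (F j) B" for j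
    using Q Q' by (simp_all add: F_def \<phi>_def \<gamma>_def)
  define u where "u = (\<Oplus>\<^bsub>Hom \<C> A Y\<^esub>j \<in> {..<2}. Comp \<C> A (F j) Y (\<iota> j) (\<phi> j))"
  define v where "v = (\<Oplus>\<^bsub>Hom \<C> Y B\<^esub>j \<in> {..<2}. Comp \<C> Y (F j) B (\<gamma> j) (\<pi> j))"
  have \<gamma>\<pi>: "Comp \<C> Y (F j) B (\<gamma> j) (\<pi> j) \<in> Mor \<C> Y B" if "j \<in> {..<2}" for j
    by (rule comp_closed [OF D(2) F(1) AB(2) D(5) [OF that] \<gamma>])
  have u: "u \<in> Mor \<C> A Y" unfolding u_def
    by (rule finsum_hom_closed [OF AB(1) D(2) comp_closed [OF AB(1) F(1) D(2) \<phi> D(4)]])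
  have v: "v \<in> Mor \<C> Y B" unfolding v_def by (rule finsum_hom_closed [OF D(2) AB(2) \<gamma>\<pi>])
  have closed: "Comp \<C> A (F j) B (\<gamma> j) (\<phi> j) \<in> Mor \<C> A B" for j
    by (rule comp_closed [OF AB(1) F(1) AB(2) \<phi> \<gamma>])
  have "Comp \<C> A Y B v u = (\<Oplus>\<^bsub>Hom \<C> A B\<^esub>j \<in> {..<2}. Comp \<C> A Y B (Comp \<C> Y (F j) B (\<gamma> j) (\<pi> j)) u)"
    unfolding v_def by (rule comp_finsum_left [OF AB(1) D(2) AB(2) u D(1) \<gamma>\<pi>])
  also have "\<dots> = (\<Oplus>\<^bsub>Hom \<C> A B\<^esub>j \<in> {..<2}. Comp \<C> A (F j) B (\<gamma> j) (\<phi> j))"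
  proof (rule finsum_hom_cong [OF AB closed])
    fix j :: nat assume j: "j \<in> {..<2}"
    have "Comp \<C> A Y (F j) (\<pi> j) u = \<phi> j"
      unfolding u_def using proj_of_sum [OF ds order_refl j AB(1) \<phi>] j by simp
    then show "Comp \<C> A Y B (Comp \<C> Y (F j) B (\<gamma> j) (\<pi> j)) u = Comp \<C> A (F j) B (\<gamma> j) (\<phi> j)"
      using comp_assoc [OF AB(1) D(2) F(1) AB(2) u D(5) [OF j] \<gamma>] by simp
  qed
  also have "{..<2} = {0, 1::nat}" by auto
  also have "(\<Oplus>\<^bsub>Hom \<C> A B\<^esub>j \<in> {0, 1}. Comp \<C> A (F j) B (\<gamma> j) (\<phi> j))
      = Comp \<C> A (F 0) B (\<gamma> 0) (\<phi> 0) \<oplus>\<^bsub>Hom \<C> A B\<^esub> (\<Oplus>\<^bsub>Hom \<C> A B\<^esub>j \<in> {1}. Comp \<C> A (F j) B (\<gamma> j) (\<phi> j))"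
    by (rule finsum_hom_insert [OF AB _ _ closed]) auto
  also have "(\<Oplus>\<^bsub>Hom \<C> A B\<^esub>j \<in> {1}. Comp \<C> A (F j) B (\<gamma> j) (\<phi> j)) = Comp \<C> A (F 1) B (\<gamma> 1) (\<phi> 1)"
    using finsum_hom_insert [OF AB finite.emptyI, of 1 "\<lambda>j. Comp \<C> A (F j) B (\<gamma> j) (\<phi> j)"] closed
    by (simp add: finsum_hom_empty [OF AB] hom_add_zero [OF AB])
  also have "Comp \<C> A (F 0) B (\<gamma> 0) (\<phi> 0) \<oplus>\<^bsub>Hom \<C> A B\<^esub> Comp \<C> A (F 1) B (\<gamma> 1) (\<phi> 1) = h \<oplus>\<^bsub>Hom \<C> A B\<^esub> h'"
    using Q Q' by (simp add: F_def \<gamma>_def \<phi>_def)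
  finally show ?thesis using proj_idealI [OF Y u v] by simp
qed

lemma proj_ideal_submodule:
  assumes AB: "A \<in> Obj \<C>" "B \<in> Obj \<C>"
  shows "submodule (proj_ideal \<C> \<K> A B) R (Hom \<C> A B)"
proof (rule right_module.submodule_criterion [OF module_imp_right_module [OF hom_module [OF AB]]])
  show "proj_ideal \<C> \<K> A B \<subseteq> Mor \<C> A B" by (rule proj_ideal_subset [OF AB])
  show "\<zero>\<^bsub>Hom \<C> A B\<^esub> \<in> proj_ideal \<C> \<K> A B"
  proof -
    obtain Z where Z: "zero_object \<C> Z" "proj_object \<C> \<K> Z" using exists_zero_object by blast
    then have ZO: "Z \<in> Obj \<C>" by (simp add: zero_object_def)
    have "Comp \<C> A Z B \<zero>\<^bsub>Hom \<C> Z B\<^esub> \<zero>\<^bsub>Hom \<C> A Z\<^esub> = \<zero>\<^bsub>Hom \<C> A B\<^esub>"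
      by (rule comp_zero_left [OF AB(1) ZO AB(2) hom_zero_closed [OF AB(1) ZO]])
    then show ?thesis
      using proj_idealI [OF Z(2) hom_zero_closed [OF AB(1) ZO] hom_zero_closed [OF ZO AB(2)]] by simp
  qed
  show "x \<oplus>\<^bsub>Hom \<C> A B\<^esub> y \<in> proj_ideal \<C> \<K> A B"
    if "x \<in> proj_ideal \<C> \<K> A B" "y \<in> proj_ideal \<C> \<K> A B" for x y
    using that by (rule proj_ideal_add [OF AB])
  show "r \<odot>\<^bsub>Hom \<C> A B\<^esub> x \<in> proj_ideal \<C> \<K> A B" if r: "r \<in> carrier R" and "x \<in> proj_ideal \<C> \<K> A B" for r x
    using that(2)
  proof (rule proj_idealE)
    fix Q f g assume Q: "proj_object \<C> \<K> Q" "Q \<in> Obj \<C>" "f \<in> Mor \<C> A Q" "g \<in> Mor \<C> Q B"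
      and x: "x = Comp \<C> A Q B g f"
    have "r \<odot>\<^bsub>Hom \<C> A B\<^esub> x = Comp \<C> A Q B (r \<odot>\<^bsub>Hom \<C> Q B\<^esub> g) f"
      unfolding x by (rule comp_smult_left [OF AB(1) Q(2) AB(2) r Q(3,4), symmetric])
    then show ?thesis
      using proj_idealI [OF Q(1,3) module.smult_closed [OF hom_module [OF Q(2) AB(2)] r Q(4)]] by simp
  qed
qed

section \<open>Stable classes of morphisms\<close>

abbreviation \<D> where "\<D> \<equiv> stable_category \<C> \<K>"

definition cls :: "'o \<Rightarrow> 'o \<Rightarrow> 'm \<Rightarrow> 'm set" where
  "cls A B f = proj_ideal \<C> \<K> A B +>\<^bsub>Hom \<C> A B\<^esub> f"

lemma stable_simps:
  "Obj \<D> = Obj \<C>" "Hom \<D> A B = quot_mod (Hom \<C> A B) (proj_ideal \<C> \<K> A B)"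
  "Id \<D> A = cls A A (Id \<C> A)"
  by (simp_all add: stable_category_def cls_def)

context
  fixes A B assumes AB: "A \<in> Obj \<C>" "B \<in> Obj \<C>"
begin

interpretation H: right_module R "Hom \<C> A B"
  by (rule module_imp_right_module [OF hom_module [OF AB]])

lemma stable_MorE:
  assumes "F \<in> Mor \<D> A B"
  obtains f where "f \<in> Mor \<C> A B" "F = cls A B f"
  using assms unfolding stable_simps cls_def by (rule H.quot_mod_carrierE)

lemma cls_closed: "f \<in> Mor \<C> A B \<Longrightarrow> cls A B f \<in> Mor \<D> A B"
  unfolding stable_simps cls_def by (rule H.quot_mod_carrierI)

lemma cls_add:
  "\<lbrakk>f \<in> Mor \<C> A B; g \<in> Mor \<C> A B\<rbrakk>
    \<Longrightarrow> cls A B f \<oplus>\<^bsub>Hom \<D> A B\<^esub> cls A B g = cls A B (f \<oplus>\<^bsub>Hom \<C> A B\<^esub> g)"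
  unfolding stable_simps cls_def by (rule H.quot_mod_add [OF proj_ideal_submodule [OF AB]])

lemma cls_smult:
  "\<lbrakk>r \<in> carrier R; f \<in> Mor \<C> A B\<rbrakk>
    \<Longrightarrow> r \<odot>\<^bsub>Hom \<D> A B\<^esub> cls A B f = cls A B (r \<odot>\<^bsub>Hom \<C> A B\<^esub> f)"
  unfolding stable_simps cls_def by (rule H.quot_mod_smult [OF proj_ideal_submodule [OF AB]])

lemma cls_zero: "\<zero>\<^bsub>Hom \<D> A B\<^esub> = cls A B \<zero>\<^bsub>Hom \<C> A B\<^esub>"
  using H.quot_mod_eq_zero [OF proj_ideal_submodule [OF AB], of "\<zero>\<^bsub>Hom \<C> A B\<^esub>"]
    H.submoduleD(2) [OF proj_ideal_submodule [OF AB]]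
  by (simp add: stable_simps cls_def)

lemma mem_cls_iff:
  assumes "f \<in> Mor \<C> A B"
  shows "g \<in> cls A B f \<longleftrightarrow> (\<exists>u \<in> proj_ideal \<C> \<K> A B. g = u \<oplus>\<^bsub>Hom \<C> A B\<^esub> f)"
  by (auto simp: cls_def a_r_coset_def')

lemma cls_cong:
  assumes "f \<in> Mor \<C> A B" "u \<in> proj_ideal \<C> \<K> A B"
  shows "cls A B (u \<oplus>\<^bsub>Hom \<C> A B\<^esub> f) = cls A B f"
proof -
  interpret N: abelian_subgroup "proj_ideal \<C> \<K> A B" "Hom \<C> A B"
    by (rule H.abelian_subgroup_of_submodule [OF proj_ideal_submodule [OF AB]])
  have "u \<oplus>\<^bsub>Hom \<C> A B\<^esub> f \<in> proj_ideal \<C> \<K> A B +>\<^bsub>Hom \<C> A B\<^esub> f"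
    using assms(2) by (auto simp: a_r_coset_def')
  then show ?thesis
    unfolding cls_def using N.a_repr_independence' [OF _ assms(1)] by simp
qed

lemma cls_self: "f \<in> Mor \<C> A B \<Longrightarrow> f \<in> cls A B f"
  using abelian_subgroup.a_rcos_self
    [OF H.abelian_subgroup_of_submodule [OF proj_ideal_submodule [OF AB]]]
  by (simp add: cls_def)

lemma stable_hom_module: "module R (Hom \<D> A B)"
  unfolding stable_simps
  by (intro right_module_imp_module H.quot_mod_right_module proj_ideal_submodule AB
      module.axioms(1) [OF hom_module [OF AB]])

end

text \<open>Stable composition is a union over all pairs of representatives. It collapses to one
  class because changing a representative by an element of the ideal changes the composite by an
  element of the ideal.\<close>

lemma cls_comp:
  assumes ABC: "A \<in> Obj \<C>" "B \<in> Obj \<C>" "C \<in> Obj \<C>" and f: "f \<in> Mor \<C> A B" and g: "g \<in> Mor \<C> B C"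
  shows "Comp \<D> A B C (cls B C g) (cls A B f) = cls A C (Comp \<C> A B C g f)"
proof -
  have *: "cls A C (Comp \<C> A B C g' f') = cls A C (Comp \<C> A B C g f)"
    if g': "g' \<in> cls B C g" and f': "f' \<in> cls A B f" for f' g'
  proof -
    obtain u where u: "u \<in> proj_ideal \<C> \<K> B C" "g' = u \<oplus>\<^bsub>Hom \<C> B C\<^esub> g"
      using g' mem_cls_iff [OF ABC(2,3) g] by blast
    obtain v where v: "v \<in> proj_ideal \<C> \<K> A B" "f' = v \<oplus>\<^bsub>Hom \<C> A B\<^esub> f"
      using f' mem_cls_iff [OF ABC(1,2) f] by blast
    have mor: "u \<in> Mor \<C> B C" "v \<in> Mor \<C> A B"
      using subsetD [OF proj_ideal_subset] u(1) v(1) ABC by blast+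
    have f'M: "f' \<in> Mor \<C> A B" using hom_add_closed [OF ABC(1,2) mor(2) f] v by simp
    have "Comp \<C> A B C g' f' = Comp \<C> A B C u f' \<oplus>\<^bsub>Hom \<C> A C\<^esub> Comp \<C> A B C g f'"
      unfolding u(2) by (rule comp_add_left [OF ABC f'M mor(1) g])
    moreover have "Comp \<C> A B C g f' = Comp \<C> A B C g v \<oplus>\<^bsub>Hom \<C> A C\<^esub> Comp \<C> A B C g f"
      unfolding v(2) by (rule comp_add_right [OF ABC mor(2) f g])
    moreover have "Comp \<C> A B C u f' \<in> proj_ideal \<C> \<K> A C"
      by (rule proj_ideal_comp_right [OF ABC u(1) f'M])
    moreover have "Comp \<C> A B C g v \<in> proj_ideal \<C> \<K> A C"
      by (rule proj_ideal_comp_left [OF ABC v(1) g])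
    ultimately show ?thesis
      using cls_cong [OF ABC(1,3)] comp_closed [OF ABC f g] comp_closed [OF ABC f'M g] by simp
  qed
  have "Comp \<D> A B C (cls B C g) (cls A B f)
      = (\<Union>g'\<in>cls B C g. \<Union>f'\<in>cls A B f. cls A C (Comp \<C> A B C g' f'))"
    by (simp add: stable_category_def cls_def)
  also have "\<dots> = (\<Union>g'\<in>cls B C g. \<Union>f'\<in>cls A B f. cls A C (Comp \<C> A B C g f))"
    by (intro SUP_cong refl *)
  also have "\<dots> = cls A C (Comp \<C> A B C g f)"
    using cls_self [OF ABC(1,2) f] cls_self [OF ABC(2,3) g] by blast
  finally show ?thesis .
qed

lemma stable_linear_category: "linear_category R \<D>"
proof (rule linear_category.intro)
  fix A assume "A \<in> Obj \<D>"
  then have A: "A \<in> Obj \<C>" by (simp add: stable_simps)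
  show "Id \<D> A \<in> Mor \<D> A A"
    unfolding stable_simps(3) by (rule cls_closed [OF A A id_closed [OF A]])
  fix B assume "B \<in> Obj \<D>"
  then have B: "B \<in> Obj \<C>" by (simp add: stable_simps)
  show "module R (Hom \<D> A B)" by (rule stable_hom_module [OF A B])
  {
    fix f assume "f \<in> Mor \<D> A B"
    then obtain f' where f': "f' \<in> Mor \<C> A B" "f = cls A B f'" by (rule stable_MorE [OF A B])
    show "Comp \<D> A B B (Id \<D> B) f = f" "Comp \<D> A A B f (Id \<D> A) = f"
      unfolding f' stable_simps(3) using A B f' by (simp_all add: cls_comp id_closed comp_id_left comp_id_right)
  }
  fix C assume "C \<in> Obj \<D>"
  then have C: "C \<in> Obj \<C>" by (simp add: stable_simps)
  {
    fix f g assume "f \<in> Mor \<D> A B" and "g \<in> Mor \<D> B C"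
    then obtain f1 g1 where f1: "f1 \<in> Mor \<C> A B" "f = cls A B f1" and g1: "g1 \<in> Mor \<C> B C" "g = cls B C g1"
      using stable_MorE [OF A B] stable_MorE [OF B C] by metis
    note fg = A B C f1(1) g1(1)
    show "Comp \<D> A B C g f \<in> Mor \<D> A C"
      unfolding f1 g1 cls_comp [OF fg] by (rule cls_closed [OF A C comp_closed [OF fg]])
    {
      fix g' assume "g' \<in> Mor \<D> B C"
      then obtain g2 where g2: "g2 \<in> Mor \<C> B C" "g' = cls B C g2" by (rule stable_MorE [OF B C])
      show "Comp \<D> A B C (g \<oplus>\<^bsub>Hom \<D> B C\<^esub> g') f = Comp \<D> A B C g f \<oplus>\<^bsub>Hom \<D> A C\<^esub> Comp \<D> A B C g' f"
        unfolding f1 g1 g2 using fg g2(1)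
        by (simp add: cls_add cls_comp comp_add_left comp_closed hom_add_closed)
    }
    {
      fix f' assume "f' \<in> Mor \<D> A B"
      then obtain f2 where f2: "f2 \<in> Mor \<C> A B" "f' = cls A B f2" by (rule stable_MorE [OF A B])
      show "Comp \<D> A B C g (f \<oplus>\<^bsub>Hom \<D> A B\<^esub> f') = Comp \<D> A B C g f \<oplus>\<^bsub>Hom \<D> A C\<^esub> Comp \<D> A B C g f'"
        unfolding f1 g1 f2 using fg f2(1)
        by (simp add: cls_add cls_comp comp_add_right comp_closed hom_add_closed)
    }
    {
      fix r assume r: "r \<in> carrier R"
      show "Comp \<D> A B C (r \<odot>\<^bsub>Hom \<D> B C\<^esub> g) f = r \<odot>\<^bsub>Hom \<D> A C\<^esub> Comp \<D> A B C g f"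
        unfolding f1 g1 using fg r module.smult_closed [OF hom_module [OF B C] r g1(1)]
        by (simp add: cls_smult cls_comp comp_smult_left comp_closed)
      show "Comp \<D> A B C g (r \<odot>\<^bsub>Hom \<D> A B\<^esub> f) = r \<odot>\<^bsub>Hom \<D> A C\<^esub> Comp \<D> A B C g f"
        unfolding f1 g1 using fg r module.smult_closed [OF hom_module [OF A B] r f1(1)]
        by (simp add: cls_smult cls_comp comp_smult_right comp_closed)
    }
    fix D h assume "D \<in> Obj \<D>" "h \<in> Mor \<D> C D"
    then have D: "D \<in> Obj \<C>" by (simp add: stable_simps)
    obtain h1 where h1: "h1 \<in> Mor \<C> C D" "h = cls C D h1"
      using \<open>h \<in> Mor \<D> C D\<close> by (rule stable_MorE [OF C D])
    show "Comp \<D> A B D (Comp \<D> B C D h g) f = Comp \<D> A C D h (Comp \<D> A B C g f)"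
      unfolding f1 g1 h1 using fg D h1(1) by (simp add: cls_comp comp_closed comp_assoc)
  }
qed

lemma cls_finsum:
  assumes "A \<in> Obj \<C>" "B \<in> Obj \<C>" "finite J" "\<And>j. j \<in> J \<Longrightarrow> f j \<in> Mor \<C> A B"
  shows "(\<Oplus>\<^bsub>Hom \<D> A B\<^esub>j \<in> J. cls A B (f j)) = cls A B (\<Oplus>\<^bsub>Hom \<C> A B\<^esub>j \<in> J. f j)"
  using assms(3,4)
proof (induction J)
  case empty
  have AB: "A \<in> Obj \<D>" "B \<in> Obj \<D>" using assms by (simp_all add: stable_simps)
  show ?case
    by (simp add: linear_category.finsum_hom_empty [OF stable_linear_category AB]
        finsum_hom_empty [OF assms(1,2)] cls_zero [OF assms(1,2)])
next
  case (insert i J)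
  have AB: "A \<in> Obj \<D>" "B \<in> Obj \<D>" using assms by (simp_all add: stable_simps)
  have "(\<Oplus>\<^bsub>Hom \<D> A B\<^esub>j \<in> insert i J. cls A B (f j))
      = cls A B (f i) \<oplus>\<^bsub>Hom \<D> A B\<^esub> (\<Oplus>\<^bsub>Hom \<D> A B\<^esub>j \<in> J. cls A B (f j))"
    using insert by (intro linear_category.finsum_hom_insert [OF stable_linear_category AB] cls_closed assms(1,2)) auto
  also have "\<dots> = cls A B (f i) \<oplus>\<^bsub>Hom \<D> A B\<^esub> cls A B (\<Oplus>\<^bsub>Hom \<C> A B\<^esub>j \<in> J. f j)"
    using insert by simp
  also have "\<dots> = cls A B (f i \<oplus>\<^bsub>Hom \<C> A B\<^esub> (\<Oplus>\<^bsub>Hom \<C> A B\<^esub>j \<in> J. f j))"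
    using insert by (intro cls_add assms(1,2) finsum_hom_closed) auto
  also have "f i \<oplus>\<^bsub>Hom \<C> A B\<^esub> (\<Oplus>\<^bsub>Hom \<C> A B\<^esub>j \<in> J. f j) = (\<Oplus>\<^bsub>Hom \<C> A B\<^esub>j \<in> insert i J. f j)"
    using insert by (intro finsum_hom_insert [symmetric] assms(1,2)) auto
  finally show ?case .
qed

lemma stable_direct_sum:
  assumes "direct_sum \<C> J F Y \<iota> \<pi>"
  shows "direct_sum \<D> J F Y (\<lambda>j. cls (F j) Y (\<iota> j)) (\<lambda>j. cls Y (F j) (\<pi> j))"
proof -
  note D = direct_sumD [OF assms]
  have closed: "Comp \<C> Y (F j) Y (\<iota> j) (\<pi> j) \<in> Mor \<C> Y Y" if "j \<in> J" for j
    by (rule comp_closed [OF D(2) D(3) [OF that] D(2) D(5) [OF that] D(4) [OF that]])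
  have YD: "Y \<in> Obj \<D>" using D(2) by (simp add: stable_simps)
  have "(\<Oplus>\<^bsub>Hom \<D> Y Y\<^esub>j \<in> J. Comp \<D> Y (F j) Y (cls (F j) Y (\<iota> j)) (cls Y (F j) (\<pi> j)))
      = (\<Oplus>\<^bsub>Hom \<D> Y Y\<^esub>j \<in> J. cls Y Y (Comp \<C> Y (F j) Y (\<iota> j) (\<pi> j)))"
    using D closed
    by (intro linear_category.finsum_hom_cong [OF stable_linear_category YD YD]) (auto simp: cls_comp cls_closed)
  also have "\<dots> = Id \<D> Y"
    by (simp only: cls_finsum [OF D(2) D(2) D(1) closed] D(8) stable_simps(3))
  finally have sum: "(\<Oplus>\<^bsub>Hom \<D> Y Y\<^esub>j \<in> J. Comp \<D> Y (F j) Y (cls (F j) Y (\<iota> j)) (cls Y (F j) (\<pi> j))) = Id \<D> Y" .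
  show ?thesis
    unfolding direct_sum_def using D sum
    by (auto simp: cls_comp cls_closed cls_zero stable_simps(1,3))
qed

text \<open>Supplies the hypothesis \<open>sums\<close> of \<open>indecomposable_local\<close> for
  the stable category: biproducts remain biproducts after passing to classes.\<close>

lemma stable_finite_direct_sums:
  fixes n :: nat
  assumes "\<And>j. j < n \<Longrightarrow> F j \<in> Obj \<D>"
  shows "\<exists>Y. is_direct_sum \<D> {..<n} F Y"
  using finite_direct_sums [of n F] stable_direct_sum assms
  unfolding is_direct_sum_def stable_simps(1) by blast

end


subsection \<open>Endomorphism rings\<close>

text \<open>Translates the condition on ideals in \<open>noetherian_ring\<close> into spans: over a
  commutative ring, a submodule of the regular module is an ideal.\<close>

lemma noetherian_regular_module:
  assumes "cring R" "noetherian_ring R"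
  shows "noetherian_module R (regular_module R)"
  unfolding noetherian_module_def
proof (intro allI impI)
  interpret cring R by fact
  note reg = regular_module_simps [OF ring_axioms]
  interpret M: right_module R "regular_module R" by (rule right_module_regular [OF ring_axioms])
  have ideal: "ideal H R" if "submodule H R (regular_module R)" for H
  proof (rule idealI [OF ring_axioms])
    note D = M.submoduleD [OF that, unfolded reg]
    show "subgroup H (add_monoid R)"
    proof (rule subgroup.intro)
      show "inv\<^bsub>add_monoid R\<^esub> x \<in> H" if "x \<in> H" for x
      proof -
        have "x \<otimes>\<^bsub>R\<^esub> (\<ominus>\<^bsub>R\<^esub> \<one>\<^bsub>R\<^esub>) \<in> H" using D(4) [OF _ that] by simp
        moreover have "x \<otimes>\<^bsub>R\<^esub> (\<ominus>\<^bsub>R\<^esub> \<one>\<^bsub>R\<^esub>) = \<ominus>\<^bsub>R\<^esub> x" using D(1) that by (simp add: r_minus subsetD)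
        ultimately show ?thesis by (simp add: a_inv_def)
      qed
    qed (use D in auto)
    show "x \<otimes>\<^bsub>R\<^esub> a \<in> H" "a \<otimes>\<^bsub>R\<^esub> x \<in> H" if "a \<in> H" "x \<in> carrier R" for a x
      using D(4) [OF that(2,1)] m_comm [of x a] that D(1) by auto
  qed
  fix H assume "submodule H R (regular_module R)"
  then obtain A where A: "A \<subseteq> carrier R" "finite A" "H = Idl\<^bsub>R\<^esub> A"
    using noetherian_ring.finetely_gen [OF assms(2)] ideal by blast
  have A': "A \<subseteq> carrier (regular_module R)" using A(1) by (simp add: reg)
  have "H \<subseteq> mod_span R (regular_module R) A"
    unfolding A(3) using M.mod_span_superset [OF _ A']
    by (intro genideal_minimal ideal M.mod_span_submodule A') blast
  then show "\<exists>A \<subseteq> H. finite A \<and> H \<subseteq> mod_span R (regular_module R) A"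
    using A genideal_self [OF A(1)] by blast
qed

lemma End_ring_simps:
  "carrier (End_ring \<C> X) = Mor \<C> X X" "monoid.mult (End_ring \<C> X) = Comp \<C> X X X"
  "\<zero>\<^bsub>End_ring \<C> X\<^esub> = \<zero>\<^bsub>Hom \<C> X X\<^esub>"
  "add (End_ring \<C> X) = add (Hom \<C> X X)"
  by (simp_all add: End_ring_def)

lemma End_ring_one: "\<one>\<^bsub>End_ring \<C> X\<^esub> = Id \<C> X"
  by (simp add: End_ring_def)

text \<open>Right ideals of End(X) are R-submodules of Hom(X, X), hence finitely generated over R.
  The same finite sets generate them as right ideals.\<close>

lemma (in linear_category) noetherian_End_ring:
  assumes X: "X \<in> Obj \<C>" and "noetherian_ring R" "fin_gen R (Hom \<C> X X)"
  shows "noetherian_module (End_ring \<C> X) (regular_module (End_ring \<C> X))"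
  unfolding noetherian_module_def
proof (intro allI impI)
  let ?L = "End_ring \<C> X"
  interpret H: module R "Hom \<C> X X" by (rule hom_module [OF X X])
  interpret HR: right_module R "Hom \<C> X X" by (rule module_imp_right_module [OF hom_module [OF X X]])
  have L: "ring ?L" by (rule End_ring_is_ring [OF X])
  note reg = regular_module_simps [OF L] End_ring_simps
  interpret M: right_module ?L "regular_module ?L" by (rule right_module_regular [OF L])
  have noeth: "noetherian_module R (Hom \<C> X X)"
    by (rule HR.fin_gen_imp_noetherian [OF noetherian_regular_module [OF H.R.is_cring assms(2)] assms(3)])
  have sub: "submodule N R (Hom \<C> X X)" if "submodule N ?L (regular_module ?L)" for N
  proof (rule HR.submodule_criterion)
    note D = M.submoduleD [OF that, unfolded reg]
    show "N \<subseteq> Mor \<C> X X" by (rule D(1))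
    show "\<zero>\<^bsub>Hom \<C> X X\<^esub> \<in> N" by (rule D(2))
    show "x \<oplus>\<^bsub>Hom \<C> X X\<^esub> y \<in> N" if "x \<in> N" "y \<in> N" for x y using that by (rule D(3))
    show "r \<odot>\<^bsub>Hom \<C> X X\<^esub> x \<in> N" if r: "r \<in> carrier R" and x: "x \<in> N" for r x
    proof -
      have xX: "x \<in> Mor \<C> X X" using D(1) x by blast
      \<comment> \<open>Scalars act through composition with r times the identity, which is right
        multiplication in End(X).\<close>
      have "Comp \<C> X X X x (r \<odot>\<^bsub>Hom \<C> X X\<^esub> Id \<C> X) = r \<odot>\<^bsub>Hom \<C> X X\<^esub> x"
        using comp_smult_right [OF X X X r id_closed [OF X] xX] comp_id_right [OF X X xX] by simp
      then show ?thesis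
        using D(4) [OF H.smult_closed [OF r id_closed [OF X]] x] by simp
    qed
  qed
  fix N assume "submodule N ?L (regular_module ?L)"
  then obtain A where A: "A \<subseteq> N" "finite A" "N \<subseteq> mod_span R (Hom \<C> X X) A"
    using noeth sub unfolding noetherian_module_def by blast
  have AX: "A \<subseteq> carrier (regular_module ?L)"
    using A(1) M.submoduleD(1) [OF \<open>submodule N ?L (regular_module ?L)\<close>] by blast
  have "mod_span R (Hom \<C> X X) A \<subseteq> mod_span ?L (regular_module ?L) A"
    by (rule HR.mod_span_least [OF sub [OF M.mod_span_submodule [OF AX]]])
      (use M.mod_span_superset [OF _ AX] in blast)
  then show "\<exists>A \<subseteq> N. finite A \<and> N \<subseteq> mod_span ?L (regular_module ?L) A"
    using A by blast
qed

section \<open>The ideal of the contraction algebra and its local corners\<close>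

context exact_category
begin

lemma proj_ideal_is_ideal:
  assumes X: "X \<in> Obj \<C>"
  shows "ideal (proj_ideal \<C> \<K> X X) (End_ring \<C> X)"
proof (rule idealI [OF End_ring_is_ring [OF X]])
  show "subgroup (proj_ideal \<C> \<K> X X) (add_monoid (End_ring \<C> X))"
    using submodule.axioms(1) [OF proj_ideal_submodule [OF X X]]
    by (simp add: subgroup_def m_inv_def End_ring_def)
qed (simp_all add: End_ring_simps proj_ideal_comp_left proj_ideal_comp_right X)

text \<open>P lies in add P: take a single copy and a zero object as complement.\<close>

lemma progenerator_projective:
  assumes "additive_progenerator \<C> \<K> P"
  shows "proj_object \<C> \<K> P"
proof -
  have P: "P \<in> Obj \<C>" using assms by (simp add: additive_progenerator_def)
  obtain Z where "zero_object \<C> Z" using exists_zero_object by blast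
  then have Z: "Z \<in> Obj \<C>" "Id \<C> Z = \<zero>\<^bsub>Hom \<C> Z Z\<^esub>" by (auto simp: zero_object_def)
  note ids = P Z(1) id_closed [OF P] id_closed [OF Z(1)] hom_zero_closed [OF P Z(1)] hom_zero_closed [OF Z(1) P]
  have "direct_sum \<C> {..<1::nat} (\<lambda>_. P) P (\<lambda>_. Id \<C> P) (\<lambda>_. Id \<C> P)"
    using ids finsum_hom_insert [OF P P, of "{}" "0::nat" "\<lambda>_. Id \<C> P"]
    by (simp add: direct_sum_def comp_id_left lessThan_Suc finsum_hom_empty hom_add_zero)
  moreover have "is_binary_sum \<C> P Z P"
    by (rule binary_sumI [OF P Z(1) P ids(3,3,6,5)])
      (use ids Z in \<open>simp_all add: comp_id_left comp_id_right comp_zero_left comp_zero_right hom_add_zero\<close>)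
  ultimately have "in_add \<C> P P" unfolding in_add_def is_direct_sum_def by blast
  then show ?thesis using assms P by (auto simp: additive_progenerator_def)
qed

text \<open>A map through a projective passes through some P^n, so h is a sum of composites c_j d_j
  with d_j : X -> P and c_j : P -> X. As p i = 1, each is (c_j p)(i d_j), where right multiplication
  by i p fixes c_j p.\<close>

lemma proj_ideal_in_span:
  assumes X: "X \<in> Obj \<C>" and gen: "additive_progenerator \<C> \<K> P"
    and i: "i \<in> Mor \<C> P X" and p: "p \<in> Mor \<C> X P" and pi: "Comp \<C> P X P p i = Id \<C> P"
    and h: "h \<in> proj_ideal \<C> \<K> X X"
  shows "h \<in> mod_span (End_ring \<C> X) (regular_module (End_ring \<C> X))
    {b \<in> carrier (End_ring \<C> X). b \<otimes>\<^bsub>End_ring \<C> X\<^esub> Comp \<C> X P X i p = b}"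
    (is "_ \<in> mod_span ?L ?M ?B")
proof -
  have P: "P \<in> Obj \<C>" using gen by (simp add: additive_progenerator_def)
  have L: "ring ?L" by (rule End_ring_is_ring [OF X])
  note reg = regular_module_simps [OF L] End_ring_simps
  interpret M: right_module ?L ?M by (rule right_module_regular [OF L])
  define W where "W = ?B"
  have B: "W \<subseteq> carrier ?M" by (auto simp: W_def reg)
  note S = M.submoduleD [OF M.mod_span_submodule [OF B], unfolded reg]
  obtain Q f g where Q: "proj_object \<C> \<K> Q" "Q \<in> Obj \<C>" "f \<in> Mor \<C> X Q" "g \<in> Mor \<C> Q X"
    "h = Comp \<C> X Q X g f" using h by (rule proj_idealE)
  then have "in_add \<C> P Q" using gen by (auto simp: additive_progenerator_def)
  then obtain n Y C \<iota> \<pi> \<iota>' \<pi>' where ds: "direct_sum \<C> {..<n::nat} (\<lambda>_. P) Y \<iota> \<pi>"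
    and ds': "direct_sum \<C> UNIV (\<lambda>b. if b then Q else C) Y \<iota>' \<pi>'"
    unfolding in_add_def is_binary_sum_def is_direct_sum_def by blast
  note D = direct_sumD [OF ds]
  \<comment> \<open>\<open>True\<close> is the index of Q in the boolean family, so \<open>s\<close>
    and \<open>r\<close> exhibit Q as a retract of a finite sum of copies of P.\<close>
  define s where "s = \<iota>' True"
  define r where "r = \<pi>' True"
  have sr: "s \<in> Mor \<C> Q Y" "r \<in> Mor \<C> Y Q" "Comp \<C> Q Y Q r s = Id \<C> Q"
    using direct_sumD(4-6) [OF ds', of True] by (simp_all add: s_def r_def)
  define u where "u = Comp \<C> X Q Y s f"
  define v where "v = Comp \<C> Y Q X g r"
  have u: "u \<in> Mor \<C> X Y" unfolding u_def by (rule comp_closed [OF X Q(2) D(2) Q(3) sr(1)])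
  have v: "v \<in> Mor \<C> Y X" unfolding v_def by (rule comp_closed [OF D(2) Q(2) X sr(2) Q(4)])
  have vu: "Comp \<C> X Y X v u = h"
  proof -
    have "Comp \<C> X Y X v u = Comp \<C> X Q X g (Comp \<C> X Y Q r u)"
      unfolding v_def by (rule comp_assoc [OF X D(2) Q(2) X u sr(2) Q(4)])
    also have "Comp \<C> X Y Q r u = Comp \<C> X Q Q (Comp \<C> Q Y Q r s) f"
      unfolding u_def by (rule comp_assoc [OF X Q(2) D(2) Q(2) Q(3) sr(1,2), symmetric])
    also have "\<dots> = f" unfolding sr(3) by (rule comp_id_left [OF X Q(2,3)])
    finally show ?thesis using Q(5) by simp
  qed
  let ?d = "\<lambda>j. Comp \<C> X Y P (\<pi> j) u" and ?c = "\<lambda>j. Comp \<C> P Y X v (\<iota> j)"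
  have d: "?d j \<in> Mor \<C> X P" and c: "?c j \<in> Mor \<C> P X" if "j \<in> {..<n}" for j
    by (rule comp_closed [OF X D(2) P u D(5) [OF that]],
        rule comp_closed [OF P D(2) X D(4) [OF that] v])
  have u_eq: "u = (\<Oplus>\<^bsub>Hom \<C> X Y\<^esub>j \<in> {..<n}. Comp \<C> X P Y (\<iota> j) (?d j))"
  proof -
    have closed: "Comp \<C> Y P Y (\<iota> j) (\<pi> j) \<in> Mor \<C> Y Y" if "j \<in> {..<n}" for j
      by (rule comp_closed [OF D(2) P D(2) D(5) [OF that] D(4) [OF that]])
    have "u = Comp \<C> X Y Y (\<Oplus>\<^bsub>Hom \<C> Y Y\<^esub>j \<in> {..<n}. Comp \<C> Y P Y (\<iota> j) (\<pi> j)) u"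
      unfolding D(8) by (rule comp_id_left [OF X D(2) u, symmetric])
    also have "\<dots> = (\<Oplus>\<^bsub>Hom \<C> X Y\<^esub>j \<in> {..<n}. Comp \<C> X Y Y (Comp \<C> Y P Y (\<iota> j) (\<pi> j)) u)"
      by (rule comp_finsum_left [OF X D(2) D(2) u D(1) closed])
    also have "\<dots> = (\<Oplus>\<^bsub>Hom \<C> X Y\<^esub>j \<in> {..<n}. Comp \<C> X P Y (\<iota> j) (?d j))"
      using comp_closed [OF X P D(2) d D(4)] comp_assoc [OF X D(2) P D(2) u D(5) D(4)]
      by (intro finsum_hom_cong [OF X D(2)])
    finally show ?thesis .
  qed
  have "h = (\<Oplus>\<^bsub>Hom \<C> X X\<^esub>j \<in> {..<n}. Comp \<C> X Y X v (Comp \<C> X P Y (\<iota> j) (?d j)))"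
    unfolding vu [symmetric] by (subst u_eq) (rule comp_finsum_right [OF X D(2) X v D(1) comp_closed [OF X P D(2) d D(4)]])
  also have "\<dots> \<in> mod_span ?L ?M W"
  proof (rule finsum_hom_in [OF X X D(1) _ S(1-3)])
    fix j assume j: "j \<in> {..<n}"
    let ?b = "Comp \<C> X P X (?c j) p"
    have id: "Comp \<C> X P X i (?d j) \<in> Mor \<C> X X" by (rule comp_closed [OF X P X d [OF j] i])
    have b: "?b \<in> Mor \<C> X X" by (rule comp_closed [OF X P X p c [OF j]])
    have pip: "Comp \<C> X X P p (Comp \<C> X P X i x) = x" if "x \<in> Mor \<C> X P" for x
      using comp_assoc [OF X P X P that i p] comp_id_left [OF X P that] pi by simp
    have absorb: "Comp \<C> X X X ?b (Comp \<C> X P X i x) = Comp \<C> X P X (?c j) x" if "x \<in> Mor \<C> X P" for x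
      using comp_assoc [OF X X P X comp_closed [OF X P X that i] p c [OF j]] pip [OF that] by simp
    have "?b \<in> W" using b absorb [OF p] by (simp add: W_def End_ring_simps)
    then have "?b \<in> mod_span ?L ?M W" using M.mod_span_superset [OF _ B] by blast
    from S(4) [OF id this]
    have "Comp \<C> X P X (?c j) (?d j) \<in> mod_span ?L ?M W" using absorb [OF d [OF j]] by simp
    moreover have "Comp \<C> X P X (?c j) (?d j) = Comp \<C> X Y X v (Comp \<C> X P Y (\<iota> j) (?d j))"
      by (rule comp_assoc [OF X P D(2) X d [OF j] D(4) [OF j] v])
    ultimately show "Comp \<C> X Y X v (Comp \<C> X P Y (\<iota> j) (?d j)) \<in> mod_span ?L ?M W" by simp
  qed
  finally show ?thesis unfolding W_def .
qed

text \<open>The quotient ring is the endomorphism ring of X in the stable category, and the coset of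
  i p is the composite of the classes of i and p. There A is indecomposable and the Krull-Schmidt
  property makes its endomorphism ring local.\<close>

lemma stable_corner_local:
  assumes ks: "krull_schmidt \<D>" and indec: "indecomposable \<D> A"
    and X: "X \<in> Obj \<C>" and i: "i \<in> Mor \<C> A X" and p: "p \<in> Mor \<C> X A" and pi: "Comp \<C> A X A p i = Id \<C> A"
  shows "corner_local (End_ring \<C> X Quot proj_ideal \<C> \<K> X X)
    (proj_ideal \<C> \<K> X X +>\<^bsub>End_ring \<C> X\<^esub> Comp \<C> X A X i p)"
proof -
  interpret S: linear_category R \<D> by (rule stable_linear_category)
  have A: "A \<in> Obj \<D>" "\<not> zero_object \<D> A" using indec by (auto simp: indecomposable_def)
  then have AC: "A \<in> Obj \<C>" and XD: "X \<in> Obj \<D>" using X by (simp_all add: stable_simps)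
  have "Comp \<D> A X A (cls X A p) (cls A X i) = Id \<D> A"
    unfolding cls_comp [OF AC X AC i p] pi stable_simps(3) ..
  then have "corner_local (End_ring \<D> X) (Comp \<D> X A X (cls A X i) (cls X A p))"
    using S.indecomposable_local [OF indec ks] stable_finite_direct_sums
    by (intro S.corner_local_of_summand [OF A(1) XD A(2) cls_closed [OF AC X i] cls_closed [OF X AC p]]) auto
  moreover have "proj_ideal \<C> \<K> X X +>\<^bsub>End_ring \<C> X\<^esub> Comp \<C> X A X i p = cls X X (Comp \<C> X A X i p)"
    by (simp add: cls_def a_r_coset_def' End_ring_simps)
  ultimately show ?thesis
    unfolding contraction_algebra_def [symmetric] contraction_algebra_eq_stable_End
    by (simp add: cls_comp [OF X AC X p i])
qed

end

lemma dsum_mod_cong: "(\<And>i. i \<in> I \<Longrightarrow> M i = N i) \<Longrightarrow> dsum_mod I M = dsum_mod I N"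
  by (auto simp: dsum_mod_def fun_eq_iff cong: PiE_cong)

theorem theorem4p20:
  fixes R :: "'r ring" and \<mm> k :: "'r set" and \<omega> :: "('r, 'w) module" and d :: nat
    and \<E> :: "('r, 'o, 'm) lincat" and \<K> :: "('o, 'm) conflations"
    and P X :: 'o and Xs :: "nat \<Rightarrow> 'o" and a :: "nat \<Rightarrow> nat" and n :: nat
    and \<iota> \<pi> :: "nat \<times> nat \<Rightarrow> 'm" and e :: "nat \<Rightarrow> 'm"
    and M :: "('m, 'x) module"
  assumes "cohen_macaulay_local R \<mm>" and "krull_dim R = enat d"
    and "coefficient_field R \<mm> k" and "canonical_module R \<mm> \<omega>"
    and "hom_finite_linear_category R \<E>"
    and "frobenius_category R \<E> \<K>"
    and "idempotent_complete \<E>"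
    and "additive_progenerator \<E> \<K> P"
    and "krull_schmidt (stable_category \<E> \<K>)"
    and "\<And>i. i \<in> {1..n} \<Longrightarrow> a i > 0"
    and "\<And>i. i \<in> {1..n} \<Longrightarrow> indecomposable (stable_category \<E> \<K>) (Xs i)"
    and "\<And>i j. i \<in> {1..n} \<Longrightarrow> j \<in> {1..n} \<Longrightarrow> i \<noteq> j \<Longrightarrow>
           \<not> isomorphic (stable_category \<E> \<K>) (Xs i) (Xs j)"
    and "direct_sum \<E> (insert (0, 0) (SIGMA i:{1..n}. {..<a i}))
           (\<lambda>(i, j). if i = 0 then P else Xs i) X \<iota> \<pi>"
    and "\<And>i. i \<in> {1..n} \<Longrightarrow>
           \<exists>j < a i. e i = Comp \<E> X (Xs i) X (\<iota> (i, j)) (\<pi> (i, j))"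
    and "right_module (End_ring \<E> X) M" and "fin_gen (End_ring \<E> X) M"
  shows "\<exists>Q \<epsilon> f. fg_projective_resolution (End_ring \<E> X) M Q \<epsilon> f \<and>
           partially_minimal (End_ring \<E> X) (sum_of_simples \<E> \<K> X {1..n} e) Q f"
proof -
  interpret frobenius_category R \<E> \<K> by fact
  let ?L = "End_ring \<E> X" and ?J = "proj_ideal \<E> \<K> X X"
  define J where "J = insert (0, 0) (SIGMA i:{1..n}. {..<a i})"
  define F where "F = (\<lambda>(i, j :: nat). if i = (0::nat) then P else Xs i)"
  have ds: "direct_sum \<E> J F X \<iota> \<pi>" using assms(13) by (simp add: J_def F_def)
  note D = direct_sumD [OF ds]
  have X: "X \<in> Obj \<E>" by (rule D(2))
  have L: "ring ?L" by (rule End_ring_is_ring [OF X])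
  have "\<forall>i. \<exists>j. i \<in> {1..n} \<longrightarrow> j < a i \<and> e i = Comp \<E> X (Xs i) X (\<iota> (i, j)) (\<pi> (i, j))"
    using assms(14) by blast
  from choice [OF this] obtain j0 where
    j0: "\<And>i. i \<in> {1..n} \<Longrightarrow> j0 i < a i \<and> e i = Comp \<E> X (Xs i) X (\<iota> (i, j0 i)) (\<pi> (i, j0 i))"
    by blast
  \<comment> \<open>The index of one copy of each type: the summand P for i = 0, and for i >= 1 the
    copy of X_i by which \<open>e i\<close> is given.\<close>
  define t where "t i = (if i = 0 then (0, 0) else (i, j0 i))" for i
  define A where "A i = (if i = 0 then P else Xs i)" for i
  have tJ: "t i \<in> J" "F (t i) = A i" if "i \<le> n" for i
    using that j0 [of i] by (auto simp: t_def J_def F_def A_def)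
  define E where "E i = Comp \<E> X (A i) X (\<iota> (t i)) (\<pi> (t i))" for i
  have A: "A i \<in> Obj \<E>" "\<iota> (t i) \<in> Mor \<E> (A i) X" "\<pi> (t i) \<in> Mor \<E> X (A i)"
    "Comp \<E> (A i) X (A i) (\<pi> (t i)) (\<iota> (t i)) = Id \<E> (A i)" if "i \<le> n" for i
    using D(3-6) [OF tJ(1) [OF that]] by (simp_all add: tJ(2) [OF that])
  have E: "E i \<in> Mor \<E> X X" if "i \<le> n" for i
    unfolding E_def by (rule comp_closed [OF X A(1) X A(3,2)]) (rule that)+
  \<comment> \<open>Any composite through \<open>A i\<close> can be rewritten as a product in
    \<Lambda> passing through the chosen copy, because projection after inclusion is the identity
    there.\<close>
  have absorb: "Comp \<E> X X X (Comp \<E> X (A i) X x (\<pi> (t i))) (Comp \<E> X (A i) X (\<iota> (t i)) y) = Comp \<E> X (A i) X x y"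
    if "i \<le> n" "x \<in> Mor \<E> (A i) X" "y \<in> Mor \<E> X (A i)" for i x y
  proof -
    note Ai = A [OF that(1)]
    have "Comp \<E> X X (A i) (\<pi> (t i)) (Comp \<E> X (A i) X (\<iota> (t i)) y) = y"
      using comp_assoc [OF X Ai(1) X Ai(1) that(3) Ai(2,3)] comp_id_left [OF X Ai(1) that(3)] Ai(4) by simp
    then show ?thesis
      using comp_assoc [OF X X Ai(1) X comp_closed [OF X Ai(1) X that(3) Ai(2)] Ai(3) that(2)] by simp
  qed
  have eE: "e i = E i" if "i \<in> {1..n}" for i
    using j0 [OF that] that by (simp add: E_def A_def t_def)
  interpret C: contraction_setting ?L ?J E n
  proof (intro contraction_setting.intro contraction_setting_axioms.intro)
    show "ideal ?J ?L" by (rule proj_ideal_is_ideal [OF X])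
    have "noetherian_ring R" using assms(1) by (simp add: cohen_macaulay_local_def)
    then show "noetherian_module ?L (regular_module ?L)"
      using hom_finite_linear_category.hom_fin_gen [OF assms(5) X X] by (rule noetherian_End_ring [OF X])
    show "E i \<in> carrier ?L" if "i \<le> n" for i using E [OF that] by (simp add: End_ring_simps)
    show "E i \<otimes>\<^bsub>?L\<^esub> E i = E i" if "i \<le> n" for i
      using absorb [OF that A(2,3) [OF that]] by (simp add: End_ring_simps E_def)
    show "E 0 \<in> ?J"
      using proj_idealI [OF progenerator_projective [OF assms(8)], of "\<pi> (t 0)" X "\<iota> (t 0)" X] A [of 0]
      by (simp add: E_def A_def)
    show "?J \<subseteq> mod_span ?L (regular_module ?L) {b \<in> carrier ?L. b \<otimes>\<^bsub>?L\<^esub> E 0 = b}"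
      using proj_ideal_in_span [OF X assms(8), of "\<iota> (t 0)" "\<pi> (t 0)"] A [of 0]
      by (auto simp: E_def A_def)
    show "corner_local (?L Quot ?J) (?J +>\<^bsub>?L\<^esub> E i)" if i: "i \<in> {1..n}" for i
      unfolding E_def using assms(11) [OF i] A [of i] i
      by (intro stable_corner_local [OF assms(9) _ X]) (auto simp: A_def)
    \<comment> \<open>The union of the left ideals \<Lambda>e_i; as a right module it generates the
      sum of the two-sided ideals \<Lambda>e_i\<Lambda>.\<close>
    define W where "W = {b \<in> carrier ?L. \<exists>i\<le>n. b \<otimes>\<^bsub>?L\<^esub> E i = b}"
    interpret M: right_module ?L "regular_module ?L" by (rule right_module_regular [OF L])
    note reg = regular_module_simps [OF L] End_ring_simps
    have B: "W \<subseteq> carrier (regular_module ?L)" by (auto simp: W_def reg)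
    note S = M.submoduleD [OF M.mod_span_submodule [OF B], unfolded reg]
    have "(\<Oplus>\<^bsub>Hom \<E> X X\<^esub>j \<in> J. Comp \<E> X (F j) X (\<iota> j) (\<pi> j)) \<in> mod_span ?L (regular_module ?L) W"
    proof (rule finsum_hom_in [OF X X D(1) _ S(1-3)])
      fix j assume j: "j \<in> J"
      define i where "i = fst j"
      have i: "i \<le> n" and Fj: "F j = A i" using j by (auto simp: i_def J_def F_def A_def)
      note Ai = A [OF i]
      have \<iota>\<pi>: "\<iota> j \<in> Mor \<E> (A i) X" "\<pi> j \<in> Mor \<E> X (A i)" using D(4,5) [OF j] by (simp_all add: Fj)
      \<comment> \<open>The inclusion of copy \<open>j\<close> after the projection to the chosen
        copy of the same type. It lies in \<Lambda>e_i, and the idempotent of copy \<open>j\<close>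
        is a right multiple of it.\<close>
      let ?b = "Comp \<E> X (A i) X (\<iota> j) (\<pi> (t i))"
      have "?b \<in> W"
        using absorb [OF i \<iota>\<pi>(1) Ai(3)] comp_closed [OF X Ai(1) X Ai(3) \<iota>\<pi>(1)] i
        by (auto simp: W_def End_ring_simps E_def)
      then have "?b \<in> mod_span ?L (regular_module ?L) W" using M.mod_span_superset [OF _ B] by blast
      from S(4) [OF comp_closed [OF X Ai(1) X \<iota>\<pi>(2) Ai(2)] this]
      show "Comp \<E> X (F j) X (\<iota> j) (\<pi> j) \<in> mod_span ?L (regular_module ?L) W"
        using absorb [OF i \<iota>\<pi>] by (simp add: Fj)
    qed
    then show "\<one>\<^bsub>?L\<^esub> \<in> mod_span ?L (regular_module ?L)
        {b \<in> carrier ?L. \<exists>i\<le>n. b \<otimes>\<^bsub>?L\<^esub> E i = b}"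
      unfolding D(8) End_ring_one W_def .
  qed
  \<comment> \<open>\<open>E\<close> extends \<open>e\<close> by the idempotent of P at index 0; the
    sum of simples involves only 1..n, where the two agree.\<close>
  have "C.S = sum_of_simples \<E> \<K> X {1..n} e"
    unfolding sum_of_simples_def contraction_simple_def contraction_algebra_def
    using dsum_mod_cong [of "{1..n}" C.T "\<lambda>i. mod_top (?L Quot ?J)
        (right_principal (?L Quot ?J) (?J +>\<^bsub>?L\<^esub> e i))"] eE by simp
  then show ?thesis
    using C.exists_partially_minimal_resolution [OF assms(15,16)] by simp
qed

end
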